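(* Let $K<\infty$ (the number of particles per processing element) be fixed, and let $\pi_n^{MK}$ be the random measures produced by the distributed particle filter described in the context, with $M$ processing elements and exchange period $n_0$. Assume the following. (1) There exists a bounded sequence of positive real numbers $\{a_n\}_{n\ge 0}$ such that $\frac{1}{a_n}\le g_n^{y_n}(x)\le a_n$ for every $x\in\mathcal X$ (and every $n\ge 1$), and $a=\sup_{n\ge 0}a_n<\infty$. (2) For any probability measures $\alpha,\eta\in\mathcal P(\mathcal X)$ and every $h\in B(\mathcal X)$, $$\mathcal E(h,T)=\sup_{n\ge 0}\left|(h,\Psi_{n+T|n}(\alpha))-(h,\Psi_{n+T|n}(\eta))\right|<\infty \quad\text{and}\quad \lim_{T\to\infty}\mathcal E(h,T)=0 .$$ (3) The particle exchange step, with period $n_0$, guarantees that $$E\left[\left(\sup_{1\le m\le M}W_{rn_0}^{(m)}\right)^q\right]\le\frac{c^q}{M^{q-\epsilon}}\quad\text{for every } r\in\mathbb N$$ and some constants $c<\infty$, $0\le\epsilon<1$ and $q\ge 4$ independent of $M$. (4) For any $\alpha,\eta\in\mathcal P(\mathcal X)$ and every $h\in B(\mathcal X)$, there exist constants $T_0<\infty$ and $\nu>0$ such that $$\sup_{n\ge0}\left|(h,\Psi_{n+T|n}(\alpha))-(h,\Psi_{n+T|n}(\eta))\right|<\exp\{-\nu T\}\quad\text{for every } T>T_0 .$$ Then, for any $h\in B(\mathcal X)$ and $p\le q$, $$\sup_{n\ge0}\left\|(h,\pi_n^{MK})-(h,\pi_n)\right\|_p\le\frac{C}{M^{\zeta}K^{\frac12}}$$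 for some $C<\infty$ and $\zeta>0$ independent of $M$ and $K$. In particular, $$\zeta=\min\left\{1,\frac{\nu}{1+\log(a)}\right\}\Upsilon$$ for any $\Upsilon\in\left(\frac{1+\epsilon}{q},\ \frac12-\frac{1+\epsilon}{q}\right)$, with $\epsilon\in(0,1)$ and $q\ge4$ given by (3).
   Context: **State-space model.** $\mathcal X\subseteq\mathbb R^{d_x}$ is the state space, $\mathcal P(\mathcal X)$ the set of Borel probability measures on $\mathcal X$, $B(\mathcal X)$ the set of bounded real functions on $\mathcal X$, $\|h\|_\infty=\sup_{x\in\mathcal X}|h(x)|$. The model consists of a prior probability measure $\tau_0$ on $\mathcal X$, Markov kernels $\tau_n(dx|x_{n-1})$, $n\ge1$, from $\mathcal X$ to $\mathcal X$, and conditional densities $g_n(y|x)$ of the observation at time $n\ge 1$ (taking values in $\mathbb R^{d_y}$) given state $x$. The observation sequence $\{y_n\}_{n\ge1}$ is fixed, and $g_n^{y_n}(x)=g_n(y_n|x)$. For a measure $\alpha$ and an integrable $f$, $(f,\alpha)=\int f\,d\alpha$; for a kernel, $(f,\tau_n)$ denotes the function $x\mapsto\int f(x')\tau_n(dx'|x)$. For a real random variable $Z$ and $p\ge 1$, $\|Z\|_p=E[|Z|^p]^{1/p}$, where the expectation is over the randomness of the algorithm; only $p\ge1$ is considered. **Optimal filter.** $\Psi_n:\mathcal P(\mathcal X)\to\mathcal P(\mathcal X)$ is defined by $(h,\Psi_n(\alpha))=\dfrac{((hg_n^{y_n},\tau_n),\alpha)}{((g_n^{y_n},\tau_n),\alpha)}$.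 For $s<n$, $\Psi_{n|s}=\Psi_n\circ\Psi_{n-1}\circ\cdots\circ\Psi_{s+1}$, and $\Psi_{n|n}$ is the identity. The filter measures (posterior distributions of the state at time $n$ given $y_1,\dots,y_n$) are $\pi_0=\tau_0$, $\pi_n=\Psi_n(\pi_{n-1})$, $n\ge1$. **Distributed particle filter** with $M$ processing elements (PEs), $K$ particles per PE, exchange period $n_0\ge1$, and a deterministic one-to-one exchange map $\beta:\{1,\dots,M\}\times\{1,\dots,K\}\to\{1,\dots,M\}\times\{1,\dots,K\}$: - Initialization: draw $x_0^{(m,k)}\sim\tau_0$ independently, and set $w_0^{(m,k)*}=\frac1{MK}$, $W_0^{(m)*}=\frac1M$, for all $1\le m\le M$, $1\le k\le K$. - For $n\ge1$, given $\{x_{n-1}^{(m,k)},w_{n-1}^{(m,k)*}\}$: (a) draw (conditionally independently) $\bar x_n^{(m,k)}\sim\tau_n(dx|x_{n-1}^{(m,k)})$, and compute $\bar w_n^{(m,k)*}=w_{n-1}^{(m,k)*}g_n^{y_n}(\bar x_n^{(m,k)})$ and $\bar W_n^{(m)*}=\sum_{k=1}^K\bar w_n^{(m,k)*}$; (b) local multinomial resampling: for each $m$ and each $k$, conditionally independently, set $\tilde x_n^{(m,k)}=\bar x_n^{(m,j)}$ with probability $\bar w_n^{(m,j)*}/\bar W_n^{(m)*}$, $j\in\{1,\dots,K\}$; set $\tilde w_n^{(m,k)*}=\bar W_n^{(m)*}/K$; (c) particle exchange: if $n=rn_0$ for some $r\in\mathbb N$, set $x_n^{\beta(m,k)}=\tilde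 x_n^{(m,k)}$ and $w_n^{\beta(m,k)*}=\tilde w_n^{(m,k)*}$ for all $(m,k)$, and $W_n^{(m)*}=\sum_{k=1}^Kw_n^{(m,k)*}$; otherwise set $x_n^{(m,k)}=\tilde x_n^{(m,k)}$, $w_n^{(m,k)*}=\tilde w_n^{(m,k)*}$, $W_n^{(m)*}=\bar W_n^{(m)*}$. Normalized aggregate weights: $W_n^{(m)}=W_n^{(m)*}/\sum_{i=1}^MW_n^{(i)*}$. Locally normalized weights: $w_n^{(m,k)}=w_n^{(m,k)*}/\sum_{i=1}^Kw_n^{(m,i)*}$. The global approximation of $\pi_n$ is $$\pi_n^{MK}=\sum_{m=1}^MW_n^{(m)}\sum_{k=1}^Kw_n^{(m,k)}\delta_{x_n^{(m,k)}} .$$ All these quantities depend on $M$ although this is not shown in the notation.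
   Formalization: In (4) the constants T_0 and ν are taken to depend only on h, uniformly over all α and η; if T_0 may depend on the pair (α, η), the claim fails, and ν in the formula for ζ would have no meaning if it depended on α and η. *)

theory Defs
  imports "HOL-Probability.Probability"
begin

section \<open>State-space model and optimal filter\<close>

abbreviation borel_on :: "'x::topological_space set \<Rightarrow> 'x measure"
  where "borel_on X \<equiv> restrict_space borel X"

definition bounded_functions :: "'x measure \<Rightarrow> ('x \<Rightarrow> real) set"
  where "bounded_functions S = {h \<in> borel_measurable S. bounded (h ` space S)}"

text \<open>\<open>S\<close> is the state space as a measurable space, \<open>g n y x\<close> stands for \<open>g\<^sub>n(y|x)\<close>.\<close>

locale state_space_model =
  fixes S :: "'x measure"
    and \<tau>\<^sub>0 :: "'x measure"
    and \<tau> :: "nat \<Rightarrow> 'x \<Rightarrow> 'x measure"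
    and g :: "nat \<Rightarrow> 'y::euclidean_space \<Rightarrow> 'x \<Rightarrow> real"
  assumes prior: "\<tau>\<^sub>0 \<in> space (prob_algebra S)"
    and kernel: "\<And>n. 1 \<le> n \<Longrightarrow> \<tau> n \<in> S \<rightarrow>\<^sub>M prob_algebra S"
    and g_measurable: "\<And>n y. 1 \<le> n \<Longrightarrow> g n y \<in> borel_measurable S"
    and g_measurable_obs: "\<And>n x. 1 \<le> n \<Longrightarrow> x \<in> space S \<Longrightarrow> (\<lambda>y. g n y x) \<in> borel_measurable borel"
    and g_nonneg: "\<And>n y x. 1 \<le> n \<Longrightarrow> x \<in> space S \<Longrightarrow> 0 \<le> g n y x"
    and g_density: "\<And>n x. 1 \<le> n \<Longrightarrow> x \<in> space S \<Longrightarrow> (\<integral>\<^sup>+y. ennreal (g n y x) \<partial>lborel) = 1"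

text \<open>
  The map \<open>\<Psi>\<^sub>n\<close>: Bayes' rule applied to the predictive measure \<open>\<alpha>\<tau>\<^sub>n\<close>.  See
  \<open>integral_filter_map\<close> below for the characterisation by integrals of test functions.
\<close>

definition filter_map ::
  "(nat \<Rightarrow> 'x \<Rightarrow> 'x measure) \<Rightarrow> (nat \<Rightarrow> 'y \<Rightarrow> 'x \<Rightarrow> real) \<Rightarrow> (nat \<Rightarrow> 'y) \<Rightarrow> nat
    \<Rightarrow> 'x measure \<Rightarrow> 'x measure"
  where "filter_map \<tau> g y n \<alpha> =
    density (\<alpha> \<bind> \<tau> n)
      (\<lambda>x. ennreal (g n (y n) x / (\<integral>x'. (\<integral>x''. g n (y n) x'' \<partial>\<tau> n x') \<partial>\<alpha>)))"

text \<open>\<open>filter_comp \<tau> g y n s\<close> is \<open>\<Psi>\<^sub>n\<^sub>|\<^sub>s = \<Psi>\<^sub>n \<circ> \<dots> \<circ> \<Psi>\<^sub>s\<^sub>+\<^sub>1\<close>, and the identity for \<open>n \<le> s\<close>.\<close>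

primrec filter_comp ::
  "(nat \<Rightarrow> 'x \<Rightarrow> 'x measure) \<Rightarrow> (nat \<Rightarrow> 'y \<Rightarrow> 'x \<Rightarrow> real) \<Rightarrow> (nat \<Rightarrow> 'y) \<Rightarrow> nat \<Rightarrow> nat
    \<Rightarrow> 'x measure \<Rightarrow> 'x measure"
  where
    "filter_comp \<tau> g y 0 s = id"
  | "filter_comp \<tau> g y (Suc n) s =
      (if s < Suc n then filter_map \<tau> g y (Suc n) \<circ> filter_comp \<tau> g y n s else id)"

primrec filter_measure ::
  "'x measure \<Rightarrow> (nat \<Rightarrow> 'x \<Rightarrow> 'x measure) \<Rightarrow> (nat \<Rightarrow> 'y \<Rightarrow> 'x \<Rightarrow> real) \<Rightarrow> (nat \<Rightarrow> 'y) \<Rightarrow> nat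
    \<Rightarrow> 'x measure"
  where
    "filter_measure \<tau>\<^sub>0 \<tau> g y 0 = \<tau>\<^sub>0"
  | "filter_measure \<tau>\<^sub>0 \<tau> g y (Suc n) = filter_map \<tau> g y (Suc n) (filter_measure \<tau>\<^sub>0 \<tau> g y n)"

text \<open>
  The quantity \<open>sup\<^sub>n \<bar>(h, \<Psi>\<^sub>n\<^sub>+\<^sub>T\<^sub>|\<^sub>n(\<alpha>)) - (h, \<Psi>\<^sub>n\<^sub>+\<^sub>T\<^sub>|\<^sub>n(\<eta>))\<bar>\<close>, taken in the extended reals so that
  its finiteness is a genuine statement.
\<close>

definition filter_gap ::
  "(nat \<Rightarrow> 'x \<Rightarrow> 'x measure) \<Rightarrow> (nat \<Rightarrow> 'y \<Rightarrow> 'x \<Rightarrow> real) \<Rightarrow> (nat \<Rightarrow> 'y)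
    \<Rightarrow> 'x measure \<Rightarrow> 'x measure \<Rightarrow> ('x \<Rightarrow> real) \<Rightarrow> nat \<Rightarrow> ereal"
  where "filter_gap \<tau> g y \<alpha> \<eta> h T =
    (SUP n. ereal \<bar>(\<integral>x. h x \<partial>filter_comp \<tau> g y (n + T) n \<alpha>) -
                   (\<integral>x. h x \<partial>filter_comp \<tau> g y (n + T) n \<eta>)\<bar>)"


section \<open>Distributed particle filter\<close>

text \<open>
  A configuration \<open>(x, w)\<close> of the algorithm consists of the particles \<open>x (m, k)\<close> and the
  unnormalised weights \<open>w (m, k)\<close>, for \<open>(m, k)\<close> in \<open>pe_index M K\<close>.  The configuration at time \<open>n\<close>
  is a Markov chain; the steps below are its transition kernels and \<open>dpf_law\<close> is its law at
  time \<open>n\<close>.  Weights live in \<open>{0<..}\<close>, which is where they stay for positive likelihoods and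
  where the resampling probabilities are well defined.
\<close>

type_synonym 'x config = "(nat \<times> nat \<Rightarrow> 'x) \<times> (nat \<times> nat \<Rightarrow> real)"

definition pe_index :: "nat \<Rightarrow> nat \<Rightarrow> (nat \<times> nat) set"
  where "pe_index M K = {1..M} \<times> {1..K}"

definition config_space :: "'x measure \<Rightarrow> nat \<Rightarrow> nat \<Rightarrow> 'x config measure"
  where "config_space S M K =
    PiM (pe_index M K) (\<lambda>_. S) \<Otimes>\<^sub>M PiM (pe_index M K) (\<lambda>_. borel_on {0<..})"

text \<open>
  The unnormalised aggregate weight of PE \<open>m\<close>.  It can be computed from the particle weights at
  every stage: if there is no exchange, all \<open>K\<close> resampled weights of a PE equal the \<open>K\<close>-th part of
  its aggregate, and initially \<open>K\<close> weights \<open>1/(MK)\<close> sum to \<open>1/M\<close>.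
\<close>

definition pe_weight :: "nat \<Rightarrow> (nat \<times> nat \<Rightarrow> real) \<Rightarrow> nat \<Rightarrow> real"
  where "pe_weight K w m = (\<Sum>k\<in>{1..K}. w (m, k))"

definition normalized_pe_weight :: "nat \<Rightarrow> nat \<Rightarrow> (nat \<times> nat \<Rightarrow> real) \<Rightarrow> nat \<Rightarrow> real"
  where "normalized_pe_weight M K w m = pe_weight K w m / (\<Sum>i\<in>{1..M}. pe_weight K w i)"

definition local_weight :: "nat \<Rightarrow> (nat \<times> nat \<Rightarrow> real) \<Rightarrow> nat \<times> nat \<Rightarrow> real"
  where "local_weight K w i = w i / pe_weight K w (fst i)"

definition init_law :: "'x measure \<Rightarrow> 'x measure \<Rightarrow> nat \<Rightarrow> nat \<Rightarrow> 'x config measure"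
  where "init_law S \<tau>\<^sub>0 M K =
    distr (PiM (pe_index M K) (\<lambda>_. \<tau>\<^sub>0)) (config_space S M K)
      (\<lambda>x. (x, \<lambda>i\<in>pe_index M K. 1 / (real M * real K)))"

definition sampling_step ::
  "'x measure \<Rightarrow> (nat \<Rightarrow> 'x \<Rightarrow> 'x measure) \<Rightarrow> (nat \<Rightarrow> 'y \<Rightarrow> 'x \<Rightarrow> real) \<Rightarrow> (nat \<Rightarrow> 'y)
    \<Rightarrow> nat \<Rightarrow> nat \<Rightarrow> nat \<Rightarrow> 'x config \<Rightarrow> 'x config measure"
  where "sampling_step S \<tau> g y M K n s =
    distr (PiM (pe_index M K) (\<lambda>i. \<tau> n (fst s i))) (config_space S M K)
      (\<lambda>x. (x, \<lambda>i\<in>pe_index M K. snd s i * g n (y n) (x i)))"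

text \<open>\<open>A (m, k)\<close> is the index \<open>j\<close> of the particle of PE \<open>m\<close> that is copied to position \<open>(m, k)\<close>.\<close>

definition resampling_step :: "'x measure \<Rightarrow> nat \<Rightarrow> nat \<Rightarrow> 'x config \<Rightarrow> 'x config measure"
  where "resampling_step S M K s =
    distr
      (PiM (pe_index M K) (\<lambda>(m, k). point_measure {1..K} (\<lambda>j. ennreal (local_weight K (snd s) (m, j)))))
      (config_space S M K)
      (\<lambda>A. (\<lambda>i\<in>pe_index M K. fst s (fst i, A i),
            \<lambda>i\<in>pe_index M K. pe_weight K (snd s) (fst i) / real K))"

text \<open>Particle and weight number \<open>i\<close> are sent to position \<open>\<beta> i\<close>.\<close>

definition exchange ::
  "(nat \<times> nat \<Rightarrow> nat \<times> nat) \<Rightarrow> nat \<Rightarrow> nat \<Rightarrow> 'x config \<Rightarrow> 'x config"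
  where "exchange \<beta> M K s =
    (\<lambda>i\<in>pe_index M K. fst s (inv_into (pe_index M K) \<beta> i),
     \<lambda>i\<in>pe_index M K. snd s (inv_into (pe_index M K) \<beta> i))"

definition exchange_step ::
  "'x measure \<Rightarrow> nat \<Rightarrow> (nat \<times> nat \<Rightarrow> nat \<times> nat) \<Rightarrow> nat \<Rightarrow> nat \<Rightarrow> nat \<Rightarrow> 'x config
    \<Rightarrow> 'x config measure"
  where "exchange_step S n\<^sub>0 \<beta> M K n s =
    return (config_space S M K) (if \<exists>r. n = r * n\<^sub>0 then exchange \<beta> M K s else s)"

primrec dpf_law ::
  "'x measure \<Rightarrow> 'x measure \<Rightarrow> (nat \<Rightarrow> 'x \<Rightarrow> 'x measure) \<Rightarrow> (nat \<Rightarrow> 'y \<Rightarrow> 'x \<Rightarrow> real) \<Rightarrow> (nat \<Rightarrow> 'y)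
    \<Rightarrow> nat \<Rightarrow> (nat \<times> nat \<Rightarrow> nat \<times> nat) \<Rightarrow> nat \<Rightarrow> nat \<Rightarrow> nat \<Rightarrow> 'x config measure"
  where
    "dpf_law S \<tau>\<^sub>0 \<tau> g y n\<^sub>0 \<beta> M K 0 = init_law S \<tau>\<^sub>0 M K"
  | "dpf_law S \<tau>\<^sub>0 \<tau> g y n\<^sub>0 \<beta> M K (Suc n) =
      dpf_law S \<tau>\<^sub>0 \<tau> g y n\<^sub>0 \<beta> M K n
        \<bind> sampling_step S \<tau> g y M K (Suc n)
        \<bind> resampling_step S M K
        \<bind> exchange_step S n\<^sub>0 \<beta> M K (Suc n)"

text \<open>The random measure \<open>\<pi>\<^sub>n\<^sup>M\<^sup>K\<close>: a weighted sum of Dirac measures; see \<open>integral_dpf_measure\<close> below.\<close>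

definition dpf_measure :: "'x measure \<Rightarrow> nat \<Rightarrow> nat \<Rightarrow> 'x config \<Rightarrow> 'x measure"
  where "dpf_measure S M K s =
    distr
      (point_measure (pe_index M K)
        (\<lambda>i. ennreal (normalized_pe_weight M K (snd s) (fst i) * local_weight K (snd s) i)))
      S (fst s)"

definition lp_norm :: "'a measure \<Rightarrow> real \<Rightarrow> ('a \<Rightarrow> real) \<Rightarrow> real"
  where "lp_norm P p Z = (\<integral>s. \<bar>Z s\<bar> powr p \<partial>P) powr (1 / p)"

definition dpf_error ::
  "'x measure \<Rightarrow> 'x measure \<Rightarrow> (nat \<Rightarrow> 'x \<Rightarrow> 'x measure) \<Rightarrow> (nat \<Rightarrow> 'y \<Rightarrow> 'x \<Rightarrow> real) \<Rightarrow> (nat \<Rightarrow> 'y)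
    \<Rightarrow> nat \<Rightarrow> (nat \<times> nat \<Rightarrow> nat \<times> nat) \<Rightarrow> nat \<Rightarrow> nat \<Rightarrow> real \<Rightarrow> ('x \<Rightarrow> real) \<Rightarrow> nat \<Rightarrow> real"
  where "dpf_error S \<tau>\<^sub>0 \<tau> g y n\<^sub>0 \<beta> M K p h n =
    lp_norm (dpf_law S \<tau>\<^sub>0 \<tau> g y n\<^sub>0 \<beta> M K n) p
      (\<lambda>s. (\<integral>x. h x \<partial>dpf_measure S M K s) - (\<integral>x. h x \<partial>filter_measure \<tau>\<^sub>0 \<tau> g y n))"

text \<open>The bound on the \<open>q\<close>-th moment of the largest normalised aggregate weight at exchange times.\<close>

definition max_weight_moment_bound ::
  "'x measure \<Rightarrow> 'x measure \<Rightarrow> (nat \<Rightarrow> 'x \<Rightarrow> 'x measure) \<Rightarrow> (nat \<Rightarrow> 'y \<Rightarrow> 'x \<Rightarrow> real) \<Rightarrow> (nat \<Rightarrow> 'y)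
    \<Rightarrow> nat \<Rightarrow> (nat \<times> nat \<Rightarrow> nat \<times> nat) \<Rightarrow> nat \<Rightarrow> nat \<Rightarrow> real \<Rightarrow> real \<Rightarrow> real \<Rightarrow> bool"
  where "max_weight_moment_bound S \<tau>\<^sub>0 \<tau> g y n\<^sub>0 \<beta> M K c \<epsilon> q \<longleftrightarrow>
    (\<forall>r. (\<integral>s. (MAX m\<in>{1..M}. normalized_pe_weight M K (snd s) m) powr q
            \<partial>dpf_law S \<tau>\<^sub>0 \<tau> g y n\<^sub>0 \<beta> M K (r * n\<^sub>0))
         \<le> c powr q / real M powr (q - \<epsilon>))"


section \<open>The definitions are well behaved\<close>

text \<open>
  Expectations are Bochner integrals, so the laws above are only meaningful if the kernels are
  measurable.  This is established here, together with the integral formulas for \<open>filter_map\<close>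
  and \<open>dpf_measure\<close>.
\<close>

lemma (in state_space_model) filter_normalizer_pos:
  assumes n: "1 \<le> n" and \<alpha>: "\<alpha> \<in> space (prob_algebra S)" and b: "0 < b"
    and bounds: "\<And>x. x \<in> space S \<Longrightarrow> 1 / b \<le> g n (y n) x \<and> g n (y n) x \<le> b"
  shows "0 < (\<integral>x. (\<integral>x'. g n (y n) x' \<partial>\<tau> n x) \<partial>\<alpha>)"
proof -
  note [measurable] = kernel[OF n] measurable_prob_algebraD[OF kernel[OF n]] g_measurable[OF n]
  have sets[measurable_cong]: "sets \<alpha> = sets S" and "prob_space \<alpha>"
    using \<alpha> by (auto simp: space_prob_algebra)
  then interpret \<alpha>: prob_space \<alpha> by simp
  have space: "space \<alpha> = space S" using sets by (rule sets_eq_imp_space_eq)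
  have *: "1 / b \<le> (\<integral>x'. g n (y n) x' \<partial>\<tau> n x) \<and> (\<integral>x'. g n (y n) x' \<partial>\<tau> n x) \<le> b"
    if x: "x \<in> space S" for x
  proof -
    have t: "sets (\<tau> n x) = sets S" "prob_space (\<tau> n x)"
      using measurable_space[OF kernel[OF n] x] by (auto simp: space_prob_algebra)
    interpret t: prob_space "\<tau> n x" by fact
    have sp: "space (\<tau> n x) = space S" using t(1) by (rule sets_eq_imp_space_eq)
    have gm: "g n (y n) \<in> borel_measurable (\<tau> n x)"
      using g_measurable[OF n] measurable_cong_sets[OF t(1) refl] by blast
    have "integrable (\<tau> n x) (g n (y n))"
      using bounds b sp by (intro t.integrable_const_bound[where B=b] gm)
        (auto intro!: AE_I2 simp: g_nonneg[OF n])
    then show ?thesis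
      using bounds sp by (auto intro!: t.integral_ge_const t.integral_le_const)
  qed
  have gm: "(\<lambda>x. (\<integral>x'. g n (y n) x' \<partial>\<tau> n x)) \<in> borel_measurable \<alpha>"
    by measurable
  have "integrable \<alpha> (\<lambda>x. (\<integral>x'. g n (y n) x' \<partial>\<tau> n x))"
    using * b space by (intro \<alpha>.integrable_const_bound[where B=b] gm AE_I2)
       (smt (verit) divide_pos_pos real_norm_def)
  then have "1 / b \<le> (\<integral>x. (\<integral>x'. g n (y n) x' \<partial>\<tau> n x) \<partial>\<alpha>)"
    using * space by (intro \<alpha>.integral_ge_const) auto
  moreover have "0 < 1 / b" using b by simp
  ultimately show ?thesis by linarith
qed

lemma (in state_space_model) integral_filter_map:
  assumes n: "1 \<le> n" and \<alpha>: "\<alpha> \<in> space (prob_algebra S)" and b: "0 < b"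
    and bounds: "\<And>x. x \<in> space S \<Longrightarrow> 1 / b \<le> g n (y n) x \<and> g n (y n) x \<le> b"
    and h: "h \<in> bounded_functions S"
  shows "(\<integral>x. h x \<partial>filter_map \<tau> g y n \<alpha>) =
    (\<integral>x. (\<integral>x'. h x' * g n (y n) x' \<partial>\<tau> n x) \<partial>\<alpha>) / (\<integral>x. (\<integral>x'. g n (y n) x' \<partial>\<tau> n x) \<partial>\<alpha>)"
proof -
  note [measurable] = measurable_prob_algebraD[OF kernel[OF n]] g_measurable[OF n]
  define Z where "Z = (\<integral>x. (\<integral>x'. g n (y n) x' \<partial>\<tau> n x) \<partial>\<alpha>)"
  have Z: "0 < Z" unfolding Z_def by (rule filter_normalizer_pos[where y=y, OF n \<alpha> b bounds])
  have sets[measurable_cong]: "sets \<alpha> = sets S" and "prob_space \<alpha>"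
    using \<alpha> by (auto simp: space_prob_algebra)
  then interpret \<alpha>: prob_space \<alpha> by simp
  have space: "space \<alpha> = space S" using sets by (rule sets_eq_imp_space_eq)
  have K: "\<tau> n \<in> \<alpha> \<rightarrow>\<^sub>M subprob_algebra S" by measurable
  have sb: "sets (\<alpha> \<bind> \<tau> n) = sets S"
    using subprob_space_kernel[OF K] sets_kernel[OF K] \<alpha>.not_empty by (intro sets_bind) auto
  have spb: "space (\<alpha> \<bind> \<tau> n) = space S" using sb by (rule sets_eq_imp_space_eq)
  have hm[measurable]: "h \<in> borel_measurable S" using h by (simp add: bounded_functions_def)
  obtain c where c: "\<And>x. x \<in> space S \<Longrightarrow> \<bar>h x\<bar> \<le> c"
    using h by (auto simp: bounded_functions_def bounded_iff)
  have hgb: "\<bar>h x * g n (y n) x\<bar> \<le> c * b" if "x \<in> space S" for x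
    unfolding abs_mult using c[OF that] bounds[OF that] g_nonneg[OF n that]
    by (intro mult_mono) auto
  have "(\<integral>x. h x \<partial>filter_map \<tau> g y n \<alpha>) = (\<integral>x. (g n (y n) x / Z) *\<^sub>R h x \<partial>(\<alpha> \<bind> \<tau> n))"
    unfolding filter_map_def Z_def[symmetric]
    using Z g_nonneg[OF n] spb
    by (intro integral_density AE_I2) (auto simp: measurable_cong_sets[OF sb refl])
  also have "\<dots> = (\<integral>x. h x * g n (y n) x \<partial>(\<alpha> \<bind> \<tau> n)) / Z"
    by (subst integral_divide_zero[symmetric]) (auto simp: mult.commute)
  also have "(\<integral>x. h x * g n (y n) x \<partial>(\<alpha> \<bind> \<tau> n)) = (\<integral>x. (\<integral>x'. h x' * g n (y n) x' \<partial>\<tau> n x) \<partial>\<alpha>)"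
    using hgb by (intro integral_bind[where K=S and B="c*b" and B'=1] K \<alpha>.finite_measure_axioms AE_I2)
      (auto simp: space intro!: subprob_space.subprob_emeasure_le_1 subprob_space_kernel[OF K])
  finally show ?thesis unfolding Z_def .
qed

lemma (in state_space_model) filter_map_in_prob_algebra:
  assumes n: "1 \<le> n" and \<alpha>: "\<alpha> \<in> space (prob_algebra S)" and b: "0 < b"
    and bounds: "\<And>x. x \<in> space S \<Longrightarrow> 1 / b \<le> g n (y n) x \<and> g n (y n) x \<le> b"
  shows "filter_map \<tau> g y n \<alpha> \<in> space (prob_algebra S)"
proof -
  note [measurable] = measurable_prob_algebraD[OF kernel[OF n]] g_measurable[OF n]
  have one: "(\<lambda>_. 1) \<in> bounded_functions S" by (auto simp: bounded_functions_def bounded_iff)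
  have sets[measurable_cong]: "sets \<alpha> = sets S" and "prob_space \<alpha>"
    using \<alpha> by (auto simp: space_prob_algebra)
  then interpret \<alpha>: prob_space \<alpha> by simp
  have K: "\<tau> n \<in> \<alpha> \<rightarrow>\<^sub>M subprob_algebra S" by measurable
  have sb: "sets (\<alpha> \<bind> \<tau> n) = sets S"
    using sets_kernel[OF K] \<alpha>.not_empty by (intro sets_bind) auto
  have s: "sets (filter_map \<tau> g y n \<alpha>) = sets S" by (simp add: filter_map_def sb)
  have 1: "measure (filter_map \<tau> g y n \<alpha>) (space (filter_map \<tau> g y n \<alpha>)) = 1"
    using integral_filter_map[where y=y, OF n \<alpha> b bounds one] filter_normalizer_pos[where y=y, OF n \<alpha> b bounds]
    by simp
  then have "emeasure (filter_map \<tau> g y n \<alpha>) (space (filter_map \<tau> g y n \<alpha>)) \<noteq> top"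
    by (auto simp: measure_def)
  with 1 have "emeasure (filter_map \<tau> g y n \<alpha>) (space (filter_map \<tau> g y n \<alpha>)) = 1"
    by (simp add: emeasure_eq_ennreal_measure)
  then show ?thesis using s by (auto simp: space_prob_algebra intro: prob_spaceI)
qed

lemma finite_pe_index [simp]: "finite (pe_index M K)" by (simp add: pe_index_def)

lemma integral_dpf_measure:
  assumes s: "s \<in> space (config_space S M K)" and h: "h \<in> borel_measurable S"
  shows "(\<integral>x. h x \<partial>dpf_measure S M K s) =
    (\<Sum>m\<in>{1..M}. normalized_pe_weight M K (snd s) m * (\<Sum>k\<in>{1..K}. local_weight K (snd s) (m, k) * h (fst s (m, k))))"
proof -
  have x: "fst s i \<in> space S" and w: "0 < snd s i" if "i \<in> pe_index M K" for i
    using s that by (auto simp: config_space_def space_pair_measure space_PiM space_restrict_space PiE_iff)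
  have pos: "0 \<le> pe_weight K (snd s) m" if "m \<in> {1..M}" for m
    unfolding pe_weight_def using that w by (intro sum_nonneg) (force simp: pe_index_def)
  have "0 \<le> normalized_pe_weight M K (snd s) (fst i) * local_weight K (snd s) i" if i: "i \<in> pe_index M K" for i
  proof -
    have "fst i \<in> {1..M}" using i by (auto simp: pe_index_def)
    then show ?thesis unfolding normalized_pe_weight_def local_weight_def
      using w[OF i] pos by (intro mult_nonneg_nonneg divide_nonneg_nonneg sum_nonneg) auto
  qed
  moreover have "fst s \<in> point_measure (pe_index M K)
        (\<lambda>i. ennreal (normalized_pe_weight M K (snd s) (fst i) * local_weight K (snd s) i)) \<rightarrow>\<^sub>M S"
    using x by (auto simp: measurable_point_measure_eq1)
  ultimately have "(\<integral>x. h x \<partial>dpf_measure S M K s) =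
     (\<Sum>i\<in>pe_index M K. (normalized_pe_weight M K (snd s) (fst i) * local_weight K (snd s) i) *\<^sub>R h (fst s i))"
    unfolding dpf_measure_def using h
    by (simp only: integral_distr lebesgue_integral_point_measure_finite finite_pe_index)
  also have "\<dots> = (\<Sum>m\<in>{1..M}. \<Sum>k\<in>{1..K}.
      (normalized_pe_weight M K (snd s) m * local_weight K (snd s) (m, k)) *\<^sub>R h (fst s (m, k)))"
    unfolding pe_index_def sum.cartesian_product by (rule sum.cong) auto
  finally show ?thesis by (simp only: sum_distrib_left mult.assoc real_scaleR_def)
qed

lemma PiM_kernel:
  assumes I: "finite I" and \<kappa>: "\<And>i. i \<in> I \<Longrightarrow> \<kappa> i \<in> L \<rightarrow>\<^sub>M prob_algebra (N i)"
  shows "(\<lambda>s. PiM I (\<lambda>i. \<kappa> i s)) \<in> L \<rightarrow>\<^sub>M prob_algebra (PiM I N)"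
proof (rule measurable_prob_algebra_generated[OF sets_PiM Int_stable_prod_algebra prod_algebra_sets_into_space])
  fix s assume s: "s \<in> space L"
  have p: "prob_space (\<kappa> i s)" "sets (\<kappa> i s) = sets (N i)" if "i \<in> I" for i
    using measurable_space[OF \<kappa>[OF that] s] by (auto simp: space_prob_algebra)
  show "prob_space (PiM I (\<lambda>i. \<kappa> i s))" using p(1) by (intro prob_space_PiM)
  show "sets (PiM I (\<lambda>i. \<kappa> i s)) = sets (PiM I N)" using p(2) by (intro sets_PiM_cong) auto
next
  fix A assume "A \<in> prod_algebra I N"
  then obtain E where A: "A = Pi\<^sub>E I E" and E: "\<And>i. i \<in> I \<Longrightarrow> E i \<in> sets (N i)"
    unfolding prod_algebra_eq_finite[OF I] by auto
  have "emeasure (PiM I (\<lambda>i. \<kappa> i s)) A = (\<Prod>i\<in>I. emeasure (\<kappa> i s) (E i))" if s: "s \<in> space L" for s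
  proof -
    define P where "P i = (if i \<in> I then \<kappa> i s else count_space {undefined})" for i
    have p: "prob_space (\<kappa> i s)" "sets (\<kappa> i s) = sets (N i)" if "i \<in> I" for i
      using measurable_space[OF \<kappa>[OF that] s] by (auto simp: space_prob_algebra)
    have "prob_space (P i)" for i
      using p by (cases "i \<in> I") (auto simp: P_def intro!: prob_spaceI)
    then interpret product_prob_space P I
      by (simp add: product_prob_space_def product_prob_space_axioms_def product_sigma_finite_def prob_space_imp_sigma_finite)
    have "PiM I (\<lambda>i. \<kappa> i s) = PiM I P" by (rule PiM_cong) (auto simp: P_def)
    moreover have "emeasure (PiM I P) A = (\<Prod>i\<in>I. emeasure (P i) (E i))"
      unfolding A using I E p by (intro emeasure_PiM) (auto simp: P_def)
    moreover have "\<dots> = (\<Prod>i\<in>I. emeasure (\<kappa> i s) (E i))" by (simp add: P_def)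
    ultimately show ?thesis by simp
  qed
  moreover have "(\<lambda>s. \<Prod>i\<in>I. emeasure (\<kappa> i s) (E i)) \<in> borel_measurable L"
    using \<kappa>[THEN measurable_prob_algebraD] E
    by (intro borel_measurable_prod_ennreal)
      (auto intro: measurable_compose[OF _ measurable_emeasure_subprob_algebra])
  ultimately show "(\<lambda>s. emeasure (PiM I (\<lambda>i. \<kappa> i s)) A) \<in> borel_measurable L"
    by (subst measurable_cong) auto
qed

lemma measurable_particle: "i \<in> pe_index M K \<Longrightarrow> (\<lambda>s. fst s i) \<in> config_space S M K \<rightarrow>\<^sub>M S"
  unfolding config_space_def by measurable

lemma measurable_weight_pos: "i \<in> pe_index M K \<Longrightarrow> (\<lambda>s. snd s i) \<in> config_space S M K \<rightarrow>\<^sub>M borel_on {0<..}"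
  unfolding config_space_def by measurable

lemma measurable_weight: "i \<in> pe_index M K \<Longrightarrow> (\<lambda>s. snd s i) \<in> borel_measurable (config_space S M K)"
  using measurable_weight_pos[of i M K S] by (simp add: measurable_restrict_space2_iff)

lemma weight_pos: "s \<in> space (config_space S M K) \<Longrightarrow> i \<in> pe_index M K \<Longrightarrow> 0 < snd s i"
  using measurable_space[OF measurable_weight_pos, of i M K s S] by (simp add: space_restrict_space)

lemma config_measurableI:
  assumes "\<And>i. i \<in> pe_index M K \<Longrightarrow> (\<lambda>s. f s i) \<in> L \<rightarrow>\<^sub>M S"
    and "\<And>i. i \<in> pe_index M K \<Longrightarrow> (\<lambda>s. v s i) \<in> borel_measurable L"
    and "\<And>i s. i \<in> pe_index M K \<Longrightarrow> s \<in> space L \<Longrightarrow> 0 < v s i"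
  shows "(\<lambda>s. (\<lambda>i\<in>pe_index M K. f s i, \<lambda>i\<in>pe_index M K. v s i)) \<in> L \<rightarrow>\<^sub>M config_space S M K"
  unfolding config_space_def
  using assms by (intro measurable_Pair measurable_restrict measurable_restrict_space2) auto

lemma pe_weight_pos:
  assumes "s \<in> space (config_space S M K)" "1 \<le> K" "m \<in> {1..M}"
  shows "0 < pe_weight K (snd s) m"
  unfolding pe_weight_def using assms
  by (intro sum_pos weight_pos[OF assms(1)]) (auto simp: pe_index_def)

lemma measurable_pe_weight:
  "m \<in> {1..M} \<Longrightarrow> (\<lambda>s. pe_weight K (snd s) m) \<in> borel_measurable (config_space S M K)"
  unfolding pe_weight_def by (intro borel_measurable_sum measurable_weight) (auto simp: pe_index_def)

lemma init_law_in_prob_algebra: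
  assumes "\<tau>\<^sub>0 \<in> space (prob_algebra S)" and "1 \<le> M" "1 \<le> K"
  shows "init_law S \<tau>\<^sub>0 M K \<in> space (prob_algebra (config_space S M K))"
proof -
  have t: "prob_space \<tau>\<^sub>0" "sets \<tau>\<^sub>0 = sets S" using assms by (auto simp: space_prob_algebra)
  have "(\<lambda>x. (x, \<lambda>i\<in>pe_index M K. 1 / (real M * real K))) \<in>
      PiM (pe_index M K) (\<lambda>_. \<tau>\<^sub>0) \<rightarrow>\<^sub>M config_space S M K"
    unfolding config_space_def using assms t
    by (intro measurable_Pair measurable_restrict measurable_restrict_space2)
      (auto simp: measurable_cong_sets[OF sets_PiM_cong[OF refl t(2)] refl])
  then show ?thesis
    unfolding init_law_def space_prob_algebra
    by (auto intro!: prob_space.prob_space_distr prob_space_PiM t(1))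
qed

lemma sampling_step_kernel:
  assumes t: "\<tau> n \<in> S \<rightarrow>\<^sub>M prob_algebra S" and g: "g n (y n) \<in> borel_measurable S"
    and pos: "\<And>x. x \<in> space S \<Longrightarrow> 0 < g n (y n) x"
  shows "sampling_step S \<tau> g y M K n \<in> config_space S M K \<rightarrow>\<^sub>M prob_algebra (config_space S M K)"
  unfolding sampling_step_def[abs_def]
proof (rule measurable_distr_prob_space2)
  let ?P = "PiM (pe_index M K) (\<lambda>_. S)" and ?C = "config_space S M K"
  show "(\<lambda>s. PiM (pe_index M K) (\<lambda>i. \<tau> n (fst s i))) \<in> ?C \<rightarrow>\<^sub>M prob_algebra ?P"
    by (intro PiM_kernel finite_pe_index measurable_compose[OF measurable_particle t])
  have x: "(\<lambda>p. snd p i) \<in> ?C \<Otimes>\<^sub>M ?P \<rightarrow>\<^sub>M S" if "i \<in> pe_index M K" for i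
    using that by measurable
  have "(\<lambda>p. (\<lambda>i\<in>pe_index M K. snd p i, \<lambda>i\<in>pe_index M K. snd (fst p) i * g n (y n) (snd p i)))
      \<in> ?C \<Otimes>\<^sub>M ?P \<rightarrow>\<^sub>M ?C"
  proof (intro config_measurableI x borel_measurable_times)
    fix i assume i: "i \<in> pe_index M K"
    show "(\<lambda>p. snd (fst p) i) \<in> borel_measurable (?C \<Otimes>\<^sub>M ?P)"
      by (rule measurable_compose[OF measurable_fst measurable_weight[OF i]])
    show "(\<lambda>p. g n (y n) (snd p i)) \<in> borel_measurable (?C \<Otimes>\<^sub>M ?P)"
      by (rule measurable_compose[OF x[OF i] g])
    fix p assume "p \<in> space (?C \<Otimes>\<^sub>M ?P)"
    then show "0 < snd (fst p) i * g n (y n) (snd p i)"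
      using weight_pos[of "fst p" S M K i] i pos measurable_space[OF x[OF i], of p]
      by (auto simp: space_pair_measure)
  qed
  then show "(\<lambda>(s, x). (x, \<lambda>i\<in>pe_index M K. snd s i * g n (y n) (x i))) \<in> ?C \<Otimes>\<^sub>M ?P \<rightarrow>\<^sub>M ?C"
    by (rule measurable_cong[THEN iffD1, rotated])
       (auto simp: space_pair_measure space_PiM PiE_restrict split_beta)
qed

lemma resampling_step_kernel:
  assumes K: "1 \<le> K"
  shows "resampling_step S M K \<in> config_space S M K \<rightarrow>\<^sub>M prob_algebra (config_space S M K)"
  unfolding resampling_step_def[abs_def]
proof (rule measurable_distr_prob_space2)
  let ?P = "PiM (pe_index M K) (\<lambda>_. count_space {1..K})" and ?C = "config_space S M K"
  let ?Q = "\<lambda>i s. point_measure {1..K} (\<lambda>j. ennreal (local_weight K (snd s) (fst i, j)))"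
  have "?Q i \<in> ?C \<rightarrow>\<^sub>M prob_algebra (count_space {1..K})" if i: "i \<in> pe_index M K" for i
  proof (rule measurable_prob_algebra_generated[where \<Omega>="{1..K}" and G="Pow {1..K}"])
    have m: "fst i \<in> {1..M}" using i by (auto simp: pe_index_def)
    have idx: "(fst i, j) \<in> pe_index M K" if "j \<in> {1..K}" for j using m that by (auto simp: pe_index_def)
    show "sets (count_space {1..K}) = sigma_sets {1..K} (Pow {1..K})"
      by (metis sets_count_space sigma_algebra.sigma_sets_eq sigma_algebra_Pow)
    show "Int_stable (Pow {1..K})" by (auto simp: Int_stable_def)
    show "Pow {1..K} \<subseteq> Pow {1..K}" by simp
    fix s assume s: "s \<in> space ?C"
    show "sets (?Q i s) = sets (count_space {1..K})" by (simp add: sets_point_measure)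
    have p: "0 < pe_weight K (snd s) (fst i)" using pe_weight_pos[OF s K m] .
    have "(\<Sum>j\<in>{1..K}. local_weight K (snd s) (fst i, j)) = 1"
      using p by (simp add: local_weight_def pe_weight_def sum_divide_distrib[symmetric])
    moreover have "0 \<le> local_weight K (snd s) (fst i, j)" if "j \<in> {1..K}" for j
      using p weight_pos[OF s idx[OF that]] by (simp add: local_weight_def)
    then have "(\<Sum>j\<in>{1..K}. ennreal (local_weight K (snd s) (fst i, j))) =
        ennreal (\<Sum>j\<in>{1..K}. local_weight K (snd s) (fst i, j))"
      by (intro sum_ennreal) auto
    ultimately show "prob_space (?Q i s)"
      by (intro prob_spaceI) (simp add: space_point_measure emeasure_point_measure_finite)
  next
    fix A assume A: "A \<in> Pow {1..K}"
    have m: "fst i \<in> {1..M}" using i by (auto simp: pe_index_def)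
    have "(\<lambda>s. ennreal (local_weight K (snd s) (fst i, j))) \<in> borel_measurable ?C" if "j \<in> A" for j
      unfolding local_weight_def fst_conv
      using that A m by (intro measurable_compose[OF _ measurable_ennreal] borel_measurable_divide measurable_weight
        measurable_pe_weight) (auto simp: pe_index_def)
    then show "(\<lambda>s. emeasure (?Q i s) A) \<in> borel_measurable ?C"
      using A by (simp add: emeasure_point_measure_finite borel_measurable_sum)
  qed
  then show "(\<lambda>s. PiM (pe_index M K) (\<lambda>(m, k). point_measure {1..K} (\<lambda>j. ennreal (local_weight K (snd s) (m, j)))))
      \<in> ?C \<rightarrow>\<^sub>M prob_algebra ?P"
    using PiM_kernel[of "pe_index M K" ?Q ?C "\<lambda>_. count_space {1..K}"] by (simp add: split_beta')
  have A: "(\<lambda>p. snd p i) \<in> ?C \<Otimes>\<^sub>M ?P \<rightarrow>\<^sub>M count_space {1..K}" if "i \<in> pe_index M K" for i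
    using that by measurable
  show "(\<lambda>(s, A). (\<lambda>i\<in>pe_index M K. fst s (fst i, A i), \<lambda>i\<in>pe_index M K. pe_weight K (snd s) (fst i) / real K))
      \<in> ?C \<Otimes>\<^sub>M ?P \<rightarrow>\<^sub>M ?C"
    unfolding split_beta'
  proof (rule config_measurableI)
    fix i assume i: "i \<in> pe_index M K"
    then have m: "fst i \<in> {1..M}" by (auto simp: pe_index_def)
    show "(\<lambda>p. fst (fst p) (fst i, snd p i)) \<in> ?C \<Otimes>\<^sub>M ?P \<rightarrow>\<^sub>M S"
    proof (rule measurable_compose_countable'[where f="\<lambda>j p. fst (fst p) (fst i, j)" and g="\<lambda>p. snd p i", OF _ A[OF i]])
      fix j assume "j \<in> {1..K}"
      then have "(fst i, j) \<in> pe_index M K" using m by (auto simp: pe_index_def)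
      then show "(\<lambda>p. fst (fst p) (fst i, j)) \<in> ?C \<Otimes>\<^sub>M ?P \<rightarrow>\<^sub>M S"
        by (rule measurable_compose[OF measurable_fst measurable_particle])
    qed simp
    show "(\<lambda>p. pe_weight K (snd (fst p)) (fst i) / real K) \<in> borel_measurable (?C \<Otimes>\<^sub>M ?P)"
      by (intro borel_measurable_divide measurable_compose[OF measurable_fst measurable_pe_weight[OF m]]) simp
    fix p assume "p \<in> space (?C \<Otimes>\<^sub>M ?P)"
    then show "0 < pe_weight K (snd (fst p)) (fst i) / real K"
      using pe_weight_pos[OF _ K m, of "fst p" S] K by (auto simp: space_pair_measure)
  qed
qed

lemma exchange_step_kernel:
  assumes "bij_betw \<beta> (pe_index M K) (pe_index M K)"
  shows "exchange_step S n\<^sub>0 \<beta> M K n \<in> config_space S M K \<rightarrow>\<^sub>M prob_algebra (config_space S M K)"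
proof -
  have i: "inv_into (pe_index M K) \<beta> i \<in> pe_index M K" if "i \<in> pe_index M K" for i
    using assms that by (metis bij_betw_imp_surj_on inv_into_into)
  have "exchange \<beta> M K \<in> config_space S M K \<rightarrow>\<^sub>M config_space S M K"
    unfolding exchange_def[abs_def]
    by (intro config_measurableI measurable_particle measurable_weight) (auto intro: i weight_pos)
  then show ?thesis
    unfolding exchange_step_def[abs_def]
    by (cases "\<exists>r. n = r * n\<^sub>0") (auto intro: measurable_compose[OF _ measurable_return_prob_space])
qed

lemma (in state_space_model) dpf_law_in_prob_algebra:
  assumes M: "1 \<le> M" and K: "1 \<le> K" and \<beta>: "bij_betw \<beta> (pe_index M K) (pe_index M K)"
    and pos: "\<And>n x. 1 \<le> n \<Longrightarrow> x \<in> space S \<Longrightarrow> 0 < g n (y n) x"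
  shows "dpf_law S \<tau>\<^sub>0 \<tau> g y n\<^sub>0 \<beta> M K n \<in> space (prob_algebra (config_space S M K))"
proof (induction n)
  case 0
  then show ?case using init_law_in_prob_algebra[OF prior M K] by simp
next
  case (Suc n)
  have bind: "\<mu> \<bind> \<kappa> \<in> space (prob_algebra N)"
    if "\<mu> \<in> space (prob_algebra N)" "\<kappa> \<in> N \<rightarrow>\<^sub>M prob_algebra N" for \<mu> \<kappa> and N :: "'a config measure"
    using measurable_space[OF measurable_bind_prob_space[OF measurable_ident that(2)] that(1)] by simp
  show ?case
    unfolding dpf_law.simps
    by (intro bind Suc.IH sampling_step_kernel resampling_step_kernel exchange_step_kernel
        kernel g_measurable pos K \<beta>) auto
qed

end

(*
  The maps Psi_{n|s} are ratios of linear functionals: with U the unnormalised semigroup and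
  G = U 1, (h, Psi_{n|s} alpha) = (U h, alpha) / (G, alpha).  Exponential stability bounds the
  oscillation of U h / G, but with a rate that depends on h.  The Banach-Steinhaus theorem turns it
  into forgetting that is uniform over test functions, at a summable (quadratic) rate; hence
  G x / G x' is bounded uniformly in the number of steps.  Writing the error at time n as a telescoping sum
  of one-step errors propagated by Psi, each term is then O(delta_T sqrt(largest particle weight)),
  where T is the number of remaining steps and delta_T is the oscillation bound for U h / G.
  Since delta_T is summable, the error is of the order M^{-1/2 + epsilon/(2q)} K^{-1/2} uniformly in
  time, which is at least as good as every rate zeta of the theorem.  Between exchanges the largest
  weight grows by at most a factor a^2 per step, and the exchange itself cannot increase the largest
  aggregate weight seen just before it.
*)

theory Submission
  imports Defs
begin

text \<open>The obstacle: stability is assumed for each test function separately, at a rate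
  \<open>\<nu> h\<close> without a lower bound over \<open>h\<close>, whereas comparing
  \<open>G T m x\<close> with \<open>G T m x'\<close> meets a new test function at every time.
  Indeed \<open>G (Suc T) m x / G T m x\<close> is the mean, under the filter started at the point
  x, of the predictive likelihood of observation m + T + 1. This is why forgetting has to be uniform
  over test functions. The weight (T + 1)^2 replaces the exponentials because one weight then serves
  every \<open>h\<close>, so that the weighted differences of filter integrals form a pointwise
  bounded family of linear functionals. The power 2 makes the rate summable, which is used twice:
  for the product of the ratios above and for the sum of propagated one-step errors. The ratio bound
  matters because a one-step error is the fluctuation of a quotient of weighted means: it depends on
  the denominator only through the quotient of its upper and lower bounds, so a \<open>G\<close>
  that is exponentially small in T does no harm as long as it is comparable at all points. The
  exponent reached, 1/2 - \<epsilon>/(2q), exceeds every \<Upsilon> below 1/2 - (1 + \<epsilon>)/q,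
  and the minimum in \<zeta> is at most 1.\<close>

section \<open>Moment bounds\<close>

text \<open>For \<open>R \<ge> 0\<close> this bounds the L^q norm of \<open>Z\<close> by
  \<open>R\<close>. The nonnegative integral gives it a meaning without integrability conditions and
  lets it pass through \<open>bind\<close> by the tower rule.\<close>

definition moment_le :: "'a measure \<Rightarrow> real \<Rightarrow> ('a \<Rightarrow> real) \<Rightarrow> real \<Rightarrow> bool"
  where "moment_le P q Z R \<longleftrightarrow> (\<integral>\<^sup>+x. ennreal (\<bar>Z x\<bar> powr q) \<partial>P) \<le> ennreal (R powr q)"

lemma moment_le_leI:
  assumes "moment_le P q Z R" "\<And>x. x \<in> space P \<Longrightarrow> \<bar>Y x\<bar> \<le> \<bar>Z x\<bar>" "0 \<le> q" "0 \<le> R" "R \<le> R'"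
  shows "moment_le P q Y R'"
proof -
  have "(\<integral>\<^sup>+x. ennreal (\<bar>Y x\<bar> powr q) \<partial>P) \<le> (\<integral>\<^sup>+x. ennreal (\<bar>Z x\<bar> powr q) \<partial>P)"
    using assms by (intro nn_integral_mono ennreal_leI powr_mono2) auto
  also have "\<dots> \<le> ennreal (R powr q)" using assms by (simp add: moment_le_def)
  also have "\<dots> \<le> ennreal (R' powr q)" using assms by (intro ennreal_leI powr_mono2) auto
  finally show ?thesis by (simp add: moment_le_def)
qed

lemma moment_le_scale:
  assumes "moment_le P q Z R" and [measurable]: "Z \<in> borel_measurable P"
    and "\<And>x. x \<in> space P \<Longrightarrow> \<bar>Y x\<bar> \<le> c * \<bar>Z x\<bar>" "0 \<le> q" "0 \<le> R" "0 \<le> c"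
  shows "moment_le P q Y (c * R)"
proof -
  have "(\<integral>\<^sup>+x. ennreal (\<bar>Y x\<bar> powr q) \<partial>P) \<le> (\<integral>\<^sup>+x. ennreal (c powr q) * ennreal (\<bar>Z x\<bar> powr q) \<partial>P)"
    using assms by (intro nn_integral_mono)
      (auto simp: ennreal_mult[symmetric] powr_mult[symmetric] intro!: ennreal_leI powr_mono2)
  also have "\<dots> = ennreal (c powr q) * (\<integral>\<^sup>+x. ennreal (\<bar>Z x\<bar> powr q) \<partial>P)"
    by (rule nn_integral_cmult) measurable
  also have "\<dots> \<le> ennreal (c powr q) * ennreal (R powr q)"
    using assms by (intro mult_left_mono) (auto simp: moment_le_def)
  also have "\<dots> = ennreal ((c * R) powr q)"
    using assms by (simp add: ennreal_mult[symmetric] powr_mult)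
  finally show ?thesis by (simp add: moment_le_def)
qed

lemma moment_le_const:
  assumes "prob_space P" "\<And>x. x \<in> space P \<Longrightarrow> \<bar>Z x\<bar> \<le> R" "0 \<le> q"
  shows "moment_le P q Z R"
proof -
  interpret prob_space P by fact
  have "(\<integral>\<^sup>+x. ennreal (\<bar>Z x\<bar> powr q) \<partial>P) \<le> (\<integral>\<^sup>+x. ennreal (R powr q) \<partial>P)"
    using assms by (intro nn_integral_mono ennreal_leI powr_mono2) auto
  then show ?thesis by (simp add: moment_le_def emeasure_space_1)
qed

text \<open>Convexity on the open half-line is extended to the endpoint 0, where it amounts to
  \<open>t powr q \<le> t\<close> for t in (0, 1). The endpoint occurs because the random variables
  may vanish.\<close>

lemma convex_on_powr_nonneg:
  fixes q :: real
  assumes q: "1 \<le> q"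
  shows "convex_on {0..} (\<lambda>x. x powr q)"
proof (rule convex_onI)
  have aux: "(t * y) powr q \<le> t * y powr q" if "0 < t" "t < 1" "0 \<le> y" for t y :: real
  proof -
    have "t powr q \<le> t powr 1" using that q by (intro powr_mono') auto
    then show ?thesis using that by (simp add: powr_mult mult_right_mono)
  qed
  fix t x y :: real assume *: "0 < t" "t < 1" "x \<in> {0..}" "y \<in> {0..}"
  consider "x = 0" | "y = 0" | "0 < x" "0 < y" using * by fastforce
  then show "((1 - t) *\<^sub>R x + t *\<^sub>R y) powr q \<le> (1 - t) * x powr q + t * y powr q"
  proof cases
    case 1
    then show ?thesis using aux[of t y] * by simp
  next
    case 2
    then show ?thesis using aux[of "1 - t" x] * by simp
  next
    case 3
    then show ?thesis using convex_onD[OF powr_convex[OF q], of t x y] * by simp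
  qed
qed simp

text \<open>Convexity of \<open>t \<mapsto> t\<^sup>q\<close> at the weights \<open>A/(A+B)\<close>, \<open>B/(A+B)\<close>.\<close>

lemma powr_add_le_weighted:
  fixes u v A B q :: real
  assumes "1 \<le> q" "0 < A" "0 < B" "0 \<le> u" "0 \<le> v"
  shows "(u + v) powr q \<le> (A + B) powr (q - 1) * (A powr (1 - q) * u powr q + B powr (1 - q) * v powr q)"
proof -
  have c: "convex_on {0..} (\<lambda>x::real. x powr q)"
    using assms(1) by (rule convex_on_powr_nonneg)
  define t where "t = B / (A + B)"
  have t: "0 \<le> t" "t \<le> 1" "1 - t = A / (A + B)"
    using assms by (auto simp: t_def field_simps)
  have "((1 - t) *\<^sub>R (u / A) + t *\<^sub>R (v / B)) powr q \<le> (1 - t) * (u / A) powr q + t * (v / B) powr q"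
    using assms t by (intro convex_onD[OF c]) (auto simp: divide_nonneg_pos)
  moreover have "(1 - t) *\<^sub>R (u / A) + t *\<^sub>R (v / B) = (u + v) / (A + B)"
    using assms unfolding t(3) unfolding t_def by (simp add: add_divide_distrib)
  ultimately have "((u + v) / (A + B)) powr q \<le> A / (A + B) * (u / A) powr q + B / (A + B) * (v / B) powr q"
    unfolding t(3) by (simp add: t_def)
  then have "(A + B) powr q * ((u + v) / (A + B)) powr q
      \<le> (A + B) powr q * (A / (A + B) * (u / A) powr q + B / (A + B) * (v / B) powr q)"
    by (intro mult_left_mono) auto
  also have "(A + B) powr q * ((u + v) / (A + B)) powr q = (u + v) powr q"
    using assms by (simp add: powr_divide)
  also have "(A + B) powr q * (A / (A + B) * (u / A) powr q + B / (A + B) * (v / B) powr q)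
    = (A + B) powr (q - 1) * (A powr (1 - q) * u powr q + B powr (1 - q) * v powr q)"
    using assms by (simp add: powr_divide powr_diff distrib_left mult.commute mult.left_commute)
  finally show ?thesis .
qed

text \<open>The convexity weights \<open>A powr (1 - q)\<close> require a positive bound, so a
  vanishing norm bound is treated apart: the variable is then zero almost everywhere.\<close>

lemma moment_le_0D:
  assumes "moment_le P q Z 0" "Z \<in> borel_measurable P" "0 < q"
  shows "AE x in P. Z x = 0"
proof -
  have "(\<integral>\<^sup>+x. ennreal (\<bar>Z x\<bar> powr q) \<partial>P) = 0"
    using assms by (simp add: moment_le_def)
  then have "AE x in P. ennreal (\<bar>Z x\<bar> powr q) = 0"
    using assms by (subst (asm) nn_integral_0_iff_AE) auto
  then show ?thesis by eventually_elim (auto simp: ennreal_eq_0_iff)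
qed

text \<open>Minkowski's inequality. The convexity weights are proportional to the given bounds
  \<open>R\<close> and \<open>R'\<close>, so that integration yields exactly
  \<open>(R + R') powr q\<close>. Majorising \<open>Z\<close> pointwise absorbs the triangle
  inequalities at the places of use.\<close>

lemma moment_le_add:
  assumes q: "1 \<le> q" and R: "0 \<le> R" "0 \<le> R'"
    and X: "moment_le P q X R" and Y: "moment_le P q Y R'"
    and [measurable]: "X \<in> borel_measurable P" "Y \<in> borel_measurable P"
    and le: "\<And>x. x \<in> space P \<Longrightarrow> \<bar>Z x\<bar> \<le> \<bar>X x\<bar> + \<bar>Y x\<bar>"
  shows "moment_le P q Z (R + R')"
proof -
  consider "R = 0" | "R' = 0" | "0 < R" "0 < R'" using R by linarith
  then show ?thesis
  proof cases
    case 1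
    with X q have "AE x in P. X x = 0" by (intro moment_le_0D) auto
    have "AE x in P. ennreal (\<bar>Z x\<bar> powr q) \<le> ennreal (\<bar>Y x\<bar> powr q)"
      using AE_space \<open>AE x in P. X x = 0\<close>
    proof eventually_elim
      case (elim x)
      then show ?case using le[of x] q by (intro ennreal_leI powr_mono2) auto
    qed
    then have "(\<integral>\<^sup>+x. ennreal (\<bar>Z x\<bar> powr q) \<partial>P) \<le> (\<integral>\<^sup>+x. ennreal (\<bar>Y x\<bar> powr q) \<partial>P)"
      by (rule nn_integral_mono_AE)
    with Y 1 show ?thesis by (auto simp: moment_le_def)
  next
    case 2
    with Y q have "AE x in P. Y x = 0" by (intro moment_le_0D) auto
    have "AE x in P. ennreal (\<bar>Z x\<bar> powr q) \<le> ennreal (\<bar>X x\<bar> powr q)"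
      using AE_space \<open>AE x in P. Y x = 0\<close>
    proof eventually_elim
      case (elim x)
      then show ?case using le[of x] q by (intro ennreal_leI powr_mono2) auto
    qed
    then have "(\<integral>\<^sup>+x. ennreal (\<bar>Z x\<bar> powr q) \<partial>P) \<le> (\<integral>\<^sup>+x. ennreal (\<bar>X x\<bar> powr q) \<partial>P)"
      by (rule nn_integral_mono_AE)
    with X 2 show ?thesis by (auto simp: moment_le_def)
  next
    case 3
    define C where "C = (R + R') powr (q - 1)"
    have "(\<integral>\<^sup>+x. ennreal (\<bar>Z x\<bar> powr q) \<partial>P)
      \<le> (\<integral>\<^sup>+x. ennreal (C * R powr (1 - q)) * ennreal (\<bar>X x\<bar> powr q)
             + ennreal (C * R' powr (1 - q)) * ennreal (\<bar>Y x\<bar> powr q) \<partial>P)"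
    proof (intro nn_integral_mono)
      fix x assume x: "x \<in> space P"
      have "\<bar>Z x\<bar> powr q \<le> (\<bar>X x\<bar> + \<bar>Y x\<bar>) powr q" using le[OF x] q by (intro powr_mono2) auto
      also have "\<dots> \<le> C * (R powr (1 - q) * \<bar>X x\<bar> powr q + R' powr (1 - q) * \<bar>Y x\<bar> powr q)"
        unfolding C_def using 3 q by (intro powr_add_le_weighted) auto
      finally have "\<bar>Z x\<bar> powr q \<le> C * R powr (1 - q) * \<bar>X x\<bar> powr q + C * R' powr (1 - q) * \<bar>Y x\<bar> powr q"
        by (simp add: algebra_simps)
      then show "ennreal (\<bar>Z x\<bar> powr q) \<le> ennreal (C * R powr (1 - q)) * ennreal (\<bar>X x\<bar> powr q)
             + ennreal (C * R' powr (1 - q)) * ennreal (\<bar>Y x\<bar> powr q)"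
        by (simp add: C_def ennreal_mult[symmetric] ennreal_plus[symmetric] ennreal_leI del: ennreal_plus)
    qed
    also have "\<dots> = ennreal (C * R powr (1 - q)) * (\<integral>\<^sup>+x. ennreal (\<bar>X x\<bar> powr q) \<partial>P)
             + ennreal (C * R' powr (1 - q)) * (\<integral>\<^sup>+x. ennreal (\<bar>Y x\<bar> powr q) \<partial>P)"
      by (simp add: nn_integral_add nn_integral_cmult)
    also have "\<dots> \<le> ennreal (C * R powr (1 - q)) * ennreal (R powr q)
             + ennreal (C * R' powr (1 - q)) * ennreal (R' powr q)"
      using X Y by (intro add_mono mult_left_mono) (auto simp: moment_le_def)
    also have "\<dots> = ennreal (C * (R powr (1 - q) * R powr q + R' powr (1 - q) * R' powr q))"
      by (simp add: C_def ennreal_mult[symmetric] ennreal_plus[symmetric] algebra_simps del: ennreal_plus)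
    also have "C * (R powr (1 - q) * R powr q + R' powr (1 - q) * R' powr q) = (R + R') powr q"
      using 3 by (simp add: C_def powr_add[symmetric] powr_diff)
    finally show ?thesis by (simp add: moment_le_def)
  qed
qed

text \<open>Lyapunov's inequality, via Young's inequality \<open>u\<^sup>p \<le> (1 - p/q) + (p/q) u\<^sup>q\<close>.\<close>

lemma moment_le_exponent:
  assumes P: "prob_space P" and p: "0 < p" "p \<le> q" and R: "0 < R"
    and Z: "moment_le P q Z R" and [measurable]: "Z \<in> borel_measurable P"
  shows "moment_le P p Z R"
proof -
  interpret prob_space P by fact
  define t where "t = p / q"
  have t: "0 < t" "t \<le> 1" "q * t = p" using p by (auto simp: t_def)
  have young: "z powr p \<le> (1 - t) * R powr p + t * R powr (p - q) * z powr q" if z: "0 \<le> z" for z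
  proof (cases "z = 0")
    case True
    then show ?thesis using t by simp
  next
    case False
    define u where "u = (z / R) powr q"
    have "1 powr (1 - t) * u powr t \<le> (1 - t) * 1 + t * u"
      using t z False R by (intro Youngs_inequality_0) (auto simp: u_def)
    then have "u powr t \<le> (1 - t) + t * u" by simp
    also have "u powr t = (z / R) powr p" by (simp add: u_def powr_powr t)
    finally have "R powr p * (z / R) powr p \<le> R powr p * ((1 - t) + t * u)"
      by (intro mult_left_mono) auto
    then show ?thesis using z False R
      by (simp add: u_def powr_divide powr_diff field_simps)
  qed
  have "(\<integral>\<^sup>+x. ennreal (\<bar>Z x\<bar> powr p) \<partial>P)
      \<le> (\<integral>\<^sup>+x. ennreal ((1 - t) * R powr p) + ennreal (t * R powr (p - q)) * ennreal (\<bar>Z x\<bar> powr q) \<partial>P)"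
    using young t by (intro nn_integral_mono)
      (simp add: ennreal_mult[symmetric] ennreal_plus[symmetric] ennreal_leI del: ennreal_plus)
  also have "\<dots> = ennreal ((1 - t) * R powr p) + ennreal (t * R powr (p - q)) * (\<integral>\<^sup>+x. ennreal (\<bar>Z x\<bar> powr q) \<partial>P)"
    by (simp add: nn_integral_add nn_integral_cmult emeasure_space_1)
  also have "\<dots> \<le> ennreal ((1 - t) * R powr p) + ennreal (t * R powr (p - q)) * ennreal (R powr q)"
    using Z by (intro add_mono mult_left_mono order_refl) (auto simp: moment_le_def)
  also have "\<dots> = ennreal ((1 - t) * R powr p + t * R powr (p - q) * R powr q)"
    using t by (simp add: ennreal_mult[symmetric] ennreal_plus[symmetric] del: ennreal_plus)
  also have "(1 - t) * R powr p + t * R powr (p - q) * R powr q = R powr p"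
    using R by (simp add: powr_diff algebra_simps)
  finally show ?thesis by (simp add: moment_le_def)
qed

text \<open>Conditioning on the previous state: the conditional bound \<open>r s\<close> is itself a
  random variable, and its own moment bounds the total moment.\<close>

lemma moment_le_bind:
  assumes P: "P \<in> space (prob_algebra N)" and \<kappa>: "\<kappa> \<in> N \<rightarrow>\<^sub>M prob_algebra N'"
    and [measurable]: "Z \<in> borel_measurable N'"
    and Z: "\<And>s. s \<in> space N \<Longrightarrow> moment_le (\<kappa> s) q Z (r s)" "\<And>s. s \<in> space N \<Longrightarrow> 0 \<le> r s"
    and r: "moment_le P q r R"
  shows "moment_le (P \<bind> \<kappa>) q Z R"
proof -
  have s: "sets P = sets N" using P by (simp add: space_prob_algebra)
  have \<kappa>': "\<kappa> \<in> P \<rightarrow>\<^sub>M subprob_algebra N'"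
    using measurable_prob_algebraD[OF \<kappa>] by (simp add: measurable_cong_sets[OF s refl])
  have "(\<integral>\<^sup>+x. ennreal (\<bar>Z x\<bar> powr q) \<partial>(P \<bind> \<kappa>)) = (\<integral>\<^sup>+s. (\<integral>\<^sup>+x. ennreal (\<bar>Z x\<bar> powr q) \<partial>\<kappa> s) \<partial>P)"
    by (rule nn_integral_bind[OF _ \<kappa>']) measurable
  also have "\<dots> \<le> (\<integral>\<^sup>+s. ennreal (\<bar>r s\<bar> powr q) \<partial>P)"
    using Z sets_eq_imp_space_eq[OF s] by (intro nn_integral_mono) (auto simp: moment_le_def)
  finally show ?thesis using r by (simp add: moment_le_def)
qed

text \<open>The error after a step splits as \<open>(A s' - B s) + (B s - c)\<close>. Given s the
  second summand is a constant, so Minkowski's inequality is applied conditionally and then once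
  more under the law of s; the bounds add up.\<close>

lemma moment_le_bind_step:
  assumes q: "1 \<le> q" and P: "P \<in> space (prob_algebra N)" and \<kappa>: "\<kappa> \<in> N \<rightarrow>\<^sub>M prob_algebra N'"
    and [measurable]: "A \<in> borel_measurable N'" "B \<in> borel_measurable N" "r \<in> borel_measurable N"
    and AB: "\<And>s. s \<in> space N \<Longrightarrow> moment_le (\<kappa> s) q (\<lambda>s'. A s' - B s) (r s)" "\<And>s. s \<in> space N \<Longrightarrow> 0 \<le> r s"
    and r: "moment_le P q r R" "0 \<le> R" and B: "moment_le P q (\<lambda>s. B s - c) R'" "0 \<le> R'"
  shows "moment_le (P \<bind> \<kappa>) q (\<lambda>s. A s - c) (R + R')"
proof (rule moment_le_bind[OF P \<kappa>])
  have s: "sets P = sets N" using P by (simp add: space_prob_algebra)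
  note [measurable_cong] = s
  show "moment_le P q (\<lambda>s. r s + \<bar>B s - c\<bar>) (R + R')"
    using q r B by (intro moment_le_add[where X=r and Y="\<lambda>s. B s - c"]) auto
  fix s assume s: "s \<in> space N"
  have k: "prob_space (\<kappa> s)" and [measurable_cong]: "sets (\<kappa> s) = sets N'"
    using measurable_space[OF \<kappa> s] by (auto simp: space_prob_algebra)
  show "moment_le (\<kappa> s) q (\<lambda>s. A s - c) (r s + \<bar>B s - c\<bar>)"
    using q AB[OF s] k by (intro moment_le_add[where X="\<lambda>s'. A s' - B s" and Y="\<lambda>_. B s - c"])
      (auto intro: moment_le_const)
  show "0 \<le> r s + \<bar>B s - c\<bar>" using AB(2)[OF s] by simp
qed measurable

section \<open>Weighted sums of independent random variables\<close>

text \<open>The tangent inequality for \<open>ln\<close> at \<open>x / q\<close>; the factor exp (-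
  q) that it would also give is dropped.\<close>

lemma powr_le_exp:
  fixes x q :: real
  assumes "0 < q" "0 \<le> x"
  shows "x powr q \<le> q powr q * exp x"
proof (cases "x = 0")
  case False
  then have x: "0 < x" using assms by simp
  have "ln (x / q) \<le> x / q - 1" using assms x by (intro ln_le_minus_one) simp
  then have "q * (ln x - ln q) \<le> q * (x / q - 1)"
    using assms x by (intro mult_left_mono) (auto simp: ln_div)
  then have "q * ln x \<le> q * ln q + x" using assms by (simp add: right_diff_distrib)
  then have "exp (q * ln x) \<le> exp (q * ln q + x)" by simp
  then show ?thesis using assms x by (simp add: powr_def exp_add)
qed simp

text \<open>Hoeffding's lemma on the interval [-c, c]: its length 2c turns the usual 1/8 into
  1/2.\<close>

lemma exp_moment_le:
  assumes "prob_space N" and [measurable]: "Z \<in> borel_measurable N"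
    and b: "\<And>z. z \<in> space N \<Longrightarrow> \<bar>Z z\<bar> \<le> c" and 0: "(\<integral>z. Z z \<partial>N) = 0" and l: "0 < l"
  shows "(\<integral>\<^sup>+z. ennreal (exp (l * Z z)) \<partial>N) \<le> ennreal (exp (l\<^sup>2 * c\<^sup>2 / 2))"
proof -
  interpret N: prob_space N by fact
  interpret interval_bounded_random_variable N Z "- c" c
    by unfold_locales (use b in \<open>auto intro!: AE_I2 simp: abs_le_iff minus_le_iff\<close>)
  have "(\<integral>\<^sup>+z. ennreal (exp (l * Z z)) \<partial>N) \<le> ennreal (exp (l\<^sup>2 * (c - - c)\<^sup>2 / 8))"
    using l 0 by (intro Hoeffdings_lemma_nn_integral_0)
  also have "l\<^sup>2 * (c - - c)\<^sup>2 / 8 = l\<^sup>2 * c\<^sup>2 / 2" by (simp add: power2_eq_square)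
  finally show ?thesis .
qed

lemma PiM_nn_integral_prod:
  assumes I: "finite I" and N: "\<And>i. i \<in> I \<Longrightarrow> prob_space (N i)"
    and f: "\<And>i. i \<in> I \<Longrightarrow> f i \<in> borel_measurable (N i)"
  shows "(\<integral>\<^sup>+x. (\<Prod>i\<in>I. f i (x i)) \<partial>PiM I N) = (\<Prod>i\<in>I. integral\<^sup>N (N i) (f i))"
proof -
  \<comment> \<open>Outside \<open>I\<close> a one-point probability space is substituted, since the
    product locale constrains all indices while \<open>PiM I\<close> sees only those in
    \<open>I\<close>.\<close>
  define N' where "N' i = (if i \<in> I then N i else count_space {undefined})" for i
  have "prob_space (N' i)" for i
    using N by (cases "i \<in> I") (auto simp: N'_def intro!: prob_spaceI)
  then interpret product_sigma_finite N'
    by (simp add: product_sigma_finite_def prob_space_imp_sigma_finite)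
  have "PiM I N = PiM I N'" by (rule PiM_cong) (auto simp: N'_def)
  moreover have "(\<integral>\<^sup>+x. (\<Prod>i\<in>I. f i (x i)) \<partial>PiM I N') = (\<Prod>i\<in>I. integral\<^sup>N (N' i) (f i))"
    using I f by (intro product_nn_integral_prod) (auto simp: N'_def)
  moreover have "\<dots> = (\<Prod>i\<in>I. integral\<^sup>N (N i) (f i))" by (simp add: N'_def)
  ultimately show ?thesis by simp
qed

text \<open>The q-th root of q^q * 2 * exp (1/2): the factor q^q comes from
  \<open>powr_le_exp\<close>, the 2 from bounding exp of an absolute value by the two signs, and exp
  (1/2) from Hoeffding's lemma at the scale 1/\<sigma>.\<close>

definition moment_const :: "real \<Rightarrow> real"
  where "moment_const q = q * (2 * exp (1/2)) powr (1 / q)"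

lemma moment_const_pos: "0 < q \<Longrightarrow> 0 < moment_const q"
  by (simp add: moment_const_def)

text \<open>
  Hoeffding's lemma bounds the moment generating function of the sum, and an exponential moment
  controls all powers: no Marcinkiewicz--Zygmund inequality is needed.
\<close>

lemma PiM_sum_moment_le:
  assumes I: "finite I" and N: "\<And>i. i \<in> I \<Longrightarrow> prob_space (N i)"
    and Z: "\<And>i. i \<in> I \<Longrightarrow> Z i \<in> borel_measurable (N i)"
    and b: "\<And>i z. i \<in> I \<Longrightarrow> z \<in> space (N i) \<Longrightarrow> \<bar>Z i z\<bar> \<le> c i"
    and 0: "\<And>i. i \<in> I \<Longrightarrow> (\<integral>z. Z i z \<partial>N i) = 0"
    and c: "(\<Sum>i\<in>I. (c i)\<^sup>2) \<le> \<sigma>\<^sup>2" and \<sigma>: "0 < \<sigma>" and q: "0 < q"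
  shows "moment_le (PiM I N) q (\<lambda>x. \<Sum>i\<in>I. Z i (x i)) (moment_const q * \<sigma>)"
proof -
  \<comment> \<open>At this scale the Hoeffding exponent
    \<open>l\<^sup>2 * (\<Sum>i\<in>I. (c i)\<^sup>2) / 2\<close> is at most 1/2.\<close>
  define l where "l = 1 / \<sigma>"
  have l: "0 < l" using \<sigma> by (simp add: l_def)
  define S where "S x = (\<Sum>i\<in>I. Z i (x i))" for x
  have [measurable]: "(\<lambda>x. Z i (x i)) \<in> borel_measurable (PiM I N)" if "i \<in> I" for i
    using Z[OF that] that by measurable
  have mgf: "(\<integral>\<^sup>+x. ennreal (exp (l * (e * S x))) \<partial>PiM I N) \<le> ennreal (exp (1/2))"
    if e: "e = 1 \<or> e = -1" for e :: real
  proof -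
    have "(\<integral>\<^sup>+x. ennreal (exp (l * (e * S x))) \<partial>PiM I N)
        = (\<integral>\<^sup>+x. (\<Prod>i\<in>I. ennreal (exp (l * (e * Z i (x i))))) \<partial>PiM I N)"
      by (simp add: S_def sum_distrib_left exp_sum I prod_ennreal)
    also have "\<dots> = (\<Prod>i\<in>I. (\<integral>\<^sup>+z. ennreal (exp (l * (e * Z i z))) \<partial>N i))"
      using Z by (intro PiM_nn_integral_prod[where f="\<lambda>i z. ennreal (exp (l * (e * Z i z)))"] I N) auto
    also have "\<dots> \<le> (\<Prod>i\<in>I. ennreal (exp (l\<^sup>2 * (c i)\<^sup>2 / 2)))"
    proof (rule prod_mono_ennreal)
      fix i assume i: "i \<in> I"
      show "(\<integral>\<^sup>+z. ennreal (exp (l * (e * Z i z))) \<partial>N i) \<le> ennreal (exp (l\<^sup>2 * (c i)\<^sup>2 / 2))"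
        using e Z[OF i] b[OF i] 0[OF i] by (intro exp_moment_le N i l) auto
    qed
    also have "\<dots> = ennreal (exp (l\<^sup>2 * (\<Sum>i\<in>I. (c i)\<^sup>2) / 2))"
      by (simp add: prod_ennreal exp_sum[OF I, symmetric] sum_distrib_left sum_divide_distrib)
    also have "\<dots> \<le> ennreal (exp (1/2))"
      using c \<sigma> by (intro ennreal_leI) (simp add: l_def power_divide)
    finally show ?thesis .
  qed
  have pw: "\<bar>S x\<bar> powr q \<le> (q * \<sigma>) powr q * (exp (l * (1 * S x)) + exp (l * (-1 * S x)))" for x
  proof -
    have "\<bar>l * S x\<bar> powr q \<le> q powr q * exp \<bar>l * S x\<bar>" using q by (intro powr_le_exp) auto
    also have "\<dots> \<le> q powr q * (exp (l * (1 * S x)) + exp (l * (-1 * S x)))"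
      by (intro mult_left_mono) (auto simp: abs_if)
    finally have "\<sigma> powr q * \<bar>l * S x\<bar> powr q \<le> \<sigma> powr q * (q powr q * (exp (l * (1 * S x)) + exp (l * (-1 * S x))))"
      by (intro mult_left_mono) auto
    moreover have "\<sigma> powr q * \<bar>l * S x\<bar> powr q = \<bar>S x\<bar> powr q"
      using \<sigma> by (simp add: l_def powr_mult[symmetric] abs_mult)
    ultimately show ?thesis using \<sigma> q by (simp add: powr_mult mult_ac)
  qed
  have "(\<integral>\<^sup>+x. ennreal (\<bar>S x\<bar> powr q) \<partial>PiM I N)
      \<le> (\<integral>\<^sup>+x. ennreal ((q * \<sigma>) powr q) * (ennreal (exp (l * (1 * S x))) + ennreal (exp (l * (-1 * S x)))) \<partial>PiM I N)"
    using pw by (intro nn_integral_mono)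
      (simp add: ennreal_mult[symmetric] ennreal_plus[symmetric] ennreal_leI del: ennreal_plus)
  also have "\<dots> = ennreal ((q * \<sigma>) powr q) * ((\<integral>\<^sup>+x. ennreal (exp (l * (1 * S x))) \<partial>PiM I N)
      + (\<integral>\<^sup>+x. ennreal (exp (l * (-1 * S x))) \<partial>PiM I N))"
    unfolding S_def by (simp add: nn_integral_add nn_integral_cmult)
  also have "\<dots> \<le> ennreal ((q * \<sigma>) powr q) * (ennreal (exp (1/2)) + ennreal (exp (1/2)))"
    using mgf[of 1] mgf[of "-1"] by (intro mult_left_mono add_mono) auto
  also have "\<dots> = ennreal ((q * \<sigma>) powr q * (2 * exp (1/2)))"
    by (simp add: ennreal_mult[symmetric] ennreal_plus[symmetric] del: ennreal_plus)
  also have "(q * \<sigma>) powr q * (2 * exp (1/2)) = (moment_const q * \<sigma>) powr q"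
    using q \<sigma> by (simp add: moment_const_def powr_mult powr_powr mult_ac)
  finally show ?thesis by (simp add: moment_le_def S_def)
qed

text \<open>
  All sources of randomness of the particle filter (initialisation, sampling, resampling) are
  instances: the particles are independent with fixed weights \<open>v i\<close>, and the filter functional is
  a ratio of weighted means.
\<close>

lemma PiM_ratio_moment_le:
  fixes v :: "'i \<Rightarrow> real" and \<phi> \<psi> :: "'i \<Rightarrow> 'a \<Rightarrow> real"
  assumes I: "finite I" and N: "\<And>i. i \<in> I \<Longrightarrow> prob_space (N i)"
    and v: "\<And>i. i \<in> I \<Longrightarrow> 0 \<le> v i" "(\<Sum>i\<in>I. v i) = 1" "\<And>i. i \<in> I \<Longrightarrow> v i \<le> vm"
    and \<phi>[measurable]: "\<And>i. i \<in> I \<Longrightarrow> \<phi> i \<in> borel_measurable (N i)"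
    and \<psi>[measurable]: "\<And>i. i \<in> I \<Longrightarrow> \<psi> i \<in> borel_measurable (N i)"
    and lo: "0 < lo" "\<And>i z. i \<in> I \<Longrightarrow> z \<in> space (N i) \<Longrightarrow> lo \<le> \<psi> i z"
    and hi: "\<And>i z. i \<in> I \<Longrightarrow> z \<in> space (N i) \<Longrightarrow> \<psi> i z \<le> hi"
    and \<delta>: "\<And>i z. i \<in> I \<Longrightarrow> z \<in> space (N i) \<Longrightarrow> \<bar>\<phi> i z - t * \<psi> i z\<bar> \<le> \<delta> * \<psi> i z" "0 < \<delta>" and q: "1 \<le> q"
  shows "moment_le (PiM I N) q
    (\<lambda>x. (\<Sum>i\<in>I. v i * \<phi> i (x i)) / (\<Sum>i\<in>I. v i * \<psi> i (x i))
        - (\<Sum>i\<in>I. v i * (\<integral>z. \<phi> i z \<partial>N i)) / (\<Sum>i\<in>I. v i * (\<integral>z. \<psi> i z \<partial>N i)))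
    (4 * (hi / lo) * \<delta> * moment_const q * sqrt vm)"
proof -
  \<comment> \<open>Subtracting \<open>t * \<psi>\<close> from the numerator shifts both quotients
    by the same \<open>t\<close> and leaves a numerator of size \<delta> relative to the
    denominator. This makes the final bound proportional to the oscillation \<delta> and not to the
    size of \<phi>.\<close>
  define \<theta> where "\<theta> i z = \<phi> i z - t * \<psi> i z" for i z
  define mean where "mean f = (\<Sum>i\<in>I. v i * (\<integral>z. f i z \<partial>N i))" for f :: "'i \<Rightarrow> 'a \<Rightarrow> real"
  define samp where "samp f x = (\<Sum>i\<in>I. v i * f i (x i))" for f :: "'i \<Rightarrow> 'a \<Rightarrow> real" and x
  define V where "V f x = samp f x - mean f" for f :: "'i \<Rightarrow> 'a \<Rightarrow> real" and x
  have \<theta>[measurable]: "\<theta> i \<in> borel_measurable (N i)" if "i \<in> I" for i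
    unfolding \<theta>_def[abs_def] using that by measurable
  have ne: "I \<noteq> {}" using v(2) by auto
  have vm: "0 < vm"
  proof (rule ccontr)
    assume "\<not> 0 < vm"
    then have "v i = 0" if "i \<in> I" for i using v(1,3)[OF that] by simp
    then show False using v(2) by simp
  qed
  have hi0: "0 < hi"
  proof -
    obtain i where i: "i \<in> I" using ne by blast
    obtain z where "z \<in> space (N i)" using prob_space.not_empty[OF N[OF i]] by blast
    then show ?thesis using lo(1) lo(2)[OF i] hi[OF i] by force
  qed
  have \<theta>b: "\<bar>\<theta> i z\<bar> \<le> \<delta> * hi" if "i \<in> I" "z \<in> space (N i)" for i z
    unfolding \<theta>_def using \<delta>(1)[OF that] mult_left_mono[OF hi[OF that], of \<delta>] \<delta>(2) by linarith
  have \<psi>b: "\<bar>\<psi> i z\<bar> \<le> hi" if "i \<in> I" "z \<in> space (N i)" for i z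
    using lo(1) lo(2)[OF that] hi[OF that] by simp
  have int: "integrable (N i) (f i)"
    if "i \<in> I" "f i \<in> borel_measurable (N i)" "\<And>z. z \<in> space (N i) \<Longrightarrow> \<bar>f i z\<bar> \<le> B" for i f and B :: real
  proof -
    interpret prob_space "N i" using N[OF that(1)] .
    show ?thesis using that(2,3) by (intro integrable_const_bound[where B=B] AE_I2) auto
  qed
  have i\<psi>: "integrable (N i) (\<psi> i)" and i\<theta>: "integrable (N i) (\<theta> i)" if "i \<in> I" for i
    using int[OF that] \<psi>b[OF that] \<theta>b[OF that] \<psi>[OF that] \<theta>[OF that] by blast+
  \<comment> \<open>A centred summand is at most \<open>v i * (2 * B)\<close> in size, and the sum
    of the squared weights is at most \<open>vm\<close>, because the weights are at most
    \<open>vm\<close> and add up to 1.\<close>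
  have dev: "moment_le (PiM I N) q (V f) (2 * B * moment_const q * sqrt vm)"
    if f[measurable]: "\<And>i. i \<in> I \<Longrightarrow> f i \<in> borel_measurable (N i)" and B: "0 < B"
      and fb: "\<And>i z. i \<in> I \<Longrightarrow> z \<in> space (N i) \<Longrightarrow> \<bar>f i z\<bar> \<le> B" for f B
  proof -
    have "moment_le (PiM I N) q (\<lambda>x. \<Sum>i\<in>I. v i * (f i (x i) - (\<integral>z. f i z \<partial>N i)))
       (moment_const q * (2 * B * sqrt vm))"
    proof (rule PiM_sum_moment_le[where c="\<lambda>i. v i * (2 * B)"])
      fix i assume i: "i \<in> I"
      interpret prob_space "N i" using N[OF i] .
      show "(\<lambda>z. v i * (f i z - (\<integral>z. f i z \<partial>N i))) \<in> borel_measurable (N i)" using i by measurable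
      have fi: "integrable (N i) (f i)" using i by (intro int[of i f B] f fb)
      show "(\<integral>z. v i * (f i z - (\<integral>z. f i z \<partial>N i)) \<partial>N i) = 0"
        using fi by (simp add: prob_space)
      fix z assume z: "z \<in> space (N i)"
      have "\<bar>\<integral>z. f i z \<partial>N i\<bar> \<le> (\<integral>z. \<bar>f i z\<bar> \<partial>N i)" by (rule integral_abs_bound)
      also have "\<dots> \<le> B" using fi fb[OF i] by (intro integral_le_const AE_I2) auto
      finally have "\<bar>f i z - (\<integral>z. f i z \<partial>N i)\<bar> \<le> 2 * B" using fb[OF i z] by linarith
      then show "\<bar>v i * (f i z - (\<integral>z. f i z \<partial>N i))\<bar> \<le> v i * (2 * B)"
        using v(1)[OF i] by (simp add: abs_mult mult_left_mono)
    next
      have "(\<Sum>i\<in>I. (v i * (2 * B))\<^sup>2) \<le> (\<Sum>i\<in>I. (2 * B)\<^sup>2 * vm * v i)"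
      proof (intro sum_mono)
        fix i assume i: "i \<in> I"
        have "v i * v i \<le> vm * v i" using v(1,3)[OF i] by (intro mult_right_mono) auto
        then have "(2 * B)\<^sup>2 * (v i * v i) \<le> (2 * B)\<^sup>2 * (vm * v i)" by (rule mult_left_mono) simp
        then show "(v i * (2 * B))\<^sup>2 \<le> (2 * B)\<^sup>2 * vm * v i" by (simp add: power2_eq_square mult_ac)
      qed
      also have "\<dots> = (2 * B * sqrt vm)\<^sup>2"
        using v(2) vm by (simp add: sum_distrib_left[symmetric] power_mult_distrib)
      finally show "(\<Sum>i\<in>I. (v i * (2 * B))\<^sup>2) \<le> (2 * B * sqrt vm)\<^sup>2" .
    qed (use I N q B vm in auto)
    then show ?thesis
      by (simp add: V_def[abs_def] samp_def mean_def right_diff_distrib sum_subtractf mult_ac)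
  qed
  have mean_lin: "mean \<phi> = mean \<theta> + t * mean \<psi>"
  proof -
    have "(\<integral>z. \<phi> i z \<partial>N i) = (\<integral>z. \<theta> i z \<partial>N i) + t * (\<integral>z. \<psi> i z \<partial>N i)" if "i \<in> I" for i
    proof -
      have "(\<integral>z. \<phi> i z \<partial>N i) = (\<integral>z. \<theta> i z + t * \<psi> i z \<partial>N i)" by (simp add: \<theta>_def)
      then show ?thesis using i\<psi>[OF that] i\<theta>[OF that] by simp
    qed
    then show ?thesis by (simp add: mean_def distrib_left sum.distrib sum_distrib_left mult_ac)
  qed
  have samp_lin: "samp \<phi> x = samp \<theta> x + t * samp \<psi> x" for x
    by (simp add: samp_def \<theta>_def sum.distrib[symmetric] sum_distrib_left algebra_simps)
  have mean_pos: "lo \<le> mean \<psi>"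
  proof -
    have "lo \<le> (\<integral>z. \<psi> i z \<partial>N i)" if "i \<in> I" for i
      using that lo(2) i\<psi> by (intro prob_space.integral_ge_const[OF N] AE_I2) auto
    then have "(\<Sum>i\<in>I. v i * lo) \<le> mean \<psi>"
      unfolding mean_def using v(1) by (intro sum_mono mult_left_mono) auto
    then show ?thesis using v(2) by (simp add: sum_distrib_right[symmetric])
  qed
  have samp_pos: "lo \<le> samp \<psi> x" if x: "x \<in> space (PiM I N)" for x
  proof -
    have "(\<Sum>i\<in>I. v i * lo) \<le> samp \<psi> x"
      unfolding samp_def using v(1) x lo(2) by (intro sum_mono mult_left_mono) (auto simp: space_PiM PiE_iff)
    then show ?thesis using v(2) by (simp add: sum_distrib_right[symmetric])
  qed
  have mean_ratio: "\<bar>mean \<theta> / mean \<psi>\<bar> \<le> \<delta>"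
  proof -
    have "\<bar>\<integral>z. \<theta> i z \<partial>N i\<bar> \<le> \<delta> * (\<integral>z. \<psi> i z \<partial>N i)" if i: "i \<in> I" for i
    proof -
      have "\<bar>\<integral>z. \<theta> i z \<partial>N i\<bar> \<le> (\<integral>z. \<bar>\<theta> i z\<bar> \<partial>N i)" by (rule integral_abs_bound)
      also have "\<dots> \<le> (\<integral>z. \<delta> * \<psi> i z \<partial>N i)"
        using \<delta>(1)[OF i, folded \<theta>_def] i\<theta>[OF i] i\<psi>[OF i]
        by (intro integral_mono) auto
      finally show ?thesis by simp
    qed
    then have "\<bar>mean \<theta>\<bar> \<le> (\<Sum>i\<in>I. v i * (\<delta> * (\<integral>z. \<psi> i z \<partial>N i)))"
      unfolding mean_def using v(1) by (intro order_trans[OF sum_abs] sum_mono) (auto simp: abs_mult intro!: mult_left_mono)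
    also have "\<dots> = \<delta> * mean \<psi>" by (simp add: mean_def sum_distrib_left mult_ac)
    finally show ?thesis using mean_pos lo(1) by (simp add: abs_divide divide_le_eq)
  qed
  have meas: "V \<theta> \<in> borel_measurable (PiM I N)" "V \<psi> \<in> borel_measurable (PiM I N)"
    unfolding V_def[abs_def] samp_def by measurable
  have d\<theta>: "moment_le (PiM I N) q (V \<theta>) (2 * (\<delta> * hi) * moment_const q * sqrt vm)"
    using \<theta> \<theta>b \<delta>(2) hi0 by (intro dev) auto
  have d\<psi>: "moment_le (PiM I N) q (V \<psi>) (2 * hi * moment_const q * sqrt vm)"
    using \<psi> \<psi>b hi0 by (intro dev) auto
  have 1: "moment_le (PiM I N) q (\<lambda>x. (1 / lo) * V \<theta> x) ((1 / lo) * (2 * (\<delta> * hi) * moment_const q * sqrt vm))"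
    using lo \<delta>(2) hi0 vm q moment_const_pos[of q]
    by (intro moment_le_scale[OF d\<theta> meas(1)]) (auto simp: abs_mult)
  have 2: "moment_le (PiM I N) q (\<lambda>x. (\<delta> / lo) * V \<psi> x) ((\<delta> / lo) * (2 * hi * moment_const q * sqrt vm))"
    using lo \<delta>(2) hi0 vm q moment_const_pos[of q]
    by (intro moment_le_scale[OF d\<psi> meas(2)]) (auto simp: abs_mult)
  have "moment_le (PiM I N) q (\<lambda>x. samp \<phi> x / samp \<psi> x - mean \<phi> / mean \<psi>)
     ((1 / lo) * (2 * (\<delta> * hi) * moment_const q * sqrt vm) + (\<delta> / lo) * (2 * hi * moment_const q * sqrt vm))"
  proof (rule moment_le_add[OF q _ _ 1 2])
    fix x assume x: "x \<in> space (PiM I N)"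
    have s: "0 < samp \<psi> x" and m: "0 < mean \<psi>" using samp_pos[OF x] mean_pos lo(1) by auto
    have "samp \<phi> x / samp \<psi> x - mean \<phi> / mean \<psi> = samp \<theta> x / samp \<psi> x - mean \<theta> / mean \<psi>"
      using s m unfolding samp_lin mean_lin by (simp add: add_divide_distrib)
    \<comment> \<open>Only the sampled denominator is left below the deviations, and it is at least
      \<open>lo\<close>. Numerator and denominator contribute 2 * hi / lo each, hence the factor 4
      in the statement.\<close>
    also have "\<dots> = V \<theta> x / samp \<psi> x - (mean \<theta> / mean \<psi>) * (V \<psi> x / samp \<psi> x)"
      using s m by (simp add: V_def field_simps)
    finally have eq: "samp \<phi> x / samp \<psi> x - mean \<phi> / mean \<psi> = V \<theta> x / samp \<psi> x - (mean \<theta> / mean \<psi>) * (V \<psi> x / samp \<psi> x)" .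
    have le: "\<bar>V f x / samp \<psi> x\<bar> \<le> \<bar>V f x\<bar> / lo" for f
      using s lo(1) samp_pos[OF x] by (auto simp: abs_divide intro!: divide_left_mono)
    have "\<bar>(mean \<theta> / mean \<psi>) * (V \<psi> x / samp \<psi> x)\<bar> \<le> \<delta> * (\<bar>V \<psi> x\<bar> / lo)"
      unfolding abs_mult using mean_ratio le \<delta>(2) by (intro mult_mono) auto
    then have "\<bar>samp \<phi> x / samp \<psi> x - mean \<phi> / mean \<psi>\<bar> \<le> \<bar>V \<theta> x\<bar> / lo + \<delta> * (\<bar>V \<psi> x\<bar> / lo)"
      unfolding eq using le[of \<theta>] by linarith
    then show "\<bar>samp \<phi> x / samp \<psi> x - mean \<phi> / mean \<psi>\<bar> \<le> \<bar>1 / lo * V \<theta> x\<bar> + \<bar>\<delta> / lo * V \<psi> x\<bar>"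
      using lo(1) \<delta>(2) by (simp add: abs_mult)
  qed (use meas lo \<delta>(2) hi0 vm q moment_const_pos[of q] in auto)
  then show ?thesis unfolding samp_def mean_def by (simp add: field_simps)
qed

section \<open>Uniform forgetting\<close>

lemma bounded_functionsI:
  assumes "h \<in> borel_measurable S" "\<And>x. x \<in> space S \<Longrightarrow> \<bar>h x\<bar> \<le> b"
  shows "h \<in> bounded_functions S"
  using assms by (auto simp: bounded_functions_def bounded_iff)

lemma bounded_functionsE:
  assumes "h \<in> bounded_functions S"
  obtains b where "0 < b" "\<And>x. x \<in> space S \<Longrightarrow> \<bar>h x\<bar> \<le> b"
proof -
  obtain c where "\<And>x. x \<in> space S \<Longrightarrow> \<bar>h x\<bar> \<le> c"
    using assms by (auto simp: bounded_functions_def bounded_iff)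
  then show thesis by (intro that[of "\<bar>c\<bar> + 1"]) fastforce+
qed

lemma bounded_functions_measurable: "h \<in> bounded_functions S \<Longrightarrow> h \<in> borel_measurable S"
  by (simp add: bounded_functions_def)

lemma bounded_functions_const [simp]: "(\<lambda>_. c) \<in> bounded_functions S"
  by (rule bounded_functionsI[where b="\<bar>c\<bar>"]) auto

lemma bounded_functions_add:
  assumes "h \<in> bounded_functions S" "h' \<in> bounded_functions S"
  shows "(\<lambda>x. h x + h' x) \<in> bounded_functions S"
proof -
  obtain b b' where "\<And>x. x \<in> space S \<Longrightarrow> \<bar>h x\<bar> \<le> b" "\<And>x. x \<in> space S \<Longrightarrow> \<bar>h' x\<bar> \<le> b'"
    using assms by (metis bounded_functionsE)
  then show ?thesis
    using assms[THEN bounded_functions_measurable]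
    by (intro bounded_functionsI[where b="b + b'"]) (auto intro: order_trans[OF abs_triangle_ineq] add_mono)
qed

lemma bounded_functions_cmult:
  assumes "h \<in> bounded_functions S"
  shows "(\<lambda>x. c * h x) \<in> bounded_functions S"
proof -
  obtain b where "\<And>x. x \<in> space S \<Longrightarrow> \<bar>h x\<bar> \<le> b" using assms by (metis bounded_functionsE)
  then show ?thesis
    using bounded_functions_measurable[OF assms]
    by (intro bounded_functionsI[where b="\<bar>c\<bar> * b"]) (auto simp: abs_mult intro: mult_left_mono)
qed

lemma bounded_functions_integrable:
  assumes "\<mu> \<in> space (prob_algebra S)" "h \<in> bounded_functions S"
  shows "integrable \<mu> h"
proof -
  have s: "sets \<mu> = sets S" and "prob_space \<mu>" using assms by (auto simp: space_prob_algebra)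
  then interpret prob_space \<mu> by simp
  obtain b where "\<And>x. x \<in> space S \<Longrightarrow> \<bar>h x\<bar> \<le> b" using assms(2) by (metis bounded_functionsE)
  then show ?thesis
    using sets_eq_imp_space_eq[OF s] bounded_functions_measurable[OF assms(2)]
    by (intro integrable_const_bound[where B=b] AE_I2) (auto simp: measurable_cong_sets[OF s refl])
qed

lemma integral_prob_abs_le:
  assumes "\<mu> \<in> space (prob_algebra S)" "h \<in> bounded_functions S" "\<And>x. x \<in> space S \<Longrightarrow> \<bar>h x\<bar> \<le> b"
  shows "\<bar>\<integral>x. h x \<partial>\<mu>\<bar> \<le> b"
proof -
  have s: "sets \<mu> = sets S" and "prob_space \<mu>" using assms by (auto simp: space_prob_algebra)
  then interpret prob_space \<mu> by simp
  have "\<bar>\<integral>x. h x \<partial>\<mu>\<bar> \<le> (\<integral>x. \<bar>h x\<bar> \<partial>\<mu>)" by (rule integral_abs_bound)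
  also have "\<dots> \<le> b"
    using bounded_functions_integrable[OF assms(1,2)] assms(3) sets_eq_imp_space_eq[OF s]
    by (intro integral_le_const AE_I2) auto
  finally show ?thesis .
qed

text \<open>
  The Banach--Steinhaus theorem for functionals on the bounded measurable functions, by a gliding
  hump: the partial sums \<open>P j\<close> add \<open>\<plusminus> 3\<^sup>-\<^sup>j\<close> times a nearly norming function of the \<open>j\<close>-th
  functional, with the sign that makes the functional large.
\<close>

lemma uniform_boundedness:
  fixes F :: "(('x \<Rightarrow> real) \<Rightarrow> real) set"
  assumes add: "\<And>L h h'. L \<in> F \<Longrightarrow> h \<in> bounded_functions S \<Longrightarrow> h' \<in> bounded_functions S \<Longrightarrow>
      L (\<lambda>x. h x + h' x) = L h + L h'"
    and cmult: "\<And>L h c. L \<in> F \<Longrightarrow> h \<in> bounded_functions S \<Longrightarrow> L (\<lambda>x. c * h x) = c * L h"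
    and bounded: "\<And>L. L \<in> F \<Longrightarrow> \<exists>k. \<forall>h\<in>bounded_functions S. (\<forall>x\<in>space S. \<bar>h x\<bar> \<le> 1) \<longrightarrow> \<bar>L h\<bar> \<le> k"
    and pointwise: "\<And>h. h \<in> bounded_functions S \<Longrightarrow> \<exists>c. \<forall>L\<in>F. \<bar>L h\<bar> \<le> c"
  shows "\<exists>B\<ge>0. \<forall>L\<in>F. \<forall>h\<in>bounded_functions S. (\<forall>x\<in>space S. \<bar>h x\<bar> \<le> 1) \<longrightarrow> \<bar>L h\<bar> \<le> B"
proof (rule ccontr)
  define U where "U = {h \<in> bounded_functions S. \<forall>x\<in>space S. \<bar>h x\<bar> \<le> 1}"
  define nrm where "nrm L = (SUP h\<in>U. \<bar>L h\<bar>)" for L :: "('x \<Rightarrow> real) \<Rightarrow> real"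
  assume "\<not> ?thesis"
  then have unb: "\<exists>L\<in>F. \<exists>h\<in>U. B < \<bar>L h\<bar>" if "0 \<le> B" for B
    using that by (fastforce simp: U_def not_le)
  have bdd: "bdd_above ((\<lambda>h. \<bar>L h\<bar>) ` U)" if "L \<in> F" for L
    using bounded[OF that] by (auto simp: U_def bdd_above_def)
  have U0: "(\<lambda>_. 0) \<in> U" by (simp add: U_def)
  have nrm: "\<bar>L h\<bar> \<le> nrm L" if "L \<in> F" "h \<in> U" for L h
    unfolding nrm_def by (rule cSUP_upper[OF that(2) bdd[OF that(1)]])
  \<comment> \<open>The factor 2/3 has to exceed the 1/2 that the tail of the series will cost, and
    the growth 4^j has to beat the damping 3^-j.\<close>
  have "\<exists>L h. L \<in> F \<and> h \<in> U \<and> 4 ^ j < nrm L \<and> 2 / 3 * nrm L < \<bar>L h\<bar>" for j :: nat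
  proof -
    obtain L h where L: "L \<in> F" "h \<in> U" "4 ^ j < \<bar>L h\<bar>" using unb[of "4 ^ j"] by auto
    then have n: "4 ^ j < nrm L" using nrm by fastforce
    moreover have "(0::real) < 4 ^ j" by simp
    ultimately have "2 / 3 * nrm L < nrm L" by linarith
    then obtain h' where "h' \<in> U" "2 / 3 * nrm L < \<bar>L h'\<bar>"
      unfolding nrm_def using less_cSUP_iff[of U "\<lambda>h. \<bar>L h\<bar>"] bdd[OF L(1)] U0 by blast
    with L n show ?thesis by blast
  qed
  then obtain L h where L: "\<And>j. L j \<in> F" and h: "\<And>j. h j \<in> U"
    and large: "\<And>j. 4 ^ j < nrm (L j)" and attain: "\<And>j. 2 / 3 * nrm (L j) < \<bar>L j (h j)\<bar>"
    by metis
  have hb: "h j \<in> bounded_functions S" "\<And>x. x \<in> space S \<Longrightarrow> \<bar>h j x\<bar> \<le> 1" for j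
    using h[of j] by (auto simp: U_def)
  define up where "up j P = (\<lambda>x. P x + (1/3) ^ j * h j x)" for j and P :: "'x \<Rightarrow> real"
  define dn where "dn j P = (\<lambda>x. P x + - ((1/3) ^ j) * h j x)" for j and P :: "'x \<Rightarrow> real"
  define P where "P = rec_nat (\<lambda>_. 0) (\<lambda>j P. if \<bar>L j (dn j P)\<bar> \<le> \<bar>L j (up j P)\<bar> then up j P else dn j P)"
  have P0: "P (0::nat) = (\<lambda>_. 0)" and PS: "P (Suc j) = (if \<bar>L j (dn j (P j))\<bar> \<le> \<bar>L j (up j (P j))\<bar> then up j (P j) else dn j (P j))" for j
    by (simp_all add: P_def)
  have Pb: "P j \<in> bounded_functions S" for j
  proof (induction j)
    case 0
    then show ?case by (simp add: P0)
  next
    case (Suc j)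
    have "up j (P j) \<in> bounded_functions S" "dn j (P j) \<in> bounded_functions S"
      unfolding up_def dn_def by (intro bounded_functions_add bounded_functions_cmult Suc.IH hb(1))+
    then show ?case by (simp add: PS)
  qed
  \<comment> \<open>Of the numbers a + b and a - b, the one larger in absolute value is at least |b|
    in absolute value; so the earlier terms cannot cancel the new one.\<close>
  have LP: "(1/3) ^ j * \<bar>L j (h j)\<bar> \<le> \<bar>L j (P (Suc j))\<bar>" for j
  proof -
    have "L j (up j (P j)) = L j (P j) + (1/3) ^ j * L j (h j)"
      "L j (dn j (P j)) = L j (P j) + - ((1/3) ^ j) * L j (h j)"
      unfolding up_def dn_def
      by (simp_all only: add[OF L Pb bounded_functions_cmult[OF hb(1)]] cmult[OF L hb(1)])
    moreover have "\<bar>(1/3) ^ j * L j (h j)\<bar> = (1/3) ^ j * \<bar>L j (h j)\<bar>" by (simp add: abs_mult)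
    ultimately show ?thesis unfolding PS by (auto split: if_splits)
  qed
  define d where "d j x = P (Suc j) x - P j x" for j x
  have db: "\<bar>d j x\<bar> \<le> (1/3) ^ j" if "x \<in> space S" for j x
    using hb(2)[OF that, of j] by (auto simp: d_def PS up_def dn_def abs_mult intro!: mult_left_le)
  have sm: "summable (\<lambda>j. d (j + k) x)" if "x \<in> space S" for x k
  proof (rule summable_comparison_test'[of "\<lambda>j. (1/3) ^ (j + k)" 0])
    show "summable (\<lambda>j. (1/3::real) ^ (j + k))" by (simp add: power_add summable_mult2)
    show "norm (d (j + k) x) \<le> (1/3) ^ (j + k)" for j using db[OF that, of "j + k"] by simp
  qed
  define f where "f x = (\<Sum>j. d j x)" for x
  have rest: "\<bar>f x - P k x\<bar> \<le> (1/3) ^ k * (3/2)" if x: "x \<in> space S" for x k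
  proof -
    have "P k x = (\<Sum>j<k. d j x)" by (induction k) (auto simp: P0 d_def)
    then have "f x - P k x = (\<Sum>j. d (j + k) x)"
      unfolding f_def using suminf_minus_initial_segment[of "\<lambda>j. d j x" k] sm[OF x, of 0] by simp
    also have "\<bar>\<dots>\<bar> \<le> (\<Sum>j. (1/3) ^ k * (1/3) ^ j)"
      using db[OF x, of "_ + k"]
      by (intro norm_suminf_le[where f="\<lambda>j. d (j + k) x", unfolded real_norm_def] summable_mult)
        (auto simp: power_add mult.commute)
    also have "\<dots> = (1/3) ^ k * (3/2)"
      by (subst suminf_mult) (auto simp: suminf_geometric)
    finally show ?thesis .
  qed
  have "(\<lambda>x. \<Sum>j. d j x) \<in> borel_measurable S"
    unfolding d_def using Pb[THEN bounded_functions_measurable] by (intro borel_measurable_suminf) auto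
  then have fb: "f \<in> bounded_functions S"
    using rest[of _ 0] by (intro bounded_functionsI[where b="3/2"]) (auto simp: f_def[abs_def] P0)
  obtain c where c: "\<And>j. \<bar>L j f\<bar> \<le> c" using pointwise[OF fb] L by blast
  have "(4/3) ^ j \<le> 6 * c" for j
  proof -
    define r where "r x = f x + (- 1) * P (Suc j) x" for x
    have rb: "r \<in> bounded_functions S"
      unfolding r_def by (intro bounded_functions_add bounded_functions_cmult fb Pb)
    \<comment> \<open>The tail after step j is at most 3^-j / 2 pointwise, so \<open>w\<close>
      scales it into the unit ball and \<open>L j\<close> maps it to at most 3^-j * nrm (L j) / 2.
      What remains of 3^-j * (2/3) * nrm (L j) is 3^-j * nrm (L j) / 6, at least (4/3)^j / 6, which
      contradicts the pointwise bound on \<open>f\<close>.\<close>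
    define w :: real where "w = 2 * 3 ^ j"
    have "\<bar>w * r x\<bar> \<le> 1" if "x \<in> space S" for x
    proof -
      have "w * \<bar>r x\<bar> \<le> w * ((1/3) ^ Suc j * (3/2))"
        using rest[OF that, of "Suc j"] by (intro mult_left_mono) (auto simp: r_def w_def)
      also have "\<dots> = 1" by (simp add: w_def power_one_over)
      finally show ?thesis by (simp add: abs_mult w_def)
    qed
    then have "(\<lambda>x. w * r x) \<in> U" unfolding U_def by (simp add: bounded_functions_cmult rb)
    from nrm[OF L this, of j] have "w * \<bar>L j r\<bar> \<le> nrm (L j)"
      by (simp add: cmult[OF L rb] abs_mult w_def)
    then have "\<bar>L j r\<bar> \<le> (1/3) ^ j * (nrm (L j) / 2)" by (simp add: w_def field_simps)
    moreover have "L j r = L j f - L j (P (Suc j))"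
      unfolding r_def by (simp only: add[OF L fb bounded_functions_cmult[OF Pb]] cmult[OF L Pb])
    moreover have "(1/3) ^ j * (2 / 3 * nrm (L j)) \<le> (1/3) ^ j * \<bar>L j (h j)\<bar>"
      using attain[of j] by (intro mult_left_mono) auto
    moreover have "(1/3) ^ j * 4 ^ j \<le> (1/3) ^ j * nrm (L j)"
      using large[of j] by (intro mult_left_mono) auto
    moreover have "(1/3) ^ j * (4::real) ^ j = (4/3) ^ j" by (simp add: power_mult_distrib[symmetric])
    ultimately show ?thesis using LP[of j] c[of j] by linarith
  qed
  moreover obtain j where "6 * c < (4/3) ^ j" using real_arch_pow[of "4/3" "6 * c"] by auto
  ultimately show False by (metis not_le)
qed

section \<open>The unnormalised semigroup of the filter\<close>

locale bounded_likelihood = state_space_model S \<tau>\<^sub>0 \<tau> g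
  for S :: "'x measure" and \<tau>\<^sub>0 \<tau> and g :: "nat \<Rightarrow> 'y::euclidean_space \<Rightarrow> 'x \<Rightarrow> real" +
  fixes y :: "nat \<Rightarrow> 'y" and A :: real
  assumes A: "1 \<le> A"
    and g_bounds: "\<And>n x. 1 \<le> n \<Longrightarrow> x \<in> space S \<Longrightarrow> 1 / A \<le> g n (y n) x \<and> g n (y n) x \<le> A"
begin

definition Q :: "nat \<Rightarrow> ('x \<Rightarrow> real) \<Rightarrow> 'x \<Rightarrow> real"
  where "Q n f x = (\<integral>x'. f x' * g n (y n) x' \<partial>\<tau> n x)"

text \<open>A test function at time m + T is carried back to time m. The recursion takes off the
  earliest transition, so that the dependence on the starting state is explicit.\<close>

primrec U :: "nat \<Rightarrow> nat \<Rightarrow> ('x \<Rightarrow> real) \<Rightarrow> 'x \<Rightarrow> real"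
  where
    "U 0 m f = f"
  | "U (Suc T) m f = Q (Suc m) (U T (Suc m) f)"

text \<open>The joint density of the observations at times m + 1, ..., m + T given the state x at
  time m.\<close>

abbreviation G :: "nat \<Rightarrow> nat \<Rightarrow> 'x \<Rightarrow> real"
  where "G T m \<equiv> U T m (\<lambda>_. 1)"

text \<open>Takes off the latest transition instead, which matches the recursion of
  \<open>filter_comp\<close>.\<close>

lemma U_Suc': "U (Suc T) m f = U T m (Q (Suc (m + T)) f)"
proof (induction T arbitrary: m)
  case (Suc T)
  have "U (Suc (Suc T)) m f = Q (Suc m) (U (Suc T) (Suc m) f)" by simp
  also have "\<dots> = Q (Suc m) (U T (Suc m) (Q (Suc (Suc m + T)) f))" by (simp only: Suc.IH)
  finally show ?case by simp
qed simp

lemma A0: "0 < A" using A by simp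

lemma g_pos: "1 \<le> n \<Longrightarrow> x \<in> space S \<Longrightarrow> 0 < g n (y n) x"
  using g_bounds[of n x] A0 by (smt (verit) divide_pos_pos)

lemma kernel_prob: "1 \<le> n \<Longrightarrow> x \<in> space S \<Longrightarrow> \<tau> n x \<in> space (prob_algebra S)"
  using measurable_space[OF kernel] by blast

lemma times_g_bounded:
  assumes "1 \<le> n" "f \<in> bounded_functions S"
  shows "(\<lambda>x. f x * g n (y n) x) \<in> bounded_functions S"
proof -
  obtain b where b: "0 < b" "\<And>x. x \<in> space S \<Longrightarrow> \<bar>f x\<bar> \<le> b" using assms by (metis bounded_functionsE)
  have "\<bar>f x * g n (y n) x\<bar> \<le> b * A" if "x \<in> space S" for x
    unfolding abs_mult using b g_bounds[OF assms(1) that] g_pos[OF assms(1) that] that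
    by (intro mult_mono) auto
  then show ?thesis
    using bounded_functions_measurable[OF assms(2)] g_measurable[OF assms(1)]
    by (intro bounded_functionsI[where b="b * A"]) auto
qed

lemma Q_bounded:
  assumes n: "1 \<le> n" and f: "f \<in> bounded_functions S"
  shows "Q n f \<in> bounded_functions S"
proof -
  have m: "(\<lambda>x. f x * g n (y n) x) \<in> bounded_functions S" by (rule times_g_bounded[OF n f])
  note [measurable] = measurable_prob_algebraD[OF kernel[OF n]] bounded_functions_measurable[OF m]
  obtain b where "0 < b" and b: "\<And>x. x \<in> space S \<Longrightarrow> \<bar>f x * g n (y n) x\<bar> \<le> b"
    using m by (rule bounded_functionsE) (rule that)
  have "\<bar>Q n f x\<bar> \<le> b" if "x \<in> space S" for x
    unfolding Q_def using kernel_prob[OF n that] m b by (rule integral_prob_abs_le)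
  then show ?thesis
    by (intro bounded_functionsI) (auto simp: Q_def[abs_def])
qed

lemma U_bounded: "f \<in> bounded_functions S \<Longrightarrow> U T m f \<in> bounded_functions S"
  by (induction T arbitrary: m) (auto intro: Q_bounded)

lemma Q_ge:
  assumes n: "1 \<le> n" and x: "x \<in> space S" and f: "f \<in> bounded_functions S"
    and b: "0 \<le> b" "\<And>x. x \<in> space S \<Longrightarrow> b \<le> f x"
  shows "b / A \<le> Q n f x"
proof -
  have t: "prob_space (\<tau> n x)" "sets (\<tau> n x) = sets S"
    using kernel_prob[OF n x] by (auto simp: space_prob_algebra)
  interpret prob_space "\<tau> n x" by fact
  have "b * (1 / A) \<le> f x' * g n (y n) x'" if "x' \<in> space S" for x'
    using b b(2)[OF that] g_bounds[OF n that] A0 by (intro mult_mono) auto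
  then show ?thesis
    unfolding Q_def using sets_eq_imp_space_eq[OF t(2)]
      bounded_functions_integrable[OF kernel_prob[OF n x] times_g_bounded[OF n f]]
    by (intro integral_ge_const AE_I2) auto
qed

text \<open>This bound decays with T and serves positivity only; a comparison uniform in T is the
  content of \<open>likelihood_ratio_bounded\<close>.\<close>

lemma G_ge: "x \<in> space S \<Longrightarrow> (1 / A) ^ T \<le> G T m x"
proof (induction T arbitrary: m x)
  case (Suc T)
  have "(1 / A) ^ T / A \<le> Q (Suc m) (G T (Suc m)) x"
    using Suc A0 by (intro Q_ge U_bounded) auto
  then show ?case by simp
qed simp

lemma G_pos: "x \<in> space S \<Longrightarrow> 0 < G T m x"
  using G_ge[of x T m] A0 by (smt (verit) divide_pos_pos zero_less_power)

lemma integral_pos: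
  assumes "\<alpha> \<in> space (prob_algebra S)" "f \<in> bounded_functions S" "\<And>x. x \<in> space S \<Longrightarrow> b \<le> f x" "0 < b"
  shows "0 < (\<integral>x. f x \<partial>\<alpha>)"
proof -
  have s: "sets \<alpha> = sets S" and "prob_space \<alpha>" using assms by (auto simp: space_prob_algebra)
  then interpret prob_space \<alpha> by simp
  have "b \<le> (\<integral>x. f x \<partial>\<alpha>)"
    using bounded_functions_integrable[OF assms(1,2)] assms(3) sets_eq_imp_space_eq[OF s]
    by (intro integral_ge_const AE_I2) auto
  with assms(4) show ?thesis by simp
qed

lemma filter_comp_same: "filter_comp \<tau> g y m m = id"
  by (cases m) auto

lemma filter_comp_prob:
  assumes \<alpha>: "\<alpha> \<in> space (prob_algebra S)"
  shows "filter_comp \<tau> g y (m + T) m \<alpha> \<in> space (prob_algebra S)"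
proof (induction T)
  case 0
  then show ?case using \<alpha> by (simp add: filter_comp_same)
next
  case (Suc T)
  show ?case
    using filter_map_in_prob_algebra[where y=y, OF _ Suc A0 g_bounds, of "Suc (m + T)"] by simp
qed

text \<open>Normalising at every step or once at the end is the same: the intermediate normaliser
  \<open>G T m\<close> cancels in the quotient.\<close>

lemma integral_filter_comp:
  assumes \<alpha>: "\<alpha> \<in> space (prob_algebra S)" and f: "f \<in> bounded_functions S"
  shows "(\<integral>x. f x \<partial>filter_comp \<tau> g y (m + T) m \<alpha>) = (\<integral>x. U T m f x \<partial>\<alpha>) / (\<integral>x. G T m x \<partial>\<alpha>)"
  using f
proof (induction T arbitrary: f)
  case 0
  have "prob_space \<alpha>" using \<alpha> by (simp add: space_prob_algebra)
  then show ?case by (simp add: filter_comp_same prob_space.prob_space)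
next
  case (Suc T)
  let ?n = "Suc (m + T)" and ?\<beta> = "filter_comp \<tau> g y (m + T) m \<alpha>"
  have "(\<integral>x. f x \<partial>filter_comp \<tau> g y (m + Suc T) m \<alpha>) = (\<integral>x. f x \<partial>filter_map \<tau> g y ?n ?\<beta>)"
    by simp
  also have "\<dots> = (\<integral>x. Q ?n f x \<partial>?\<beta>) / (\<integral>x. Q ?n (\<lambda>_. 1) x \<partial>?\<beta>)"
    using integral_filter_map[where y=y, OF _ filter_comp_prob[OF \<alpha>] A0 g_bounds Suc.prems, of ?n]
    by (simp add: Q_def)
  also have "(\<integral>x. Q ?n f x \<partial>?\<beta>) = (\<integral>x. U T m (Q ?n f) x \<partial>\<alpha>) / (\<integral>x. G T m x \<partial>\<alpha>)"
    using Suc.prems by (intro Suc.IH Q_bounded) auto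
  also have "(\<integral>x. Q ?n (\<lambda>_. 1) x \<partial>?\<beta>) = (\<integral>x. U T m (Q ?n (\<lambda>_. 1)) x \<partial>\<alpha>) / (\<integral>x. G T m x \<partial>\<alpha>)"
    by (intro Suc.IH Q_bounded) auto
  also have "(\<integral>x. U T m (Q ?n f) x \<partial>\<alpha>) / (\<integral>x. G T m x \<partial>\<alpha>) / \<dots>
     = (\<integral>x. U (Suc T) m f x \<partial>\<alpha>) / (\<integral>x. G (Suc T) m x \<partial>\<alpha>)"
    using integral_pos[OF \<alpha> U_bounded[OF bounded_functions_const] G_ge, of T m] A0
    unfolding U_Suc' by simp
  finally show ?case .
qed

lemma filter_comp_0: "filter_comp \<tau> g y n 0 = (\<lambda>\<alpha>. filter_measure \<alpha> \<tau> g y n)"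
  by (induction n) auto

lemma integral_filter_measure:
  "f \<in> bounded_functions S \<Longrightarrow>
    (\<integral>x. f x \<partial>filter_measure \<tau>\<^sub>0 \<tau> g y n) = (\<integral>x. U n 0 f x \<partial>\<tau>\<^sub>0) / (\<integral>x. G n 0 x \<partial>\<tau>\<^sub>0)"
  using integral_filter_comp[OF prior, of f 0 n] by (simp add: filter_comp_0)

lemma return_prob: "x \<in> space S \<Longrightarrow> return S x \<in> space (prob_algebra S)"
  by (auto simp: space_prob_algebra intro: prob_space_return)

text \<open>Started from a Dirac measure, the filter has mean \<open>U T m f x / G T m x\<close>;
  stability for Dirac measures is thus a bound on the oscillation of this quotient.\<close>

lemma integral_filter_comp_return:
  assumes x: "x \<in> space S" and f: "f \<in> bounded_functions S"
  shows "(\<integral>x. f x \<partial>filter_comp \<tau> g y (m + T) m (return S x)) = U T m f x / G T m x"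
  unfolding integral_filter_comp[OF return_prob[OF x] f]
  using x U_bounded[OF f] U_bounded[OF bounded_functions_const]
  by (simp add: integral_return bounded_functions_measurable)

end

text \<open>
  Quadratic decay with a constant that may depend on the test function.  It follows from
  exponential stability at rates \<open>\<nu> h\<close> that need not be bounded away from zero.
\<close>

locale forgetting = bounded_likelihood +
  assumes forgetting: "\<And>h. h \<in> bounded_functions S \<Longrightarrow>
    \<exists>B. \<forall>T m. \<forall>x\<in>space S. \<forall>x'\<in>space S. \<bar>U T m h x / G T m x - U T m h x' / G T m x'\<bar> \<le> B / (real T + 1)\<^sup>2"
begin

text \<open>The functionals are (T + 1)^2 times the difference of two filters started at points,
  indexed by T, m and the two points. Written as integrals against probability measures they are
  visibly linear, with norm at most 2 (T + 1)^2; pointwise boundedness is the locale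
  assumption.\<close>

lemma uniform_forgetting:
  obtains B where "0 \<le> B" "\<And>T m x x' h b. x \<in> space S \<Longrightarrow> x' \<in> space S \<Longrightarrow> h \<in> bounded_functions S \<Longrightarrow>
    (\<And>z. z \<in> space S \<Longrightarrow> \<bar>h z\<bar> \<le> b) \<Longrightarrow> 0 < b \<Longrightarrow>
    \<bar>U T m h x / G T m x - U T m h x' / G T m x'\<bar> \<le> B * b / (real T + 1)\<^sup>2"
proof -
  define \<mu> where "\<mu> T m x = filter_comp \<tau> g y (m + T) m (return S x)" for T m x
  have \<mu>: "\<mu> T m x \<in> space (prob_algebra S)" if "x \<in> space S" for T m x
    unfolding \<mu>_def using that by (intro filter_comp_prob return_prob)
  define L where "L T m x x' h = (real T + 1)\<^sup>2 * ((\<integral>z. h z \<partial>\<mu> T m x) - (\<integral>z. h z \<partial>\<mu> T m x'))" for T m x x' h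
  define F where "F = {L T m x x' | T m x x'. x \<in> space S \<and> x' \<in> space S}"
  have L_eq: "L T m x x' h = (real T + 1)\<^sup>2 * (U T m h x / G T m x - U T m h x' / G T m x')"
    if "x \<in> space S" "x' \<in> space S" "h \<in> bounded_functions S" for T m x x' h
    using that by (simp add: L_def \<mu>_def integral_filter_comp_return)
  have "\<exists>B\<ge>0. \<forall>L\<in>F. \<forall>h\<in>bounded_functions S. (\<forall>x\<in>space S. \<bar>h x\<bar> \<le> 1) \<longrightarrow> \<bar>L h\<bar> \<le> B"
  proof (rule uniform_boundedness)
    fix L' h h' assume L': "L' \<in> F" and h: "h \<in> bounded_functions S"
    then obtain T m x x' where L'_eq: "L' = L T m x x'" and x: "x \<in> space S" "x' \<in> space S"
      by (auto simp: F_def)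
    note int = bounded_functions_integrable[OF \<mu>[OF x(1)]] bounded_functions_integrable[OF \<mu>[OF x(2)]]
    show "L' (\<lambda>x. c * h x) = c * L' h" for c by (simp add: L'_eq L_def algebra_simps)
    show "L' (\<lambda>x. h x + h' x) = L' h + L' h'" if "h' \<in> bounded_functions S"
      using int h that by (simp add: L'_eq L_def algebra_simps)
  next
    fix L' assume L': "L' \<in> F"
    then obtain T m x x' where L'_eq: "L' = L T m x x'" and x: "x \<in> space S" "x' \<in> space S"
      by (auto simp: F_def)
    have "\<bar>L' h\<bar> \<le> (real T + 1)\<^sup>2 * 2" if h: "h \<in> bounded_functions S" "\<forall>x\<in>space S. \<bar>h x\<bar> \<le> 1" for h
    proof -
      have "\<bar>(\<integral>z. h z \<partial>\<mu> T m x)\<bar> \<le> 1" "\<bar>(\<integral>z. h z \<partial>\<mu> T m x')\<bar> \<le> 1"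
        using h x by (auto intro!: integral_prob_abs_le[OF \<mu>])
      then have "\<bar>(\<integral>z. h z \<partial>\<mu> T m x) - (\<integral>z. h z \<partial>\<mu> T m x')\<bar> \<le> 2" by linarith
      then show ?thesis by (simp add: L'_eq L_def abs_mult)
    qed
    then show "\<exists>k. \<forall>h\<in>bounded_functions S. (\<forall>x\<in>space S. \<bar>h x\<bar> \<le> 1) \<longrightarrow> \<bar>L' h\<bar> \<le> k" by blast
  next
    fix h assume h: "h \<in> bounded_functions S"
    obtain B where B: "\<bar>U T m h x / G T m x - U T m h x' / G T m x'\<bar> \<le> B / (real T + 1)\<^sup>2"
      if "x \<in> space S" "x' \<in> space S" for T m x x'
      using forgetting[OF h] by blast
    have "\<bar>L T m x x' h\<bar> \<le> B" if "x \<in> space S" "x' \<in> space S" for T m x x'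
      using B[OF that, of T m] by (simp add: L_eq[OF that h] abs_mult pos_le_divide_eq mult.commute)
    then show "\<exists>c. \<forall>L\<in>F. \<bar>L h\<bar> \<le> c" by (intro exI[of _ B]) (auto simp: F_def)
  qed
  then obtain B where B: "0 \<le> B" "\<And>T m x x' h. x \<in> space S \<Longrightarrow> x' \<in> space S \<Longrightarrow> h \<in> bounded_functions S \<Longrightarrow>
    (\<And>z. z \<in> space S \<Longrightarrow> \<bar>h z\<bar> \<le> 1) \<Longrightarrow> \<bar>L T m x x' h\<bar> \<le> B"
    by (fastforce simp: F_def)
  show thesis
  proof (rule that[OF B(1)])
    fix T m x x' h and b :: real
    assume x: "x \<in> space S" "x' \<in> space S" and h: "h \<in> bounded_functions S"
      and b: "\<And>z. z \<in> space S \<Longrightarrow> \<bar>h z\<bar> \<le> b" "0 < b"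
    have "\<bar>L T m x x' (\<lambda>z. (1 / b) * h z)\<bar> \<le> B"
      using b by (intro B(2) x bounded_functions_cmult h) (auto simp: abs_mult divide_le_eq)
    moreover have "L T m x x' (\<lambda>z. (1 / b) * h z) = (1 / b) * L T m x x' h"
      unfolding L_def integral_mult_right_zero by (simp only: right_diff_distrib mult.left_commute)
    ultimately have "\<bar>L T m x x' h\<bar> \<le> B * b" using b(2) by (simp add: abs_mult divide_le_eq)
    then show "\<bar>U T m h x / G T m x - U T m h x' / G T m x'\<bar> \<le> B * b / (real T + 1)\<^sup>2"
      unfolding L_eq[OF x h] by (simp add: abs_mult pos_le_divide_eq mult.commute)
  qed
qed

end

text \<open>Telescoping with 1 / (T (T + 1)). At T = 0 the right-hand side is 2, since 1 / 0 =
  0.\<close>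

lemma sum_inverse_squares_le: "(\<Sum>t<T. 1 / (real t + 1)\<^sup>2) \<le> 2 - 1 / real T"
proof (induction T)
  case (Suc T)
  show ?case
  proof (cases "T = 0")
    case False
    have "1 / (real T + 1)\<^sup>2 \<le> 1 / (real T * (real T + 1))"
      using False by (intro divide_left_mono) (auto simp: power2_eq_square)
    also have "\<dots> = 1 / real T - 1 / real (Suc T)" using False by (simp add: field_simps)
    finally show ?thesis using Suc unfolding sum.lessThan_Suc by linarith
  qed simp
qed simp

text \<open>The predictive likelihoods \<open>G (Suc T) m x / G T m x\<close> forget the starting
  point at rate (T + 1)^-2 and are at least 1/A, so at two points they differ by a factor at most 1
  + e T with summable e. Multiplying over the steps gives a bound free of T.\<close>

lemma (in forgetting) likelihood_ratio_bounded:
  obtains D where "1 \<le> D" "\<And>T m x x'. x \<in> space S \<Longrightarrow> x' \<in> space S \<Longrightarrow> G T m x \<le> D * G T m x'"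
proof -
  obtain B where B: "0 \<le> B" "\<And>T m x x' h b. x \<in> space S \<Longrightarrow> x' \<in> space S \<Longrightarrow> h \<in> bounded_functions S \<Longrightarrow>
    (\<And>z. z \<in> space S \<Longrightarrow> \<bar>h z\<bar> \<le> b) \<Longrightarrow> 0 < b \<Longrightarrow>
    \<bar>U T m h x / G T m x - U T m h x' / G T m x'\<bar> \<le> B * b / (real T + 1)\<^sup>2"
    using uniform_forgetting by blast
  \<comment> \<open>The absolute error is \<open>B * A / (T + 1)\<^sup>2\<close>, since
    \<open>A\<close> bounds the test function \<open>q\<close>; dividing by the lower bound 1/A of
    the predictive likelihood supplies the second factor \<open>A\<close>.\<close>
  define e where "e T = A\<^sup>2 * B * (1 / (real T + 1)\<^sup>2)" for T
  have e0: "0 \<le> e T" for T using A0 B(1) by (simp add: e_def)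
  have step: "G (Suc T) m x / G T m x \<le> (1 + e T) * (G (Suc T) m x' / G T m x')"
    if x: "x \<in> space S" "x' \<in> space S" for T m x x'
  proof -
    \<comment> \<open>This test function changes with m + T. A forgetting constant depending on the
      test function would not be uniform in m and T here.\<close>
    define q where "q = Q (Suc (m + T)) (\<lambda>_. 1)"
    have q: "q \<in> bounded_functions S" unfolding q_def by (intro Q_bounded) auto
    have qA: "\<bar>q z\<bar> \<le> A" if "z \<in> space S" for z
      unfolding q_def Q_def using that g_bounds g_pos[THEN less_imp_le]
      by (intro integral_prob_abs_le[OF kernel_prob] times_g_bounded) auto
    have "1 / A \<le> q z" if "z \<in> space S" for z
      unfolding q_def using that by (intro Q_ge) auto
    then have "1 / A \<le> U T m q x' / G T m x'"
      using integral_filter_comp_return[OF x(2) q, of m T]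
        prob_space.integral_ge_const[of "filter_comp \<tau> g y (m + T) m (return S x')" q "1 / A"]
        filter_comp_prob[OF return_prob[OF x(2)], of m T]
        bounded_functions_integrable[OF filter_comp_prob[OF return_prob[OF x(2)]] q, of m T]
      by (auto simp: space_prob_algebra intro!: AE_I2 dest: sets_eq_imp_space_eq)
    then have "A * B * A * (1 / (real T + 1)\<^sup>2) * (1 / A) \<le> A * B * A * (1 / (real T + 1)\<^sup>2) * (U T m q x' / G T m x')"
      using A0 B(1) by (intro mult_left_mono) auto
    then have "B * A / (real T + 1)\<^sup>2 \<le> e T * (U T m q x' / G T m x')"
      using A0 by (simp add: e_def power2_eq_square mult_ac)
    moreover have "\<bar>U T m q x / G T m x - U T m q x' / G T m x'\<bar> \<le> B * A / (real T + 1)\<^sup>2"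
      using B(2)[OF x q qA A0] by simp
    ultimately show ?thesis
      unfolding U_Suc' q_def[symmetric] distrib_right mult_1_left by linarith
  qed
  have prod: "G T m x \<le> exp (\<Sum>t<T. e t) * G T m x'" if x: "x \<in> space S" "x' \<in> space S" for T m x x'
  proof (induction T)
    case (Suc T)
    have "G (Suc T) m x \<le> (1 + e T) * (G (Suc T) m x' / G T m x') * G T m x"
      using step[OF x, of T m] G_pos[OF x(1), of T m] by (simp add: divide_le_eq)
    also have "\<dots> \<le> exp (e T) * (G (Suc T) m x' / G T m x') * (exp (\<Sum>t<T. e t) * G T m x')"
      using Suc exp_ge_add_one_self[of "e T"] G_pos[OF x(2)] G_pos[OF x(1)] e0[of T]
      by (intro mult_mono mult_right_mono) (auto simp del: U.simps intro!: mult_nonneg_nonneg less_imp_le)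
    also have "\<dots> = exp (\<Sum>t<Suc T. e t) * G (Suc T) m x'"
      using G_pos[OF x(2), of T m] by (simp add: exp_add)
    finally show ?case .
  qed simp
  have "(\<Sum>t<T. e t) \<le> A\<^sup>2 * B * 2" for T
  proof -
    have "(\<Sum>t<T. 1 / (real t + 1)\<^sup>2) \<le> 2"
      using sum_inverse_squares_le[of T] by (smt (verit) divide_nonneg_nonneg of_nat_0_le_iff)
    then show ?thesis
      unfolding e_def sum_distrib_left[symmetric] using B(1) by (intro mult_left_mono) auto
  qed
  then have "G T m x \<le> exp (A\<^sup>2 * B * 2) * G T m x'" if "x \<in> space S" "x' \<in> space S" for T m x x'
    using prod[OF that, of T m] G_pos[OF that(2), of T m]
    by (smt (verit) exp_le_cancel_iff mult_right_mono)
  then show thesis using B(1) by (intro that[of "exp (A\<^sup>2 * B * 2)"]) auto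
qed

section \<open>One step of the particle filter\<close>

lemma moment_le_distr:
  assumes [measurable]: "f \<in> N \<rightarrow>\<^sub>M N'" "Z \<in> borel_measurable N'"
  shows "moment_le (distr N N' f) q Z R \<longleftrightarrow> moment_le N q (\<lambda>x. Z (f x)) R"
  by (simp add: moment_le_def nn_integral_distr)

lemma moment_le_return:
  assumes "s \<in> space N" "Z \<in> borel_measurable N" "\<bar>Z s\<bar> \<le> R" "0 \<le> q"
  shows "moment_le (return N s) q Z R"
  using assms by (auto simp: moment_le_def nn_integral_return intro!: ennreal_leI powr_mono2)

section \<open>Weight functionals of a configuration\<close>

definition wsum :: "nat \<Rightarrow> nat \<Rightarrow> ('x \<Rightarrow> real) \<Rightarrow> 'x config \<Rightarrow> real"
  where "wsum M K f s = (\<Sum>i\<in>pe_index M K. snd s i * f (fst s i))"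

definition total_weight :: "nat \<Rightarrow> nat \<Rightarrow> 'x config \<Rightarrow> real"
  where "total_weight M K s = (\<Sum>i\<in>pe_index M K. snd s i)"

text \<open>It bounds the sum of the squared normalised weights, hence its square root is the scale
  of all conditional fluctuations.\<close>

definition max_weight :: "nat \<Rightarrow> nat \<Rightarrow> 'x config \<Rightarrow> real"
  where "max_weight M K s = (MAX i\<in>pe_index M K. snd s i / total_weight M K s)"

definition max_pe_weight :: "nat \<Rightarrow> nat \<Rightarrow> 'x config \<Rightarrow> real"
  where "max_pe_weight M K s = (MAX m\<in>{1..M}. normalized_pe_weight M K (snd s) m)"

lemma sum_pe_index: "(\<Sum>i\<in>pe_index M K. f i) = (\<Sum>m\<in>{1..M}. \<Sum>k\<in>{1..K}. f (m, k))"
  unfolding pe_index_def sum.cartesian_product by (rule sum.cong) auto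

lemma total_weight_eq: "total_weight M K s = (\<Sum>m\<in>{1..M}. pe_weight K (snd s) m)"
  by (simp add: total_weight_def pe_weight_def sum_pe_index)

lemma normalized_pe_weight_eq: "normalized_pe_weight M K (snd s) m = pe_weight K (snd s) m / total_weight M K s"
  by (simp add: normalized_pe_weight_def total_weight_eq)

locale pe_array =
  fixes S :: "'x measure" and M K :: nat
  assumes M: "1 \<le> M" and K: "1 \<le> K"
begin

abbreviation I :: "(nat \<times> nat) set" where "I \<equiv> pe_index M K"
abbreviation C :: "'x config measure" where "C \<equiv> config_space S M K"

lemma I_ne: "I \<noteq> {}"
  using M K by (auto simp: pe_index_def)

lemma particle_in_space: "s \<in> space C \<Longrightarrow> i \<in> I \<Longrightarrow> fst s i \<in> space S"
  by (rule measurable_space[OF measurable_particle])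

lemma total_weight_pos: "s \<in> space C \<Longrightarrow> 0 < total_weight M K s"
  unfolding total_weight_def using I_ne by (intro sum_pos) (auto intro: weight_pos)

lemma measurable_total_weight [measurable]: "total_weight M K \<in> borel_measurable C"
  unfolding total_weight_def[abs_def] by (intro borel_measurable_sum measurable_weight)

lemma measurable_wsum: "f \<in> borel_measurable S \<Longrightarrow> wsum M K f \<in> borel_measurable C"
  unfolding wsum_def[abs_def]
  by (intro borel_measurable_sum borel_measurable_times measurable_weight
      measurable_compose[OF measurable_particle])

lemma measurable_max_weight [measurable]: "max_weight M K \<in> borel_measurable C"
  unfolding max_weight_def[abs_def]
  by (intro borel_measurable_Max borel_measurable_divide measurable_weight measurable_total_weight) simp_all

lemma measurable_max_pe_weight [measurable]: "max_pe_weight M K \<in> borel_measurable C"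
  unfolding max_pe_weight_def[abs_def] normalized_pe_weight_eq
  by (intro borel_measurable_Max borel_measurable_divide measurable_pe_weight measurable_total_weight) simp_all

lemma weight_le_max: "i \<in> I \<Longrightarrow> snd s i / total_weight M K s \<le> max_weight M K s"
  unfolding max_weight_def by (intro Max_ge) auto

lemma max_weight_le_iff: "max_weight M K s \<le> b \<longleftrightarrow> (\<forall>i\<in>I. snd s i / total_weight M K s \<le> b)"
  unfolding max_weight_def using I_ne by (subst Max_le_iff) auto

lemma pe_weight_le_max: "m \<in> {1..M} \<Longrightarrow> pe_weight K (snd s) m / total_weight M K s \<le> max_pe_weight M K s"
  unfolding max_pe_weight_def normalized_pe_weight_eq by (intro Max_ge) auto

lemma max_pe_weight_le_iff:
  "max_pe_weight M K s \<le> b \<longleftrightarrow> (\<forall>m\<in>{1..M}. pe_weight K (snd s) m / total_weight M K s \<le> b)"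
  unfolding max_pe_weight_def normalized_pe_weight_eq using M by (subst Max_le_iff) auto

lemma max_weight_pos: "s \<in> space C \<Longrightarrow> 0 < max_weight M K s"
proof -
  assume s: "s \<in> space C"
  obtain i where i: "i \<in> I" using I_ne by blast
  have "0 < snd s i / total_weight M K s" using weight_pos[OF s i] total_weight_pos[OF s] by simp
  with weight_le_max[OF i, of s] show ?thesis by linarith
qed

lemma max_pe_weight_pos: "s \<in> space C \<Longrightarrow> 0 < max_pe_weight M K s"
proof -
  assume s: "s \<in> space C"
  have "0 < pe_weight K (snd s) 1 / total_weight M K s"
    using pe_weight_pos[OF s K, of 1] M total_weight_pos[OF s] by simp
  with pe_weight_le_max[of 1 s] M show ?thesis by simp
qed

lemma pe_weight_le: "m \<in> {1..M} \<Longrightarrow> pe_weight K (snd s) m / total_weight M K s \<le> real K * max_weight M K s"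
proof -
  assume m: "m \<in> {1..M}"
  have "pe_weight K (snd s) m / total_weight M K s = (\<Sum>k\<in>{1..K}. snd s (m, k) / total_weight M K s)"
    by (simp add: pe_weight_def sum_divide_distrib)
  also have "\<dots> \<le> (\<Sum>k\<in>{1..K}. max_weight M K s)"
    using m by (intro sum_mono weight_le_max) (auto simp: pe_index_def)
  finally show ?thesis by simp
qed

lemma max_pe_weight_le: "max_pe_weight M K s \<le> real K * max_weight M K s"
  unfolding max_pe_weight_le_iff using pe_weight_le by blast

lemma sum_normalized_weights: "s \<in> space C \<Longrightarrow> (\<Sum>i\<in>I. snd s i / total_weight M K s) = 1"
  using total_weight_pos[of s] by (simp add: sum_divide_distrib[symmetric] total_weight_def[symmetric])

lemma local_weight_nonneg:
  assumes s: "s \<in> space C" and i: "i \<in> I" "j \<in> {1..K}"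
  shows "0 \<le> local_weight K (snd s) (fst i, j)"
proof -
  have "fst i \<in> {1..M}" "(fst i, j) \<in> I" using i by (auto simp: pe_index_def)
  then show ?thesis
    using pe_weight_pos[OF s K] weight_pos[OF s] by (simp add: local_weight_def divide_nonneg_nonneg less_imp_le)
qed

definition ancestor_law :: "'x config \<Rightarrow> nat \<times> nat \<Rightarrow> nat measure"
  where "ancestor_law s i = point_measure {1..K} (\<lambda>j. ennreal (local_weight K (snd s) (fst i, j)))"

definition resample :: "'x config \<Rightarrow> (nat \<times> nat \<Rightarrow> nat) \<Rightarrow> 'x config"
  where "resample s A = (\<lambda>i\<in>I. fst s (fst i, A i), \<lambda>i\<in>I. pe_weight K (snd s) (fst i) / real K)"

lemma resampling_step_eq: "resampling_step S M K s = distr (PiM I (ancestor_law s)) C (resample s)"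
proof -
  have "PiM I (\<lambda>(m, k). point_measure {1..K} (\<lambda>j. ennreal (local_weight K (snd s) (m, j)))) = PiM I (ancestor_law s)"
    by (rule PiM_cong) (auto simp: ancestor_law_def)
  then show ?thesis by (simp add: resampling_step_def resample_def[abs_def])
qed

lemma prob_space_ancestor_law:
  assumes s: "s \<in> space C" and i: "i \<in> I"
  shows "prob_space (ancestor_law s i)"
proof -
  have "0 < pe_weight K (snd s) (fst i)" using i by (intro pe_weight_pos[OF s K]) (auto simp: pe_index_def)
  moreover have "(\<Sum>j\<in>{1..K}. snd s (fst i, j)) = pe_weight K (snd s) (fst i)" by (simp add: pe_weight_def)
  ultimately have "(\<Sum>j\<in>{1..K}. local_weight K (snd s) (fst i, j)) = 1"
    by (simp add: local_weight_def sum_divide_distrib[symmetric])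
  moreover have "(\<Sum>j\<in>{1..K}. ennreal (local_weight K (snd s) (fst i, j))) = ennreal (\<Sum>j\<in>{1..K}. local_weight K (snd s) (fst i, j))"
    using local_weight_nonneg[OF s i] by (intro sum_ennreal) auto
  ultimately show ?thesis
    by (intro prob_spaceI) (simp add: ancestor_law_def space_point_measure emeasure_point_measure_finite)
qed

lemma resample_measurable:
  assumes s: "s \<in> space C"
  shows "resample s \<in> PiM I (ancestor_law s) \<rightarrow>\<^sub>M C"
  unfolding resample_def[abs_def]
proof (rule config_measurableI)
  fix i assume i: "i \<in> I"
  then have m: "fst i \<in> {1..M}" and idx: "\<And>j. j \<in> {1..K} \<Longrightarrow> (fst i, j) \<in> I" by (auto simp: pe_index_def)
  have sets: "sets (PiM I (ancestor_law s)) = sets (PiM I (\<lambda>_. count_space {1..K}))"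
    by (intro sets_PiM_cong) (auto simp: ancestor_law_def sets_point_measure)
  have A: "(\<lambda>A. A i) \<in> PiM I (ancestor_law s) \<rightarrow>\<^sub>M count_space {1..K}"
    unfolding measurable_cong_sets[OF sets refl] using i by measurable
  show "(\<lambda>A. fst s (fst i, A i)) \<in> PiM I (ancestor_law s) \<rightarrow>\<^sub>M S"
    using particle_in_space[OF s idx]
    by (intro measurable_compose[OF A, where g="\<lambda>j. fst s (fst i, j)"]) auto
  show "0 < pe_weight K (snd s) (fst i) / real K" using pe_weight_pos[OF s K m] K by simp
qed auto

end

text \<open>\<open>D\<close> is a parameter next to \<open>M\<close> and \<open>K\<close>, so that
  constants built from \<open>A\<close>, \<open>D\<close> and \<open>q\<close> are visibly
  independent of the numbers of elements and particles.\<close>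

locale particle_filter = forgetting S \<tau>\<^sub>0 \<tau> g y A + pe_array S M K
  for S :: "'x measure" and \<tau>\<^sub>0 \<tau> and g :: "nat \<Rightarrow> 'y::euclidean_space \<Rightarrow> 'x \<Rightarrow> real" and y A M K +
  fixes D q :: real
  assumes D: "1 \<le> D" "\<And>T m x x'. x \<in> space S \<Longrightarrow> x' \<in> space S \<Longrightarrow> G T m x \<le> D * G T m x'"
    and q: "1 \<le> q"
begin

text \<open>The value at \<open>h\<close> of \<open>\<Psi>\<^sub>m\<^sub>+\<^sub>T\<^sub>|\<^sub>m\<close> applied to the weighted empirical measure of a configuration.\<close>

definition \<Phi> :: "nat \<Rightarrow> nat \<Rightarrow> ('x \<Rightarrow> real) \<Rightarrow> 'x config \<Rightarrow> real"
  where "\<Phi> T m h s = wsum M K (U T m h) s / wsum M K (G T m) s"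

text \<open>The constant of \<open>PiM_ratio_moment_le\<close> with hi / lo equal to A^2 D^2: the
  state-dependent \<open>G\<close> varies by D in either direction from a reference point, and the
  likelihood by A around 1.\<close>

definition step_const :: real
  where "step_const = 4 * (A\<^sup>2 * D\<^sup>2) * moment_const q"

lemma step_const_pos: "0 < step_const"
  unfolding step_const_def using A0 D(1) q moment_const_pos[of q] by simp

lemma U_measurable: "h \<in> bounded_functions S \<Longrightarrow> U T m h \<in> borel_measurable S"
  by (intro bounded_functions_measurable U_bounded)

lemma G_measurable: "G T m \<in> borel_measurable S"
  by (simp add: U_measurable)

lemma \<Phi>_measurable: "h \<in> bounded_functions S \<Longrightarrow> \<Phi> T m h \<in> borel_measurable C"
  unfolding \<Phi>_def[abs_def] by (intro borel_measurable_divide measurable_wsum U_measurable G_measurable)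

lemma init_map_measurable:
  assumes "0 < w"
  shows "(\<lambda>x. (x, \<lambda>i\<in>I. w)) \<in> PiM I (\<lambda>_. \<tau>\<^sub>0) \<rightarrow>\<^sub>M C"
proof -
  have t: "sets \<tau>\<^sub>0 = sets S" using prior by (simp add: space_prob_algebra)
  show ?thesis
    unfolding config_space_def using assms
    by (intro measurable_Pair measurable_restrict measurable_restrict_space2)
      (auto simp: measurable_cong_sets[OF sets_PiM_cong[OF refl t] refl])
qed

text \<open>Scale invariance of the quotient. In a step the weights before and after are both
  divided by the total before the step, so that the input weights sum to 1 and stay deterministic
  given the configuration.\<close>

lemma \<Phi>_eq:
  assumes "0 < w"
  shows "\<Phi> T m h s = (\<Sum>i\<in>I. snd s i / w * U T m h (fst s i)) / (\<Sum>i\<in>I. snd s i / w * G T m (fst s i))"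
  using assms unfolding \<Phi>_def wsum_def
  by (simp add: sum_divide_distrib[symmetric])

text \<open>
  \<open>u\<close> is the likelihood in the sampling step, and \<open>1\<close> in the initialisation and in the resampling step.
\<close>

lemma ratio_moment_le:
  fixes v :: "nat \<times> nat \<Rightarrow> real" and N :: "nat \<times> nat \<Rightarrow> 'a measure" and X :: "nat \<times> nat \<Rightarrow> 'a \<Rightarrow> 'x"
  assumes N: "\<And>i. i \<in> I \<Longrightarrow> prob_space (N i)"
    and v: "\<And>i. i \<in> I \<Longrightarrow> 0 \<le> v i" "(\<Sum>i\<in>I. v i) = 1" "\<And>i. i \<in> I \<Longrightarrow> v i \<le> vm"
    and X: "\<And>i. i \<in> I \<Longrightarrow> X i \<in> N i \<rightarrow>\<^sub>M S"
    and u: "u \<in> borel_measurable S" "\<And>x. x \<in> space S \<Longrightarrow> 1 / A \<le> u x \<and> u x \<le> A"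
    and h: "h \<in> bounded_functions S" and \<delta>: "0 < \<delta>"
      "\<And>x x'. x \<in> space S \<Longrightarrow> x' \<in> space S \<Longrightarrow> \<bar>U T m h x / G T m x - U T m h x' / G T m x'\<bar> \<le> \<delta>"
  shows "moment_le (PiM I N) q
    (\<lambda>x. (\<Sum>i\<in>I. v i * (U T m h (X i (x i)) * u (X i (x i)))) / (\<Sum>i\<in>I. v i * (G T m (X i (x i)) * u (X i (x i))))
        - (\<Sum>i\<in>I. v i * (\<integral>z. U T m h (X i z) * u (X i z) \<partial>N i)) / (\<Sum>i\<in>I. v i * (\<integral>z. G T m (X i z) * u (X i z) \<partial>N i)))
    (step_const * \<delta> * sqrt vm)"
proof -
  have "prob_space \<tau>\<^sub>0" "sets \<tau>\<^sub>0 = sets S" using prior by (auto simp: space_prob_algebra)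
  then obtain x0 where x0: "x0 \<in> space S" using prob_space.not_empty sets_eq_imp_space_eq by blast
  \<comment> \<open>Both bounds are anchored at the reference point \<open>x0\<close>, so the
    possibly tiny value \<open>G T m x0\<close> cancels in hi / lo.\<close>
  define lo where "lo = G T m x0 / D * (1 / A)"
  define hi where "hi = D * G T m x0 * A"
  have lo: "0 < lo" using G_pos[OF x0] D(1) A0 by (simp add: lo_def)
  have Xs: "X i z \<in> space S" if "i \<in> I" "z \<in> space (N i)" for i z
    using measurable_space[OF X[OF that(1)] that(2)] .
  have "moment_le (PiM I N) q
    (\<lambda>x. (\<Sum>i\<in>I. v i * (U T m h (X i (x i)) * u (X i (x i)))) / (\<Sum>i\<in>I. v i * (G T m (X i (x i)) * u (X i (x i))))
        - (\<Sum>i\<in>I. v i * (\<integral>z. U T m h (X i z) * u (X i z) \<partial>N i)) / (\<Sum>i\<in>I. v i * (\<integral>z. G T m (X i z) * u (X i z) \<partial>N i)))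
    (4 * (hi / lo) * \<delta> * moment_const q * sqrt vm)"
  proof (rule PiM_ratio_moment_le[where t="U T m h x0 / G T m x0"])
    fix i assume i: "i \<in> I"
    note [measurable] = X[OF i] u(1) U_measurable[OF h] G_measurable
    show "(\<lambda>z. U T m h (X i z) * u (X i z)) \<in> borel_measurable (N i)"
      "(\<lambda>z. G T m (X i z) * u (X i z)) \<in> borel_measurable (N i)" by measurable
    fix z assume z: "z \<in> space (N i)"
    note x = Xs[OF i z]
    have u0: "0 < u (X i z)" using u(2)[OF x] A0 by (smt (verit) divide_pos_pos)
    show "lo \<le> G T m (X i z) * u (X i z)"
      unfolding lo_def using u(2)[OF x] D(2)[OF x0 x] D(1) G_pos[OF x] A0
      by (intro mult_mono) (auto simp: divide_le_eq mult.commute intro: less_imp_le)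
    show "G T m (X i z) * u (X i z) \<le> hi"
      unfolding hi_def using u(2)[OF x] D(2)[OF x x0] D(1) G_pos[OF x0] u0
      by (intro mult_mono) (auto intro!: mult_nonneg_nonneg less_imp_le)
    have "\<bar>U T m h (X i z) / G T m (X i z) - U T m h x0 / G T m x0\<bar> * (G T m (X i z) * u (X i z))
        \<le> \<delta> * (G T m (X i z) * u (X i z))"
      using \<delta>(2)[OF x x0] G_pos[OF x] u0 by (intro mult_right_mono less_imp_le[OF mult_pos_pos])
    also have "\<bar>U T m h (X i z) / G T m (X i z) - U T m h x0 / G T m x0\<bar> * (G T m (X i z) * u (X i z))
       = \<bar>(U T m h (X i z) / G T m (X i z) - U T m h x0 / G T m x0) * (G T m (X i z) * u (X i z))\<bar>"
      using G_pos[OF x, of T m] u0 by (simp add: abs_mult)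
    also have "(U T m h (X i z) / G T m (X i z) - U T m h x0 / G T m x0) * (G T m (X i z) * u (X i z))
       = U T m h (X i z) * u (X i z) - U T m h x0 / G T m x0 * (G T m (X i z) * u (X i z))"
      using G_pos[OF x, of T m] by (simp add: left_diff_distrib)
    finally show "\<bar>U T m h (X i z) * u (X i z) - U T m h x0 / G T m x0 * (G T m (X i z) * u (X i z))\<bar>
       \<le> \<delta> * (G T m (X i z) * u (X i z))" .
  qed (use N v lo \<delta> q in auto)
  moreover have "hi / lo = A\<^sup>2 * D\<^sup>2"
    using G_pos[OF x0, of T m] D(1) A0 by (simp add: hi_def lo_def power2_eq_square field_simps)
  ultimately show ?thesis by (simp add: step_const_def mult_ac)
qed

section \<open>Conditional errors of initialisation, resampling and sampling\<close>

context
  fixes h T m \<delta>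
  assumes h: "h \<in> bounded_functions S" and \<delta>: "0 < \<delta>"
      "\<And>x x'. x \<in> space S \<Longrightarrow> x' \<in> space S \<Longrightarrow> \<bar>U T m h x / G T m x - U T m h x' / G T m x'\<bar> \<le> \<delta>"
begin

lemma init_moment_le:
  assumes "m = 0"
  shows "moment_le (init_law S \<tau>\<^sub>0 M K) q (\<lambda>s. \<Phi> T m h s - (\<integral>x. U T m h x \<partial>\<tau>\<^sub>0) / (\<integral>x. G T m x \<partial>\<tau>\<^sub>0))
    (step_const * \<delta> * sqrt (1 / (real M * real K)))"
proof -
  have t: "prob_space \<tau>\<^sub>0" "sets \<tau>\<^sub>0 = sets S" using prior by (auto simp: space_prob_algebra)
  define w where "w = 1 / (real M * real K)"
  have w: "0 < w" using M K by (simp add: w_def)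
  have card: "(\<Sum>i\<in>I. w) = 1" using M K by (simp add: w_def pe_index_def)
  note F = init_map_measurable[OF w]
  have "(\<Sum>i\<in>I. w * c) = c" for c
    by (simp only: sum_distrib_right[symmetric] card mult_1)
  moreover have "moment_le (PiM I (\<lambda>_. \<tau>\<^sub>0)) q
    (\<lambda>x. (\<Sum>i\<in>I. w * (U T m h (x i) * 1)) / (\<Sum>i\<in>I. w * (G T m (x i) * 1))
        - (\<Sum>i\<in>I. w * (\<integral>z. U T m h z * 1 \<partial>\<tau>\<^sub>0)) / (\<Sum>i\<in>I. w * (\<integral>z. G T m z * 1 \<partial>\<tau>\<^sub>0)))
    (step_const * \<delta> * sqrt w)"
    using t w card A h \<delta>
    by (intro ratio_moment_le[where X="\<lambda>i z. z"]) (auto simp: measurable_ident_sets)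
  ultimately have "moment_le (PiM I (\<lambda>_. \<tau>\<^sub>0)) q
      (\<lambda>x. \<Phi> T m h (x, \<lambda>i\<in>I. w) - (\<integral>x. U T m h x \<partial>\<tau>\<^sub>0) / (\<integral>x. G T m x \<partial>\<tau>\<^sub>0)) (step_const * \<delta> * sqrt w)"
    by (simp add: \<Phi>_def wsum_def del: sum_constant)
  then show ?thesis
    unfolding init_law_def w_def[symmetric] using \<Phi>_measurable[OF h]
    by (subst moment_le_distr[OF F]) auto
qed

text \<open>Given s the ancestors are independent, and position (m, k) carries the fixed weight of a
  K-th part of its aggregate. Local multinomial resampling is unbiased, so the conditional means of
  numerator and denominator are those of s.\<close>

lemma resampling_moment_le:
  assumes s: "s \<in> space C"
  shows "moment_le (resampling_step S M K s) q (\<lambda>s'. \<Phi> T m h s' - \<Phi> T m h s)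
    (step_const * \<delta> * sqrt (max_weight M K s))"
proof -
  define W where "W = total_weight M K s"
  have W: "0 < W" using total_weight_pos[OF s] by (simp add: W_def)
  define X where "X i j = fst s (fst i, j)" for i :: "nat \<times> nat" and j :: nat
  define v where "v i = pe_weight K (snd s) (fst i) / real K / W" for i :: "nat \<times> nat"
  have m: "fst i \<in> {1..M}" if "i \<in> I" for i using that by (auto simp: pe_index_def)
  have idx: "(fst i, j) \<in> I" if "i \<in> I" "j \<in> {1..K}" for i j using that by (auto simp: pe_index_def)
  have X: "X i \<in> ancestor_law s i \<rightarrow>\<^sub>M S" if "i \<in> I" for i
    unfolding ancestor_law_def X_def using particle_in_space[OF s idx[OF that]]
    by (auto simp: measurable_point_measure_eq1)
  have v1: "(\<Sum>i\<in>I. v i) = 1"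
  proof -
    have "(\<Sum>i\<in>I. v i) = (\<Sum>m\<in>{1..M}. pe_weight K (snd s) m) / W"
      using K by (simp add: sum_pe_index v_def sum_divide_distrib)
    then show ?thesis using W by (simp add: W_def total_weight_eq)
  qed
  \<comment> \<open>A resampled weight is the average of the K weights of its element, hence at most
    the largest particle weight.\<close>
  have vle: "v i \<le> max_weight M K s" if "i \<in> I" for i
    using divide_right_mono[OF pe_weight_le[OF m[OF that], of s], of "real K"] K by (simp add: v_def W_def mult.commute)
  have "0 \<le> v i" if "i \<in> I" for i
    using pe_weight_pos[OF s K m[OF that]] W by (simp add: v_def)
  then have "moment_le (PiM I (ancestor_law s)) q
    (\<lambda>A. (\<Sum>i\<in>I. v i * (U T m h (X i (A i)) * 1)) / (\<Sum>i\<in>I. v i * (G T m (X i (A i)) * 1))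
        - (\<Sum>i\<in>I. v i * (\<integral>z. U T m h (X i z) * 1 \<partial>ancestor_law s i))
          / (\<Sum>i\<in>I. v i * (\<integral>z. G T m (X i z) * 1 \<partial>ancestor_law s i)))
    (step_const * \<delta> * sqrt (max_weight M K s))"
    using prob_space_ancestor_law[OF s] v1 vle X A h \<delta> by (intro ratio_moment_le) auto
  moreover have "(\<Sum>i\<in>I. v i * (U T m f (X i (A i)) * 1))
      = (\<Sum>i\<in>I. snd (resample s A) i / W * U T m f (fst (resample s A) i))" for A f
    by (rule sum.cong) (auto simp: v_def resample_def X_def)
  \<comment> \<open>Unbiasedness: the K positions of an element have equal means, which cancels the
    factor 1/K, and the aggregate cancels the local normaliser.\<close>
  moreover have "(\<Sum>i\<in>I. v i * (\<integral>z. U T m f (X i z) * 1 \<partial>ancestor_law s i))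
      = (\<Sum>i\<in>I. snd s i / W * U T m f (fst s i))" for f
  proof -
    have int: "(\<integral>z. U T m f (X i z) * 1 \<partial>ancestor_law s i)
        = (\<Sum>j\<in>{1..K}. local_weight K (snd s) (fst i, j) * U T m f (X i j))" if "i \<in> I" for i
      using local_weight_nonneg[OF s that] unfolding ancestor_law_def
      by (subst lebesgue_integral_point_measure_finite) auto
    have "(\<Sum>i\<in>I. v i * (\<integral>z. U T m f (X i z) * 1 \<partial>ancestor_law s i))
      = (\<Sum>i\<in>I. v i * (\<Sum>j\<in>{1..K}. local_weight K (snd s) (fst i, j) * U T m f (X i j)))"
      using int by (intro sum.cong) auto
    also have "\<dots> = (\<Sum>m'\<in>{1..M}. pe_weight K (snd s) m' / W * (\<Sum>j\<in>{1..K}. local_weight K (snd s) (m', j) * U T m f (fst s (m', j))))"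
      using K by (simp add: sum_pe_index v_def X_def)
    also have "\<dots> = (\<Sum>m'\<in>{1..M}. \<Sum>j\<in>{1..K}. snd s (m', j) / W * U T m f (fst s (m', j)))"
    proof (rule sum.cong[OF refl])
      fix m' assume "m' \<in> {1..M}"
      then have "0 < pe_weight K (snd s) m'" by (rule pe_weight_pos[OF s K])
      then show "pe_weight K (snd s) m' / W * (\<Sum>j\<in>{1..K}. local_weight K (snd s) (m', j) * U T m f (fst s (m', j)))
        = (\<Sum>j\<in>{1..K}. snd s (m', j) / W * U T m f (fst s (m', j)))"
        by (simp add: sum_distrib_left local_weight_def)
    qed
    finally show ?thesis by (simp add: sum_pe_index)
  qed
  ultimately have "moment_le (PiM I (ancestor_law s)) q (\<lambda>A. \<Phi> T m h (resample s A) - \<Phi> T m h s)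
      (step_const * \<delta> * sqrt (max_weight M K s))"
    unfolding \<Phi>_eq[OF W] by simp
  then show ?thesis
    unfolding resampling_step_eq using \<Phi>_measurable[OF h]
    by (subst moment_le_distr[OF resample_measurable[OF s]]) auto
qed

end

lemma sampling_map_measurable:
  assumes s: "s \<in> space C" and n: "1 \<le> n"
  shows "(\<lambda>x. (x, \<lambda>i\<in>I. snd s i * g n (y n) (x i))) \<in> PiM I (\<lambda>i. \<tau> n (fst s i)) \<rightarrow>\<^sub>M C"
proof -
  have sets: "sets (PiM I (\<lambda>i. \<tau> n (fst s i))) = sets (PiM I (\<lambda>_. S))"
    using kernel_prob[OF n particle_in_space[OF s]] by (intro sets_PiM_cong) (auto simp: space_prob_algebra)
  note [measurable] = g_measurable[OF n]
  have "(\<lambda>x. (x, \<lambda>i\<in>I. snd s i * g n (y n) (x i))) \<in> PiM I (\<lambda>_. S) \<rightarrow>\<^sub>M C"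
    unfolding config_space_def
  proof (intro measurable_Pair measurable_restrict measurable_restrict_space2)
    fix i assume i: "i \<in> I"
    then show "(\<lambda>x. snd s i * g n (y n) (x i)) \<in> borel_measurable (PiM I (\<lambda>_. S))" by measurable
    show "(\<lambda>x. snd s i * g n (y n) (x i)) \<in> space (PiM I (\<lambda>_. S)) \<rightarrow> {0<..}"
      using i weight_pos[OF s i] g_pos[OF n] by (auto simp: space_PiM PiE_iff)
  qed auto
  then show ?thesis unfolding measurable_cong_sets[OF sets refl] .
qed

text \<open>Integrating \<open>U T (Suc m) h\<close> times the likelihood against the kernel is one
  application of \<open>Q\<close>, so the quotient of the conditional means is
  \<open>\<Phi> (Suc T) m h s\<close>.\<close>

lemma sampling_moment_le:
  assumes h: "h \<in> bounded_functions S" and \<delta>: "0 < \<delta>"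
      "\<And>x x'. x \<in> space S \<Longrightarrow> x' \<in> space S \<Longrightarrow> \<bar>U T (Suc m) h x / G T (Suc m) x - U T (Suc m) h x' / G T (Suc m) x'\<bar> \<le> \<delta>"
    and s: "s \<in> space C"
  shows "moment_le (sampling_step S \<tau> g y M K (Suc m) s) q (\<lambda>s'. \<Phi> T (Suc m) h s' - \<Phi> (Suc T) m h s)
    (step_const * \<delta> * sqrt (max_weight M K s))"
proof -
  define W where "W = total_weight M K s"
  have W: "0 < W" using total_weight_pos[OF s] by (simp add: W_def)
  have "moment_le (PiM I (\<lambda>i. \<tau> (Suc m) (fst s i))) q
    (\<lambda>x. (\<Sum>i\<in>I. snd s i / W * (U T (Suc m) h (x i) * g (Suc m) (y (Suc m)) (x i)))
           / (\<Sum>i\<in>I. snd s i / W * (G T (Suc m) (x i) * g (Suc m) (y (Suc m)) (x i)))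
        - (\<Sum>i\<in>I. snd s i / W * (\<integral>z. U T (Suc m) h z * g (Suc m) (y (Suc m)) z \<partial>\<tau> (Suc m) (fst s i)))
           / (\<Sum>i\<in>I. snd s i / W * (\<integral>z. G T (Suc m) z * g (Suc m) (y (Suc m)) z \<partial>\<tau> (Suc m) (fst s i))))
    (step_const * \<delta> * sqrt (max_weight M K s))"
  proof (rule ratio_moment_le[where X="\<lambda>i z. z"])
    fix i assume i: "i \<in> I"
    have t: "\<tau> (Suc m) (fst s i) \<in> space (prob_algebra S)"
      by (intro kernel_prob particle_in_space s i) simp
    then show "prob_space (\<tau> (Suc m) (fst s i))" by (simp add: space_prob_algebra)
    show "(\<lambda>z. z) \<in> \<tau> (Suc m) (fst s i) \<rightarrow>\<^sub>M S"
      using t by (simp add: space_prob_algebra measurable_ident_sets)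
    show "0 \<le> snd s i / W" using weight_pos[OF s i] W by simp
    show "snd s i / W \<le> max_weight M K s" unfolding W_def by (rule weight_le_max[OF i])
  qed (use h \<delta> g_bounds g_measurable sum_normalized_weights[OF s] in \<open>auto simp: W_def\<close>)
  moreover have "(\<Sum>i\<in>I. snd s i / W * (f (x i) * g (Suc m) (y (Suc m)) (x i)))
     = (\<Sum>i\<in>I. (\<lambda>i\<in>I. snd s i * g (Suc m) (y (Suc m)) (x i)) i / W * f (x i))" for f x
    by (rule sum.cong) auto
  ultimately have "moment_le (PiM I (\<lambda>i. \<tau> (Suc m) (fst s i))) q
     (\<lambda>x. \<Phi> T (Suc m) h (x, \<lambda>i\<in>I. snd s i * g (Suc m) (y (Suc m)) (x i)) - \<Phi> (Suc T) m h s)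
     (step_const * \<delta> * sqrt (max_weight M K s))"
    unfolding \<Phi>_eq[OF W] by (simp add: Q_def del: restrict_apply)
  then show ?thesis
    unfolding sampling_step_def using \<Phi>_measurable[OF h]
    by (subst moment_le_distr[OF sampling_map_measurable[OF s]]) auto
qed

text \<open>Particles travel together with their weights, so exchange only reindexes the sum: every
  \<open>\<Phi>\<close> is unchanged and the step contributes no error.\<close>

lemma exchange_wsum:
  assumes \<beta>: "bij_betw \<beta> I I"
  shows "wsum M K f (exchange \<beta> M K s) = wsum M K f s"
proof -
  have "wsum M K f (exchange \<beta> M K s)
    = (\<Sum>i\<in>I. snd s (inv_into I \<beta> i) * f (fst s (inv_into I \<beta> i)))"
    unfolding wsum_def exchange_def by (rule sum.cong) auto
  also have "\<dots> = wsum M K f s"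
    unfolding wsum_def by (rule sum.reindex_bij_betw[OF bij_betw_inv_into[OF \<beta>]])
  finally show ?thesis .
qed

lemma exchange_total_weight: "bij_betw \<beta> I I \<Longrightarrow> total_weight M K (exchange \<beta> M K s) = total_weight M K s"
  using exchange_wsum[of \<beta> "\<lambda>_. 1" s] by (simp add: wsum_def total_weight_def)

lemma exchange_max_weight:
  assumes \<beta>: "bij_betw \<beta> I I"
  shows "max_weight M K (exchange \<beta> M K s) \<le> max_weight M K s"
  unfolding max_weight_le_iff exchange_total_weight[OF \<beta>]
proof
  fix i assume i: "i \<in> I"
  then have "inv_into I \<beta> i \<in> I" using bij_betw_inv_into[OF \<beta>] by (auto simp: bij_betw_def)
  from weight_le_max[OF this, of s] i
  show "snd (exchange \<beta> M K s) i / total_weight M K s \<le> max_weight M K s"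
    by (simp add: exchange_def)
qed

lemma exchange_in_space:
  assumes \<beta>: "bij_betw \<beta> I I" and s: "s \<in> space C"
  shows "exchange \<beta> M K s \<in> space C"
proof -
  have "exchange \<beta> M K \<in> C \<rightarrow>\<^sub>M C"
    unfolding exchange_def[abs_def] using bij_betw_inv_into[OF \<beta>]
    by (intro config_measurableI measurable_particle measurable_weight) (auto simp: bij_betw_def intro: weight_pos)
  from measurable_space[OF this s] show ?thesis .
qed

lemma exchange_moment_le:
  assumes \<beta>: "bij_betw \<beta> I I" and s: "s \<in> space C"
    and f: "f \<in> borel_measurable C" "\<And>s. s \<in> space C \<Longrightarrow> f (exchange \<beta> M K s) \<le> f s" "\<And>s. s \<in> space C \<Longrightarrow> 0 \<le> f s"
  shows "moment_le (exchange_step S n\<^sub>0 \<beta> M K n s) q f (f s)"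
  unfolding exchange_step_def using exchange_in_space[OF \<beta> s] s f q
  by (intro moment_le_return) auto

section \<open>Propagation of the largest weight\<close>

text \<open>The numerator grows by at most A and the total shrinks by at most 1/A. A general index
  set \<open>J\<close> covers a single particle as well as a whole processing element.\<close>

lemma sampled_weight_le:
  assumes s: "s \<in> space C" and n: "1 \<le> n" and x: "\<And>i. i \<in> I \<Longrightarrow> x i \<in> space S" and J: "J \<subseteq> I"
  defines "s' \<equiv> (x, \<lambda>i\<in>I. snd s i * g n (y n) (x i))"
  shows "(\<Sum>i\<in>J. snd s' i) / total_weight M K s' \<le> A\<^sup>2 * ((\<Sum>i\<in>J. snd s i) / total_weight M K s)"
proof -
  have W: "0 < total_weight M K s" by (rule total_weight_pos[OF s])
  have "(\<Sum>i\<in>J. snd s' i) \<le> (\<Sum>i\<in>J. snd s i * A)"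
    using J g_bounds[OF n x] weight_pos[OF s] by (intro sum_mono) (auto simp: s'_def subset_iff intro!: mult_left_mono less_imp_le)
  moreover have "(\<Sum>i\<in>I. snd s i * (1 / A)) \<le> total_weight M K s'"
    unfolding total_weight_def
  proof (intro sum_mono)
    fix i assume i: "i \<in> I"
    have "snd s i * (1 / A) \<le> snd s i * g n (y n) (x i)"
      using g_bounds[OF n x[OF i]] weight_pos[OF s i] by (intro mult_left_mono) auto
    then show "snd s i * (1 / A) \<le> snd s' i" using i by (simp add: s'_def)
  qed
  moreover have "0 \<le> (\<Sum>i\<in>J. snd s i)" using J weight_pos[OF s] by (intro sum_nonneg) (auto intro: less_imp_le)
  ultimately have "(\<Sum>i\<in>J. snd s' i) / total_weight M K s' \<le> ((\<Sum>i\<in>J. snd s i) * A) / (total_weight M K s * (1 / A))"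
    using W A0 by (intro frac_le) (auto simp: total_weight_def sum_distrib_right[symmetric] sum_divide_distrib[symmetric])
  then show ?thesis using A0 by (simp add: power2_eq_square mult_ac)
qed

lemma sampled_space:
  assumes s: "s \<in> space C" and n: "1 \<le> n" and x: "x \<in> space (PiM I (\<lambda>i. \<tau> n (fst s i)))" and i: "i \<in> I"
  shows "x i \<in> space S"
  using x i kernel_prob[OF n particle_in_space[OF s i]]
  by (auto simp: space_PiM PiE_iff space_prob_algebra dest!: sets_eq_imp_space_eq)

lemma prob_space_sampling:
  assumes "s \<in> space C" "1 \<le> n"
  shows "prob_space (PiM I (\<lambda>i. \<tau> n (fst s i)))"
  using kernel_prob[OF assms(2) particle_in_space[OF assms(1)]]
  by (intro prob_space_PiM) (auto simp: space_prob_algebra)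

lemma sampling_max_weight:
  assumes s: "s \<in> space C" and n: "1 \<le> n"
  shows "moment_le (sampling_step S \<tau> g y M K n s) q (max_weight M K) (A\<^sup>2 * max_weight M K s)"
  unfolding sampling_step_def moment_le_distr[OF sampling_map_measurable[OF s n] measurable_max_weight]
proof (rule moment_le_const[OF prob_space_sampling[OF s n]])
  fix x assume x: "x \<in> space (PiM I (\<lambda>i. \<tau> n (fst s i)))"
  let ?s = "(x, \<lambda>i\<in>I. snd s i * g n (y n) (x i))"
  have "max_weight M K ?s \<le> A\<^sup>2 * max_weight M K s"
    unfolding max_weight_le_iff
  proof
    fix i assume i: "i \<in> I"
    have "snd ?s i / total_weight M K ?s \<le> A\<^sup>2 * (snd s i / total_weight M K s)"
      using sampled_weight_le[OF s n sampled_space[OF s n x], where J="{i}"] i by simp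
    also have "\<dots> \<le> A\<^sup>2 * max_weight M K s" using weight_le_max[OF i, of s] by (intro mult_left_mono) auto
    finally show "snd ?s i / total_weight M K ?s \<le> A\<^sup>2 * max_weight M K s" .
  qed
  moreover have "0 < max_weight M K ?s"
    using measurable_space[OF sampling_map_measurable[OF s n] x] by (rule max_weight_pos)
  ultimately show "\<bar>max_weight M K ?s\<bar> \<le> A\<^sup>2 * max_weight M K s" by simp
qed (use q in auto)

lemma sampling_max_pe_weight:
  assumes s: "s \<in> space C" and n: "1 \<le> n"
  shows "moment_le (sampling_step S \<tau> g y M K n s) q (max_pe_weight M K) (A\<^sup>2 * max_pe_weight M K s)"
  unfolding sampling_step_def moment_le_distr[OF sampling_map_measurable[OF s n] measurable_max_pe_weight]
proof (rule moment_le_const[OF prob_space_sampling[OF s n]])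
  fix x assume x: "x \<in> space (PiM I (\<lambda>i. \<tau> n (fst s i)))"
  let ?s = "(x, \<lambda>i\<in>I. snd s i * g n (y n) (x i))"
  have pe: "pe_weight K (snd s) m = (\<Sum>i\<in>{m} \<times> {1..K}. snd s i)" for s :: "'x config" and m
    unfolding pe_weight_def by (simp add: sum.cartesian_product')
  have "max_pe_weight M K ?s \<le> A\<^sup>2 * max_pe_weight M K s"
    unfolding max_pe_weight_le_iff
  proof
    fix m assume m: "m \<in> {1..M}"
    have "pe_weight K (snd ?s) m / total_weight M K ?s \<le> A\<^sup>2 * (pe_weight K (snd s) m / total_weight M K s)"
      unfolding pe using m by (intro sampled_weight_le[OF s n sampled_space[OF s n x]]) (auto simp: pe_index_def)
    also have "\<dots> \<le> A\<^sup>2 * max_pe_weight M K s" using pe_weight_le_max[OF m, of s] by (intro mult_left_mono) auto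
    finally show "pe_weight K (snd ?s) m / total_weight M K ?s \<le> A\<^sup>2 * max_pe_weight M K s" .
  qed
  moreover have "0 < max_pe_weight M K ?s"
    using measurable_space[OF sampling_map_measurable[OF s n] x] by (rule max_pe_weight_pos)
  ultimately show "\<bar>max_pe_weight M K ?s\<bar> \<le> A\<^sup>2 * max_pe_weight M K s" by simp
qed (use q in auto)

text \<open>Resampling keeps the total and spreads each aggregate evenly over its K
  particles.\<close>

lemma resampled_max_weight: "max_weight M K (resample s J) \<le> max_pe_weight M K s / real K"
  unfolding max_weight_le_iff
proof
  fix i assume i: "i \<in> I"
  then have m: "fst i \<in> {1..M}" by (auto simp: pe_index_def)
  have "total_weight M K (resample s J) = (\<Sum>i\<in>I. pe_weight K (snd s) (fst i) / real K)"
    unfolding total_weight_def by (intro sum.cong) (auto simp: resample_def)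
  also have "\<dots> = total_weight M K s"
    using K by (simp add: sum_pe_index total_weight_eq)
  finally have "snd (resample s J) i / total_weight M K (resample s J)
      = (pe_weight K (snd s) (fst i) / total_weight M K s) / real K"
    using i by (simp add: resample_def)
  also have "\<dots> \<le> max_pe_weight M K s / real K"
    using pe_weight_le_max[OF m, of s] by (intro divide_right_mono) auto
  finally show "snd (resample s J) i / total_weight M K (resample s J) \<le> max_pe_weight M K s / real K" .
qed

lemma resampling_max_weight:
  assumes s: "s \<in> space C"
  shows "moment_le (resampling_step S M K s) q (max_weight M K) (max_pe_weight M K s / real K)"
  unfolding resampling_step_eq moment_le_distr[OF resample_measurable[OF s] measurable_max_weight]
proof (rule moment_le_const)
  show "prob_space (PiM I (ancestor_law s))" by (intro prob_space_PiM prob_space_ancestor_law[OF s])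
  fix J assume "J \<in> space (PiM I (ancestor_law s))"
  then have "0 < max_weight M K (resample s J)"
    by (intro max_weight_pos measurable_space[OF resample_measurable[OF s]])
  then show "\<bar>max_weight M K (resample s J)\<bar> \<le> max_pe_weight M K s / real K"
    using resampled_max_weight[of s J] by simp
qed (use q in auto)

end

text \<open>The q-th moment of \<open>sqrt Z\<close> is the moment of \<open>Z\<close> of order q/2,
  which Lyapunov's inequality controls.\<close>

lemma moment_le_sqrt:
  assumes P: "prob_space P" and q: "0 < q" and [measurable]: "Z \<in> borel_measurable P"
    and Z: "moment_le P q Z b" "0 < b" "\<And>s. s \<in> space P \<Longrightarrow> 0 \<le> Z s" and c: "0 \<le> c"
  shows "moment_le P q (\<lambda>s. c * sqrt (Z s)) (c * sqrt b)"
proof (rule moment_le_scale)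
  have sq: "sqrt z powr q = z powr (q / 2)" if "0 \<le> z" for z :: real
    using that by (simp add: powr_half_sqrt[symmetric] powr_powr)
  have "moment_le P (q / 2) Z b" by (rule moment_le_exponent[OF P _ _ Z(2,1)]) (use q in auto)
  moreover have "(\<integral>\<^sup>+x. ennreal (\<bar>sqrt (Z x)\<bar> powr q) \<partial>P) = (\<integral>\<^sup>+x. ennreal (\<bar>Z x\<bar> powr (q / 2)) \<partial>P)"
    using Z(3) by (intro nn_integral_cong) (simp add: sq)
  ultimately show "moment_le P q (\<lambda>s. sqrt (Z s)) (sqrt b)"
    using Z(2) by (simp add: moment_le_def sq)
qed (use q c Z in \<open>auto simp: abs_mult\<close>)

lemma lp_norm_le:
  assumes P: "prob_space P" and p: "0 < p" "p \<le> q" and R: "0 < R"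
    and Z: "moment_le P q Z R" and [measurable]: "Z \<in> borel_measurable P"
  shows "lp_norm P p Z \<le> R"
proof -
  have "moment_le P p Z R" by (rule moment_le_exponent[OF P p R Z]) measurable
  then have "(\<integral>s. \<bar>Z s\<bar> powr p \<partial>P) \<le> R powr p"
    unfolding moment_le_def by (subst integral_eq_nn_integral) (auto intro!: enn2real_leI)
  then have "lp_norm P p Z \<le> (R powr p) powr (1 / p)"
    unfolding lp_norm_def using p by (intro powr_mono2) auto
  also have "\<dots> = R" using p R by (simp add: powr_powr)
  finally show ?thesis .
qed

section \<open>Error recursion\<close>

locale distributed_filter = particle_filter +
  fixes n\<^sub>0 :: nat and \<beta> :: "nat \<times> nat \<Rightarrow> nat \<times> nat"
  assumes n\<^sub>0: "1 \<le> n\<^sub>0" and \<beta>: "bij_betw \<beta> I I"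
begin

abbreviation law :: "nat \<Rightarrow> 'a config measure"
  where "law \<equiv> dpf_law S \<tau>\<^sub>0 \<tau> g y n\<^sub>0 \<beta> M K"

lemma law_prob: "law n \<in> space (prob_algebra C)"
  by (rule dpf_law_in_prob_algebra[OF M K \<beta>]) (rule g_pos)

lemma sampling_kernel: "sampling_step S \<tau> g y M K (Suc n) \<in> C \<rightarrow>\<^sub>M prob_algebra C"
  by (intro sampling_step_kernel kernel g_measurable g_pos) auto

lemma exchange_kernel: "exchange_step S n\<^sub>0 \<beta> M K n \<in> C \<rightarrow>\<^sub>M prob_algebra C"
  by (rule exchange_step_kernel[OF \<beta>])

lemma bind_prob:
  assumes "P \<in> space (prob_algebra C)" "\<kappa> \<in> C \<rightarrow>\<^sub>M prob_algebra C"
  shows "P \<bind> \<kappa> \<in> space (prob_algebra C)"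
  using measurable_space[OF measurable_bind_prob_space[OF measurable_ident assms(2)] assms(1)] by simp

lemma sampled_law_prob: "law n \<bind> sampling_step S \<tau> g y M K (Suc n) \<in> space (prob_algebra C)"
  by (intro bind_prob law_prob sampling_kernel)

lemma resampled_law_prob:
  "law n \<bind> sampling_step S \<tau> g y M K (Suc n) \<bind> resampling_step S M K \<in> space (prob_algebra C)"
  by (intro bind_prob sampled_law_prob resampling_step_kernel K)

lemma measurable_prob:
  assumes "P \<in> space (prob_algebra C)" "f \<in> borel_measurable C"
  shows "f \<in> borel_measurable P"
proof -
  have "sets P = sets C" using assms(1) by (simp add: space_prob_algebra)
  from measurable_cong_sets[OF this refl] assms(2) show ?thesis by blast
qed

lemma space_prob:
  assumes "P \<in> space (prob_algebra C)" "s \<in> space P"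
  shows "s \<in> space C"
proof -
  have "sets P = sets C" using assms(1) by (simp add: space_prob_algebra)
  from sets_eq_imp_space_eq[OF this] assms(2) show ?thesis by blast
qed

lemma moment_le_cmult:
  assumes P: "P \<in> space (prob_algebra C)" and f: "f \<in> borel_measurable C" "moment_le P q f R" "0 \<le> R" "0 \<le> c"
  shows "moment_le P q (\<lambda>s. c * f s) (c * R)"
  using measurable_prob[OF P f(1)] q f by (intro moment_le_scale[of P q f]) (auto simp: abs_mult)

text \<open>Sampling costs A^2, resampling brings in 1/K, and exchange permutes the particle
  weights. This is the source of the factor K^(-1/2) in the final rate.\<close>

lemma law_max_weight_step:
  assumes R: "moment_le (law n) q (max_pe_weight M K) R" "0 \<le> R"
  shows "moment_le (law (Suc n)) q (max_weight M K) (A\<^sup>2 * R / real K)"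
proof -
  let ?P1 = "law n \<bind> sampling_step S \<tau> g y M K (Suc n)"
  have "moment_le ?P1 q (max_pe_weight M K) (A\<^sup>2 * R)"
  proof (rule moment_le_bind[OF law_prob sampling_kernel measurable_max_pe_weight])
    show "moment_le (law n) q (\<lambda>s. A\<^sup>2 * max_pe_weight M K s) (A\<^sup>2 * R)"
      by (intro moment_le_cmult law_prob R measurable_max_pe_weight) simp
  qed (auto intro!: sampling_max_pe_weight mult_nonneg_nonneg less_imp_le[OF max_pe_weight_pos])
  then have 1: "moment_le ?P1 q (\<lambda>s. (1 / real K) * max_pe_weight M K s) ((1 / real K) * (A\<^sup>2 * R))"
    using R by (intro moment_le_cmult sampled_law_prob measurable_max_pe_weight) auto
  have "moment_le (?P1 \<bind> resampling_step S M K) q (max_weight M K) (A\<^sup>2 * R / real K)"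
    using 1 by (intro moment_le_bind[OF sampled_law_prob resampling_step_kernel[OF K] measurable_max_weight
          resampling_max_weight]) (auto intro: divide_nonneg_nonneg less_imp_le[OF max_pe_weight_pos])
  then show ?thesis
    unfolding dpf_law.simps
    by (intro moment_le_bind[OF resampled_law_prob exchange_kernel measurable_max_weight exchange_moment_le])
      (auto intro: exchange_max_weight \<beta> less_imp_le[OF max_weight_pos])
qed

text \<open>Exchange may regroup particles, so the aggregate is not followed directly: after
  resampling every particle weight is at most the largest aggregate over K, and an element receives
  just K of them.\<close>

lemma law_max_pe_weight_step:
  assumes R: "moment_le (law n) q (max_pe_weight M K) R" "0 \<le> R"
  shows "moment_le (law (Suc n)) q (max_pe_weight M K) (A\<^sup>2 * R)"
proof -
  have K0: "0 < real K" using K by simp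
  have "moment_le (law (Suc n)) q (max_pe_weight M K) (real K * (A\<^sup>2 * R / real K))"
  proof (rule moment_le_scale[OF law_max_weight_step[OF R]])
    fix s assume "s \<in> space (law (Suc n))"
    then have "s \<in> space C" by (rule space_prob[OF law_prob])
    then show "\<bar>max_pe_weight M K s\<bar> \<le> real K * \<bar>max_weight M K s\<bar>"
      using max_pe_weight_le[of s] max_pe_weight_pos[of s] max_weight_pos[of s] by simp
  qed (use measurable_prob[OF law_prob measurable_max_weight] q R in \<open>auto simp del: dpf_law.simps\<close>)
  then show ?thesis using K0 by (simp del: dpf_law.simps)
qed

lemma law_max_weight:
  assumes R: "\<And>r. moment_le (law (r * n\<^sub>0)) q (max_pe_weight M K) R" "1 / real M \<le> R"
  shows "moment_le (law n) q (max_weight M K) ((A\<^sup>2) ^ Suc n\<^sub>0 * R / real K)"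
proof (cases n)
  case 0
  have R0: "0 \<le> R" using R(2) by (smt (verit) divide_nonneg_nonneg of_nat_0_le_iff)
  have A2: "1 \<le> (A\<^sup>2) ^ Suc n\<^sub>0" using A by (intro one_le_power) (simp add: one_le_power)
  define w where "w = 1 / (real M * real K)"
  have w: "0 < w" using M K by (simp add: w_def)
  have t: "prob_space \<tau>\<^sub>0" "sets \<tau>\<^sub>0 = sets S" using prior by (auto simp: space_prob_algebra)
  note F = init_map_measurable[OF w]
  have "moment_le (init_law S \<tau>\<^sub>0 M K) q (max_weight M K) w"
    unfolding init_law_def w_def[symmetric] moment_le_distr[OF F measurable_max_weight]
  proof (rule moment_le_const[OF prob_space_PiM])
    fix x assume x: "x \<in> space (PiM I (\<lambda>_. \<tau>\<^sub>0))"
    have "total_weight M K (x, \<lambda>i\<in>I. w) = (\<Sum>i\<in>I. w)"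
      unfolding total_weight_def by (rule sum.cong) auto
    also have "\<dots> = 1" using M K by (simp add: w_def pe_index_def)
    finally have "max_weight M K (x, \<lambda>i\<in>I. w) \<le> w" by (simp add: max_weight_le_iff)
    then show "\<bar>max_weight M K (x, \<lambda>i\<in>I. w)\<bar> \<le> w"
      using max_weight_pos[OF measurable_space[OF F x]] by simp
  qed (use t q in auto)
  moreover have "w \<le> (A\<^sup>2) ^ Suc n\<^sub>0 * R / real K"
  proof -
    have "w = 1 / real M / real K" by (simp add: w_def)
    also have "\<dots> \<le> (A\<^sup>2) ^ Suc n\<^sub>0 * R / real K"
      using R(2) mult_right_mono[OF A2 R0] by (intro divide_right_mono) auto
    finally show ?thesis .
  qed
  ultimately show ?thesis
    using q w 0 by (auto intro: moment_le_leI)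
next
  case (Suc n')
  have R0: "0 \<le> R" using R(2) by (smt (verit) divide_nonneg_nonneg of_nat_0_le_iff)
  have A2: "1 \<le> A\<^sup>2" using A by (simp add: one_le_power)
  \<comment> \<open>Restart at the last multiple of the period up to \<open>n'\<close>. Fewer than
    \<open>n\<^sub>0\<close> steps lead to \<open>n'\<close>, and one more to \<open>n\<close>,
    hence the exponent \<open>Suc n\<^sub>0\<close>.\<close>
  define r where "r = n' div n\<^sub>0"
  have "moment_le (law (r * n\<^sub>0 + j)) q (max_pe_weight M K) ((A\<^sup>2) ^ j * R)" for j
  proof (induction j)
    case (Suc j)
    then show ?case
      using law_max_pe_weight_step[OF Suc] R0 by (simp add: mult.assoc)
  qed (use R in simp)
  from this[of "n' mod n\<^sub>0"] have "moment_le (law n') q (max_pe_weight M K) ((A\<^sup>2) ^ (n' mod n\<^sub>0) * R)"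
    by (simp add: r_def)
  moreover have "(A\<^sup>2) ^ (n' mod n\<^sub>0) * R \<le> (A\<^sup>2) ^ n\<^sub>0 * R"
    using A2 R0 n\<^sub>0 by (intro mult_right_mono power_increasing) (auto intro: less_imp_le)
  ultimately have "moment_le (law n') q (max_pe_weight M K) ((A\<^sup>2) ^ n\<^sub>0 * R)"
    using q R0 by (auto intro: moment_le_leI)
  from law_max_weight_step[OF this] R0 show ?thesis by (simp add: Suc mult.assoc)
qed

text \<open>Sampling contributes at the weight level b, resampling at the level A^2 b reached after
  sampling; the square roots add up to (1 + A) sqrt b.\<close>

lemma error_step:
  assumes h: "h \<in> bounded_functions S" and \<delta>: "0 < \<delta>"
      "\<And>x x'. x \<in> space S \<Longrightarrow> x' \<in> space S \<Longrightarrow> \<bar>U T (Suc n) h x / G T (Suc n) x - U T (Suc n) h x' / G T (Suc n) x'\<bar> \<le> \<delta>"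
    and b: "moment_le (law n) q (max_weight M K) b" "0 < b"
    and E: "moment_le (law n) q (\<lambda>s. \<Phi> (Suc T) n h s - e) E" "0 \<le> E"
  shows "moment_le (law (Suc n)) q (\<lambda>s. \<Phi> T (Suc n) h s - e) (E + step_const * \<delta> * (1 + A) * sqrt b)"
proof -
  let ?P1 = "law n \<bind> sampling_step S \<tau> g y M K (Suc n)"
  let ?r = "\<lambda>s. step_const * \<delta> * sqrt (max_weight M K s)"
  have sd: "0 < step_const * \<delta>" using step_const_pos \<delta>(1) by simp
  have r: "?r \<in> borel_measurable C" by measurable
  have r0: "0 \<le> ?r s" if "s \<in> space C" for s
    using max_weight_pos[OF that] by (intro mult_nonneg_nonneg[OF less_imp_le[OF sd]]) auto
  note \<Phi> = \<Phi>_measurable[OF h]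
  have rP: "moment_le P q ?r (step_const * \<delta> * sqrt b)"
    if P: "P \<in> space (prob_algebra C)" and "moment_le P q (max_weight M K) b" "0 < b" for P b
    using that q sd measurable_prob[OF P measurable_max_weight] max_weight_pos[OF space_prob[OF P], THEN less_imp_le]
    by (intro moment_le_sqrt) (auto simp: space_prob_algebra)
  have 1: "moment_le ?P1 q (\<lambda>s. \<Phi> T (Suc n) h s - e) (step_const * \<delta> * sqrt b + E)"
  proof (rule moment_le_bind_step[OF q law_prob sampling_kernel \<Phi> \<Phi> r _ r0])
    show "moment_le (law n) q ?r (step_const * \<delta> * sqrt b)" using b by (intro rP law_prob)
    show "moment_le (sampling_step S \<tau> g y M K (Suc n) s) q (\<lambda>s'. \<Phi> T (Suc n) h s' - \<Phi> (Suc T) n h s) (?r s)"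
      if "s \<in> space C" for s
      by (rule sampling_moment_le[OF h \<delta> that])
  qed (use E sd b in auto)
  have b1: "moment_le ?P1 q (max_weight M K) (A\<^sup>2 * b)"
  proof (rule moment_le_bind[OF law_prob sampling_kernel measurable_max_weight])
    show "moment_le (law n) q (\<lambda>s. A\<^sup>2 * max_weight M K s) (A\<^sup>2 * b)"
      using b by (intro moment_le_cmult law_prob measurable_max_weight) auto
  qed (auto intro!: sampling_max_weight mult_nonneg_nonneg less_imp_le[OF max_weight_pos])
  have sq: "sqrt (A\<^sup>2 * b) = A * sqrt b" using A0 by (simp add: real_sqrt_mult)
  have 2: "moment_le (?P1 \<bind> resampling_step S M K) q (\<lambda>s. \<Phi> T (Suc n) h s - e)
      (step_const * \<delta> * sqrt (A\<^sup>2 * b) + (step_const * \<delta> * sqrt b + E))"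
  proof (rule moment_le_bind_step[OF q sampled_law_prob resampling_step_kernel[OF K] \<Phi> \<Phi> r _ r0])
    show "moment_le ?P1 q ?r (step_const * \<delta> * sqrt (A\<^sup>2 * b))" using b1 b A0 by (intro rP sampled_law_prob) auto
    show "moment_le (resampling_step S M K s) q (\<lambda>s'. \<Phi> T (Suc n) h s' - \<Phi> T (Suc n) h s) (?r s)"
      if "s \<in> space C" for s
      by (rule resampling_moment_le[OF h \<delta> that])
  qed (use 1 E sd b A0 in auto)
  have "moment_le (law (Suc n)) q (\<lambda>s. \<bar>\<Phi> T (Suc n) h s - e\<bar>)
      (step_const * \<delta> * sqrt (A\<^sup>2 * b) + (step_const * \<delta> * sqrt b + E))"
    unfolding dpf_law.simps
  proof (rule moment_le_bind[OF resampled_law_prob exchange_kernel])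
    show "moment_le (?P1 \<bind> resampling_step S M K) q (\<lambda>s. \<bar>\<Phi> T (Suc n) h s - e\<bar>)
      (step_const * \<delta> * sqrt (A\<^sup>2 * b) + (step_const * \<delta> * sqrt b + E))"
      using 2 by (simp add: moment_le_def)
    show "moment_le (exchange_step S n\<^sub>0 \<beta> M K (Suc n) s) q (\<lambda>s. \<bar>\<Phi> T (Suc n) h s - e\<bar>) \<bar>\<Phi> T (Suc n) h s - e\<bar>"
      if "s \<in> space C" for s
    proof -
      have "\<Phi> T (Suc n) h (exchange \<beta> M K s) = \<Phi> T (Suc n) h s" for s
        by (simp add: \<Phi>_def exchange_wsum[OF \<beta>])
      then show ?thesis using that \<Phi> by (intro exchange_moment_le \<beta>) auto
    qed
  qed (use \<Phi> in auto)
  then show ?thesis unfolding sq by (simp add: moment_le_def algebra_simps)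
qed

text \<open>In the induction the target \<open>e\<close> at the final time is fixed and
  \<open>\<Phi> (n - m) m h\<close> predicts it from the particles at time m. The error made at time
  m is damped by the forgetting over the remaining n - m steps, and the squares sum to at most
  2.\<close>

lemma error_moment_le:
  assumes h: "h \<in> bounded_functions S" and B: "0 < B"
      "\<And>T m x x'. x \<in> space S \<Longrightarrow> x' \<in> space S \<Longrightarrow> \<bar>U T m h x / G T m x - U T m h x' / G T m x'\<bar> \<le> B / (real T + 1)\<^sup>2"
    and b: "\<And>n. moment_le (law n) q (max_weight M K) b" "1 / (real M * real K) \<le> b"
  shows "moment_le (law n) q (\<lambda>s. \<Phi> 0 n h s - (\<integral>x. U n 0 h x \<partial>\<tau>\<^sub>0) / (\<integral>x. G n 0 x \<partial>\<tau>\<^sub>0))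
    (step_const * (1 + A) * sqrt b * (2 * B))"
proof -
  define e where "e = (\<integral>x. U n 0 h x \<partial>\<tau>\<^sub>0) / (\<integral>x. G n 0 x \<partial>\<tau>\<^sub>0)"
  define L where "L = step_const * (1 + A) * sqrt b"
  define \<delta> where "\<delta> T = B / (real T + 1)\<^sup>2" for T
  have \<delta>: "0 < \<delta> T" for T using B(1) by (simp add: \<delta>_def add_pos_nonneg)
  have b0: "0 < b" using b(2) M K by (smt (verit) divide_pos_pos mult_pos_pos of_nat_0_less_iff less_le_trans zero_less_one)
  have L0: "0 \<le> L" using step_const_pos A0 b0 by (simp add: L_def)
  have "moment_le (law m) q (\<lambda>s. \<Phi> (n - m) m h s - e) (L * (\<Sum>j\<le>m. \<delta> (n - j)))" if "m \<le> n" for m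
    using that
  proof (induction m)
    case 0
    have "moment_le (law 0) q (\<lambda>s. \<Phi> n 0 h s - e) (step_const * \<delta> n * sqrt (1 / (real M * real K)))"
      unfolding dpf_law.simps e_def by (rule init_moment_le[OF h \<delta> B(2)[folded \<delta>_def]]) auto
    \<comment> \<open>The lower bound on \<open>b\<close> lets the initial sampling error share the
      constant of all later steps.\<close>
    moreover have "step_const * \<delta> n * sqrt (1 / (real M * real K)) \<le> L * \<delta> n"
    proof -
      have "(step_const * \<delta> n) * sqrt (1 / (real M * real K)) \<le> (step_const * \<delta> n) * ((1 + A) * sqrt b)"
        using step_const_pos \<delta>[of n] A0 b(2) b0
        by (intro mult_left_mono order_trans[OF real_sqrt_le_mono[OF b(2)]]) (auto simp: mult_le_cancel_right1)
      then show ?thesis by (simp add: L_def mult_ac)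
    qed
    ultimately show ?case
      using q step_const_pos \<delta>[of n] by (auto intro: moment_le_leI)
  next
    case (Suc m)
    have eq: "n - m = Suc (n - Suc m)" using Suc.prems by simp
    have "moment_le (law (Suc m)) q (\<lambda>s. \<Phi> (n - Suc m) (Suc m) h s - e)
       (L * (\<Sum>j\<le>m. \<delta> (n - j)) + step_const * \<delta> (n - Suc m) * (1 + A) * sqrt b)"
    proof (rule error_step[OF h \<delta> B(2)[folded \<delta>_def] b(1) b0])
      show "moment_le (law m) q (\<lambda>s. \<Phi> (Suc (n - Suc m)) m h s - e) (L * (\<Sum>j\<le>m. \<delta> (n - j)))"
        using Suc unfolding eq[symmetric] by simp
      show "0 \<le> L * (\<Sum>j\<le>m. \<delta> (n - j))"
        using L0 \<delta>[THEN less_imp_le] by (intro mult_nonneg_nonneg sum_nonneg) auto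
    qed auto
    then show ?case by (simp add: L_def distrib_left mult_ac)
  qed
  from this[of n] have "moment_le (law n) q (\<lambda>s. \<Phi> 0 n h s - e) (L * (\<Sum>j\<le>n. \<delta> (n - j)))" by simp
  moreover have "L * (\<Sum>j\<le>n. \<delta> (n - j)) \<le> L * (2 * B)"
  proof (intro mult_left_mono L0)
    have "(\<Sum>j\<le>n. \<delta> (n - j)) = (\<Sum>t<Suc n. \<delta> t)"
      using sum.nat_diff_reindex[of \<delta> "Suc n"] by (simp add: lessThan_Suc_atMost)
    also have "\<dots> = B * (\<Sum>t<Suc n. 1 / (real t + 1)\<^sup>2)"
      by (simp add: \<delta>_def sum_distrib_left del: sum.lessThan_Suc)
    also have "\<dots> \<le> B * 2"
      using B(1) sum_inverse_squares_le[of "Suc n"]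
      by (intro mult_left_mono) (auto intro: order_trans)
    finally show "(\<Sum>j\<le>n. \<delta> (n - j)) \<le> 2 * B" by simp
  qed
  moreover have "0 \<le> L * (\<Sum>j\<le>n. \<delta> (n - j))"
    using L0 \<delta>[THEN less_imp_le] by (intro mult_nonneg_nonneg sum_nonneg) auto
  ultimately show ?thesis
    unfolding e_def[symmetric] L_def[symmetric] using q by (auto intro: moment_le_leI)
qed

lemma max_weight_moment_boundD:
  assumes b: "max_weight_moment_bound S \<tau>\<^sub>0 \<tau> g y n\<^sub>0 \<beta> M K c \<epsilon> q" and c: "0 \<le> c"
  shows "moment_le (law (r * n\<^sub>0)) q (max_pe_weight M K) (c * real M powr (- (1 - \<epsilon> / q)))"
proof -
  have P: "prob_space (law (r * n\<^sub>0))" using law_prob by (auto simp: space_prob_algebra)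
  then interpret P: prob_space "law (r * n\<^sub>0)" .
  have [measurable]: "max_pe_weight M K \<in> borel_measurable (law (r * n\<^sub>0))"
    by (rule measurable_prob[OF law_prob measurable_max_pe_weight])
  have bnd: "0 \<le> max_pe_weight M K s" "max_pe_weight M K s \<le> 1" if s: "s \<in> space C" for s
  proof -
    show "0 \<le> max_pe_weight M K s" using max_pe_weight_pos[OF s] by simp
    have "pe_weight K (snd s) m \<le> total_weight M K s" if "m \<in> {1..M}" for m
      unfolding total_weight_eq using that pe_weight_pos[OF s K, THEN less_imp_le]
      by (intro member_le_sum) auto
    then show "max_pe_weight M K s \<le> 1"
      using total_weight_pos[OF s] by (simp add: max_pe_weight_le_iff)
  qed
  \<comment> \<open>Normalised aggregates lie between 0 and 1, so the Bochner integral in the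
    hypothesis is a genuine expectation and equals the nonnegative integral.\<close>
  have "integrable (law (r * n\<^sub>0)) (\<lambda>s. \<bar>max_pe_weight M K s\<bar> powr q)"
    using bnd[OF space_prob[OF law_prob]] q
    by (intro P.integrable_const_bound[where B=1] AE_I2) (auto intro: powr_le1)
  then have "(\<integral>\<^sup>+s. ennreal (\<bar>max_pe_weight M K s\<bar> powr q) \<partial>law (r * n\<^sub>0))
     = ennreal (\<integral>s. \<bar>max_pe_weight M K s\<bar> powr q \<partial>law (r * n\<^sub>0))"
    by (intro nn_integral_eq_integral) auto
  also have "(\<integral>s. \<bar>max_pe_weight M K s\<bar> powr q \<partial>law (r * n\<^sub>0)) = (\<integral>s. max_pe_weight M K s powr q \<partial>law (r * n\<^sub>0))"
    using bnd[OF space_prob[OF law_prob]] by (intro Bochner_Integration.integral_cong) auto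
  also have "\<dots> \<le> c powr q / real M powr (q - \<epsilon>)"
    using b unfolding max_weight_moment_bound_def max_pe_weight_def by blast
  also have "c powr q / real M powr (q - \<epsilon>) = (c * real M powr (- (1 - \<epsilon> / q))) powr q"
  proof -
    have "- (1 - \<epsilon> / q) * q = - (q - \<epsilon>)" using q by (simp add: field_simps)
    then have "(c * real M powr (- (1 - \<epsilon> / q))) powr q = c powr q * real M powr (- (q - \<epsilon>))"
      using c by (simp add: powr_mult powr_powr)
    then show ?thesis by (simp only: powr_minus divide_inverse)
  qed
  finally show ?thesis by (simp add: moment_le_def ennreal_leI)
qed

text \<open>The aggregate cancels the local normaliser, leaving each particle its unnormalised
  weight over the total.\<close>

lemma \<Phi>_0:
  assumes s: "s \<in> space C" and h: "h \<in> bounded_functions S"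
  shows "(\<integral>x. h x \<partial>dpf_measure S M K s) = \<Phi> 0 n h s"
proof -
  have "(\<integral>x. h x \<partial>dpf_measure S M K s)
    = (\<Sum>m\<in>{1..M}. pe_weight K (snd s) m / total_weight M K s * (\<Sum>k\<in>{1..K}. local_weight K (snd s) (m, k) * h (fst s (m, k))))"
    unfolding normalized_pe_weight_eq[symmetric]
    by (rule integral_dpf_measure[OF s bounded_functions_measurable[OF h]])
  also have "\<dots> = (\<Sum>m\<in>{1..M}. \<Sum>k\<in>{1..K}. snd s (m, k) * h (fst s (m, k)) / total_weight M K s)"
  proof (rule sum.cong[OF refl])
    fix m assume "m \<in> {1..M}"
    then have "0 < pe_weight K (snd s) m" by (rule pe_weight_pos[OF s K])
    then show "pe_weight K (snd s) m / total_weight M K s * (\<Sum>k\<in>{1..K}. local_weight K (snd s) (m, k) * h (fst s (m, k)))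
      = (\<Sum>k\<in>{1..K}. snd s (m, k) * h (fst s (m, k)) / total_weight M K s)"
      by (simp add: sum_distrib_left local_weight_def)
  qed
  also have "\<dots> = \<Phi> 0 n h s"
    by (simp add: \<Phi>_def wsum_def total_weight_def sum_pe_index sum_divide_distrib)
  finally show ?thesis .
qed

lemma dpf_error_le:
  assumes h: "h \<in> bounded_functions S" and B: "0 < B"
      "\<And>T m x x'. x \<in> space S \<Longrightarrow> x' \<in> space S \<Longrightarrow> \<bar>U T m h x / G T m x - U T m h x' / G T m x'\<bar> \<le> B / (real T + 1)\<^sup>2"
    and b: "max_weight_moment_bound S \<tau>\<^sub>0 \<tau> g y n\<^sub>0 \<beta> M K c \<epsilon> q" "1 \<le> c" "0 \<le> \<epsilon>"
    and p: "1 \<le> p" "p \<le> q"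
  shows "dpf_error S \<tau>\<^sub>0 \<tau> g y n\<^sub>0 \<beta> M K p h n
    \<le> step_const * (1 + A) * sqrt ((A\<^sup>2) ^ Suc n\<^sub>0 * c) * (2 * B)
        / (real M powr (1/2 - \<epsilon> / (2 * q)) * sqrt (real K))"
proof -
  define R where "R = c * real M powr (- (1 - \<epsilon> / q))"
  define b where "b = (A\<^sup>2) ^ Suc n\<^sub>0 * R / real K"
  have M1: "1 \<le> real M" and K0: "0 < real K" using M K by auto
  \<comment> \<open>Together with \<open>c \<ge> 1\<close> this makes \<open>R\<close> cover the
    uniform aggregates 1/M at time 0.\<close>
  have MR: "1 / real M \<le> R"
  proof -
    have "1 / real M = real M powr (-1)" using M1 by (simp add: powr_minus_divide)
    also have "\<dots> \<le> real M powr (- (1 - \<epsilon> / q))" using M1 b(3) q by (intro powr_mono) auto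
    also have "\<dots> \<le> R" unfolding R_def using b(2) mult_right_mono[of 1 c "real M powr (- (1 - \<epsilon> / q))"] by simp
    finally show ?thesis .
  qed
  have "moment_le (law (r * n\<^sub>0)) q (max_pe_weight M K) R" for r
    unfolding R_def using b(2) by (intro max_weight_moment_boundD[OF b(1)]) simp
  then have w: "moment_le (law n) q (max_weight M K) b" for n
    unfolding b_def using MR by (rule law_max_weight)
  have R0: "0 < R" using MR M1 by (smt (verit) divide_pos_pos)
  have MK: "1 / (real M * real K) \<le> b"
  proof -
    have "1 * R \<le> (A\<^sup>2) ^ Suc n\<^sub>0 * R" using A R0 by (intro mult_right_mono one_le_power) auto
    then have "1 / real M / real K \<le> b" unfolding b_def using MR K0 by (intro divide_right_mono) auto
    then show ?thesis by simp
  qed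
  have b0: "0 < b" using R0 K0 A0 by (simp add: b_def)
  let ?Z = "\<lambda>s. \<Phi> 0 n h s - (\<integral>x. h x \<partial>filter_measure \<tau>\<^sub>0 \<tau> g y n)"
  have "lp_norm (law n) p ?Z \<le> step_const * (1 + A) * sqrt b * (2 * B)"
  proof (rule lp_norm_le[where q=q])
    show "prob_space (law n)" using law_prob by (auto simp: space_prob_algebra)
    show "moment_le (law n) q ?Z (step_const * (1 + A) * sqrt b * (2 * B))"
      unfolding integral_filter_measure[OF h] by (rule error_moment_le[OF h B w MK])
    show "?Z \<in> borel_measurable (law n)"
      using \<Phi>_measurable[OF h] by (intro measurable_prob[OF law_prob]) auto
  qed (use p step_const_pos A0 b0 B(1) in auto)
  moreover have "dpf_error S \<tau>\<^sub>0 \<tau> g y n\<^sub>0 \<beta> M K p h n = lp_norm (law n) p ?Z"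
    unfolding dpf_error_def lp_norm_def
    by (intro arg_cong[where f="\<lambda>x. x powr (1 / p)"] Bochner_Integration.integral_cong refl)
      (simp add: \<Phi>_0[OF space_prob[OF law_prob[of n]] h, where n=n])
  moreover have "sqrt b = sqrt ((A\<^sup>2) ^ Suc n\<^sub>0 * c) / (real M powr (1/2 - \<epsilon> / (2 * q)) * sqrt (real K))"
  proof -
    have "sqrt (real M powr (- (1 - \<epsilon> / q))) = real M powr (- (1 - \<epsilon> / q) * (1/2))"
      by (simp only: powr_half_sqrt[symmetric] powr_powr powr_ge_zero)
    also have "- (1 - \<epsilon> / q) * (1/2) = - (1/2 - \<epsilon> / (2 * q))" using q by (simp add: field_simps)
    finally have s: "sqrt (real M powr (- (1 - \<epsilon> / q))) = 1 / real M powr (1/2 - \<epsilon> / (2 * q))"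
      by (simp only: powr_minus divide_inverse mult_1_left)
    have "b = ((A\<^sup>2) ^ Suc n\<^sub>0 * c) * real M powr (- (1 - \<epsilon> / q)) / real K"
      by (simp only: b_def R_def mult.assoc)
    then have "sqrt b = sqrt ((A\<^sup>2) ^ Suc n\<^sub>0 * c) * sqrt (real M powr (- (1 - \<epsilon> / q))) / sqrt (real K)"
      by (simp only: real_sqrt_divide real_sqrt_mult)
    then show ?thesis unfolding s by (simp only: times_divide_eq_right mult_1_right divide_divide_eq_left)
  qed
  ultimately show ?thesis by (simp only: times_divide_eq_right times_divide_eq_left)
qed

end


section \<open>From exponential stability to the rate of convergence\<close>

lemma exp_neg_le_inverse_square:
  fixes \<nu> t :: real
  assumes "0 < \<nu>" "0 \<le> t"
  shows "exp (- \<nu> * t) \<le> 2 * exp \<nu> / \<nu>\<^sup>2 / (t + 1)\<^sup>2"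
proof -
  have "1 + \<nu> * (t + 1) + (\<nu> * (t + 1))\<^sup>2 / 2 \<le> exp (\<nu> * (t + 1))"
    using assms by (intro exp_lower_Taylor_quadratic) auto
  moreover have "0 \<le> \<nu> * (t + 1)" using assms by auto
  ultimately have "(\<nu> * (t + 1))\<^sup>2 / 2 \<le> exp (\<nu> * (t + 1))" by linarith
  then have "exp (- \<nu> * t) * ((\<nu> * (t + 1))\<^sup>2 / 2) \<le> exp (- \<nu> * t) * exp (\<nu> * (t + 1))"
    by (intro mult_left_mono) auto
  also have "\<dots> = exp \<nu>" by (simp add: exp_add[symmetric] algebra_simps)
  finally show ?thesis using assms by (simp add: power_mult_distrib pos_le_divide_eq mult_ac)
qed

lemma (in bounded_likelihood) forgetting_of_exponential_stability:
  assumes h: "h \<in> bounded_functions S" and \<nu>: "0 < \<nu>"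
    and stable: "\<And>\<alpha> \<eta> T. \<alpha> \<in> space (prob_algebra S) \<Longrightarrow> \<eta> \<in> space (prob_algebra S) \<Longrightarrow> T\<^sub>0 < T \<Longrightarrow>
      filter_gap \<tau> g y \<alpha> \<eta> h T < ereal (exp (- \<nu> * real T))"
  obtains B where "0 < B" "\<And>T m x x'. x \<in> space S \<Longrightarrow> x' \<in> space S \<Longrightarrow>
    \<bar>U T m h x / G T m x - U T m h x' / G T m x'\<bar> \<le> B / (real T + 1)\<^sup>2"
proof -
  obtain b where b: "0 < b" "\<And>x. x \<in> space S \<Longrightarrow> \<bar>h x\<bar> \<le> b"
    using h by (rule bounded_functionsE) (rule that)
  \<comment> \<open>The first entry handles the finitely many T up to \<open>T\<^sub>0\<close>,
    where only the trivial bound 2b is available; the second turns the exponential into the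
    quadratic rate.\<close>
  define B where "B = max (2 * b * (real T\<^sub>0 + 1)\<^sup>2) (2 * exp \<nu> / \<nu>\<^sup>2)"
  show thesis
  proof (rule that)
    show "0 < B" using \<nu> by (simp add: B_def less_max_iff_disj)
    fix T m x x' assume x: "x \<in> space S" "x' \<in> space S"
    let ?d = "(\<integral>x. h x \<partial>filter_comp \<tau> g y (m + T) m (return S x)) - (\<integral>x. h x \<partial>filter_comp \<tau> g y (m + T) m (return S x'))"
    have "\<bar>?d\<bar> \<le> B / (real T + 1)\<^sup>2"
    proof (cases "T\<^sub>0 < T")
      case True
      have "ereal \<bar>?d\<bar> \<le> filter_gap \<tau> g y (return S x) (return S x') h T"
        unfolding filter_gap_def by (rule SUP_upper) simp
      also have "\<dots> < ereal (exp (- \<nu> * real T))" using True x by (intro stable return_prob)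
      finally have "\<bar>?d\<bar> \<le> exp (- \<nu> * real T)" by simp
      also have "\<dots> \<le> 2 * exp \<nu> / \<nu>\<^sup>2 / (real T + 1)\<^sup>2" using \<nu> by (intro exp_neg_le_inverse_square) auto
      also have "\<dots> \<le> B / (real T + 1)\<^sup>2" by (intro divide_right_mono) (auto simp: B_def)
      finally show ?thesis .
    next
      case False
      have "\<bar>\<integral>x. h x \<partial>filter_comp \<tau> g y (m + T) m (return S z)\<bar> \<le> b" if "z \<in> space S" for z
        using that h b(2) by (intro integral_prob_abs_le[OF filter_comp_prob[OF return_prob]]) auto
      from this[OF x(1)] this[OF x(2)] have "\<bar>?d\<bar> \<le> 2 * b" by linarith
      also have "\<dots> = 2 * b * (real T + 1)\<^sup>2 / (real T + 1)\<^sup>2" by (simp add: add_nonneg_eq_0_iff)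
      also have "\<dots> \<le> B / (real T + 1)\<^sup>2"
      proof (intro divide_right_mono)
        have "(real T + 1)\<^sup>2 \<le> (real T\<^sub>0 + 1)\<^sup>2" using False by (intro power_mono) auto
        then have "2 * b * (real T + 1)\<^sup>2 \<le> 2 * b * (real T\<^sub>0 + 1)\<^sup>2" using b(1) by (intro mult_left_mono) auto
        then show "2 * b * (real T + 1)\<^sup>2 \<le> B" by (simp add: B_def)
      qed simp
      finally show ?thesis .
    qed
    then show "\<bar>U T m h x / G T m x - U T m h x' / G T m x'\<bar> \<le> B / (real T + 1)\<^sup>2"
      by (simp only: integral_filter_comp_return[OF x(1) h] integral_filter_comp_return[OF x(2) h])
  qed
qed

lemma max_weight_moment_bound_mono:
  assumes "max_weight_moment_bound S \<tau>\<^sub>0 \<tau> g y n\<^sub>0 \<beta> M K c \<epsilon> q" "0 \<le> c" "c \<le> c'" "0 \<le> q"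
  shows "max_weight_moment_bound S \<tau>\<^sub>0 \<tau> g y n\<^sub>0 \<beta> M K c' \<epsilon> q"
proof -
  have "c powr q / real M powr (q - \<epsilon>) \<le> c' powr q / real M powr (q - \<epsilon>)"
    using assms by (intro divide_right_mono powr_mono2) auto
  with assms(1) show ?thesis unfolding max_weight_moment_bound_def by (blast intro: order_trans)
qed

text \<open>Independence of M and K is expressed by the order of quantifiers: \<zeta> and
  \<open>C\<close> follow \<open>h\<close> and \<open>p\<close> but precede K and M. The rate and
  the threshold in time are functions of \<open>h\<close> alone, because \<zeta> refers to the rate
  without mentioning initial measures. The supremum is taken in \<open>ereal\<close>, so its
  finiteness is part of the claim.\<close>

theorem theorem2:
  fixes X :: "(real ^ 'dx) set"
    and \<tau>\<^sub>0 :: "(real ^ 'dx) measure"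
    and \<tau> :: "nat \<Rightarrow> real ^ 'dx \<Rightarrow> (real ^ 'dx) measure"
    and g :: "nat \<Rightarrow> real ^ 'dy \<Rightarrow> real ^ 'dx \<Rightarrow> real"
    and y :: "nat \<Rightarrow> real ^ 'dy"
    and n\<^sub>0 :: nat
    and \<beta> :: "nat \<Rightarrow> nat \<Rightarrow> nat \<times> nat \<Rightarrow> nat \<times> nat"
    and a :: "nat \<Rightarrow> real"
    and c \<epsilon> q :: real
    and \<nu> :: "(real ^ 'dx \<Rightarrow> real) \<Rightarrow> real"
    and T\<^sub>0 :: "(real ^ 'dx \<Rightarrow> real) \<Rightarrow> nat"
  assumes model: "state_space_model (borel_on X) \<tau>\<^sub>0 \<tau> g"
    and period: "1 \<le> n\<^sub>0"
    and exchange_map: "\<And>M K. 1 \<le> M \<Longrightarrow> 1 \<le> K \<Longrightarrow> bij_betw (\<beta> M K) (pe_index M K) (pe_index M K)"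
    and a_pos: "\<And>n. 0 < a n"
    and a_bounded: "bdd_above (range a)"
    and likelihood_bounds:
      "\<And>n x. 1 \<le> n \<Longrightarrow> x \<in> X \<Longrightarrow> 1 / a n \<le> g n (y n) x \<and> g n (y n) x \<le> a n"
    and stability_finite:
      "\<And>\<alpha> \<eta> h T. \<alpha> \<in> space (prob_algebra (borel_on X)) \<Longrightarrow> \<eta> \<in> space (prob_algebra (borel_on X)) \<Longrightarrow>
        h \<in> bounded_functions (borel_on X) \<Longrightarrow> filter_gap \<tau> g y \<alpha> \<eta> h T < \<infinity>"
    and stability_limit:
      "\<And>\<alpha> \<eta> h. \<alpha> \<in> space (prob_algebra (borel_on X)) \<Longrightarrow> \<eta> \<in> space (prob_algebra (borel_on X)) \<Longrightarrow>
        h \<in> bounded_functions (borel_on X) \<Longrightarrow> (\<lambda>T. filter_gap \<tau> g y \<alpha> \<eta> h T) \<longlonglongrightarrow> 0"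
    and constants: "0 \<le> c" "0 \<le> \<epsilon>" "\<epsilon> < 1" "4 \<le> q"
    and \<nu>_pos: "\<And>h. h \<in> bounded_functions (borel_on X) \<Longrightarrow> 0 < \<nu> h"
    and exponential_stability:
      "\<And>\<alpha> \<eta> h T. \<alpha> \<in> space (prob_algebra (borel_on X)) \<Longrightarrow> \<eta> \<in> space (prob_algebra (borel_on X)) \<Longrightarrow>
        h \<in> bounded_functions (borel_on X) \<Longrightarrow> T\<^sub>0 h < T \<Longrightarrow>
        filter_gap \<tau> g y \<alpha> \<eta> h T < ereal (exp (- \<nu> h * real T))"
  shows "\<forall>h \<in> bounded_functions (borel_on X). \<forall>p. 1 \<le> p \<and> p \<le> q \<longrightarrow>
    (\<exists>\<zeta>>0. \<exists>C. \<forall>K\<ge>1.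
       (\<forall>M\<ge>1. max_weight_moment_bound (borel_on X) \<tau>\<^sub>0 \<tau> g y n\<^sub>0 (\<beta> M K) M K c \<epsilon> q) \<longrightarrow>
       (\<forall>M\<ge>1. (SUP n. ereal (dpf_error (borel_on X) \<tau>\<^sub>0 \<tau> g y n\<^sub>0 (\<beta> M K) M K p h n))
                \<le> ereal (C / (real M powr \<zeta> * sqrt (real K))))) \<and>
    (\<forall>\<Upsilon> \<in> {(1 + \<epsilon>) / q <..< 1 / 2 - (1 + \<epsilon>) / q}. \<forall>\<zeta>.
       \<zeta> = min 1 (\<nu> h / (1 + ln (SUP n. a n))) * \<Upsilon> \<longrightarrow>
       \<zeta> > 0 \<and>
       (\<exists>C. \<forall>K\<ge>1.
          (\<forall>M\<ge>1. max_weight_moment_bound (borel_on X) \<tau>\<^sub>0 \<tau> g y n\<^sub>0 (\<beta> M K) M K c \<epsilon> q) \<longrightarrow>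
          (\<forall>M\<ge>1. (SUP n. ereal (dpf_error (borel_on X) \<tau>\<^sub>0 \<tau> g y n\<^sub>0 (\<beta> M K) M K p h n))
                   \<le> ereal (C / (real M powr \<zeta> * sqrt (real K))))))"
proof -
  let ?S = "borel_on X"
  interpret state_space_model ?S \<tau>\<^sub>0 \<tau> g by (rule model)
  define A where "A = (SUP n. a n)"
  have aA: "a n \<le> A" for n unfolding A_def using a_bounded by (intro cSUP_upper) auto
  have "prob_space \<tau>\<^sub>0" "sets \<tau>\<^sub>0 = sets ?S" using prior by (auto simp: space_prob_algebra)
  then have "space ?S \<noteq> {}" using prob_space.not_empty sets_eq_imp_space_eq by blast
  then obtain x where x: "x \<in> X" by (auto simp: space_restrict_space)
  \<comment> \<open>At any point of the nonempty state space the likelihood lies between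
    \<open>1 / a 1\<close> and \<open>a 1\<close>, which forces \<open>a 1 \<ge> 1\<close>.\<close>
  have A: "1 \<le> A"
  proof -
    have "1 / a 1 \<le> a 1" using likelihood_bounds[of 1 x] x by (auto intro: order_trans)
    then have "1 \<le> a 1 * a 1" using a_pos[of 1] by (simp add: divide_le_eq)
    then have "1 \<le> a 1" using a_pos[of 1] by (smt (verit) mult_le_one mult_less_cancel_left2)
    with aA[of 1] show ?thesis by simp
  qed
  interpret bounded_likelihood ?S \<tau>\<^sub>0 \<tau> g y A
  proof unfold_locales
    fix n :: nat and x assume n: "1 \<le> n" and "x \<in> space ?S"
    then have "1 / a n \<le> g n (y n) x \<and> g n (y n) x \<le> a n"
      by (intro likelihood_bounds) (auto simp: space_restrict_space)
    moreover have "1 / A \<le> 1 / a n" using aA[of n] a_pos[of n] by (intro divide_left_mono) auto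
    ultimately show "1 / A \<le> g n (y n) x \<and> g n (y n) x \<le> A" using aA[of n] by linarith
  qed (rule A)
  interpret forgetting ?S \<tau>\<^sub>0 \<tau> g y A
  proof unfold_locales
    fix h assume h: "h \<in> bounded_functions ?S"
    show "\<exists>B. \<forall>T m. \<forall>x\<in>space ?S. \<forall>x'\<in>space ?S.
        \<bar>U T m h x / G T m x - U T m h x' / G T m x'\<bar> \<le> B / (real T + 1)\<^sup>2"
      by (rule forgetting_of_exponential_stability[OF h \<nu>_pos[OF h] exponential_stability[OF _ _ h]]) blast+
  qed
  obtain D where D: "1 \<le> D" "\<And>T m x x'. x \<in> space ?S \<Longrightarrow> x' \<in> space ?S \<Longrightarrow> G T m x \<le> D * G T m x'"
    using likelihood_ratio_bounded by blast
  show ?thesis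
  proof (intro ballI allI impI)
    fix h p assume h: "h \<in> bounded_functions ?S" and p: "1 \<le> p \<and> p \<le> q"
    obtain B where B: "0 < B" "\<And>T m x x'. x \<in> space ?S \<Longrightarrow> x' \<in> space ?S \<Longrightarrow>
        \<bar>U T m h x / G T m x - U T m h x' / G T m x'\<bar> \<le> B / (real T + 1)\<^sup>2"
      by (rule forgetting_of_exponential_stability[OF h \<nu>_pos[OF h] exponential_stability[OF _ _ h]]) blast+
    \<comment> \<open>The factor \<open>c + 1\<close> replaces \<open>c\<close> to meet the
      requirement \<open>1 \<le> c\<close> of \<open>dpf_error_le\<close>; everything here is fixed
      before M and K.\<close>
    define c' where "c' = 4 * (A\<^sup>2 * D\<^sup>2) * moment_const q * (1 + A) * sqrt ((A\<^sup>2) ^ Suc n\<^sub>0 * (c + 1)) * (2 * B)"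
    have c'0: "0 \<le> c'" using A B(1) constants moment_const_pos[of q] by (simp add: c'_def)
    have rate: "(SUP n. ereal (dpf_error ?S \<tau>\<^sub>0 \<tau> g y n\<^sub>0 (\<beta> M K) M K p h n))
        \<le> ereal (c' / (real M powr \<zeta> * sqrt (real K)))"
      if MK: "1 \<le> M" "1 \<le> K" and w: "max_weight_moment_bound ?S \<tau>\<^sub>0 \<tau> g y n\<^sub>0 (\<beta> M K) M K c \<epsilon> q"
        and \<zeta>: "\<zeta> \<le> 1/2 - \<epsilon> / (2 * q)" for M K \<zeta>
    proof (rule SUP_least)
      fix n :: nat
      interpret distributed_filter ?S \<tau>\<^sub>0 \<tau> g y A M K D q n\<^sub>0 "\<beta> M K"
        using MK D constants period exchange_map[OF MK] by unfold_locales auto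
      have "dpf_error ?S \<tau>\<^sub>0 \<tau> g y n\<^sub>0 (\<beta> M K) M K p h n
          \<le> step_const * (1 + A) * sqrt ((A\<^sup>2) ^ Suc n\<^sub>0 * (c + 1)) * (2 * B)
              / (real M powr (1/2 - \<epsilon> / (2 * q)) * sqrt (real K))"
        using p constants by (intro dpf_error_le[OF h B max_weight_moment_bound_mono[OF w]]) auto
      also have "\<dots> = c' / (real M powr (1/2 - \<epsilon> / (2 * q)) * sqrt (real K))"
        by (simp only: c'_def step_const_def)
      also have "\<dots> \<le> c' / (real M powr \<zeta> * sqrt (real K))"
        using c'0 \<zeta> MK by (intro divide_left_mono mult_right_mono powr_mono) auto
      finally show "ereal (dpf_error ?S \<tau>\<^sub>0 \<tau> g y n\<^sub>0 (\<beta> M K) M K p h n)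
          \<le> ereal (c' / (real M powr \<zeta> * sqrt (real K)))" by simp
    qed
    \<comment> \<open>With \<epsilon> < 1 and q \<ge> 4 the attained exponent is at least 3/8, so
      1/4 is a valid witness for the first claim.\<close>
    have \<epsilon>q: "\<epsilon> / (2 * q) \<le> 1 / 8"
      using constants by (simp add: field_simps)
    have "\<exists>\<zeta>>0. \<exists>C. \<forall>K\<ge>1.
       (\<forall>M\<ge>1. max_weight_moment_bound ?S \<tau>\<^sub>0 \<tau> g y n\<^sub>0 (\<beta> M K) M K c \<epsilon> q) \<longrightarrow>
       (\<forall>M\<ge>1. (SUP n. ereal (dpf_error ?S \<tau>\<^sub>0 \<tau> g y n\<^sub>0 (\<beta> M K) M K p h n))
                \<le> ereal (C / (real M powr \<zeta> * sqrt (real K))))"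
      by (rule exI[of _ "1/4"], rule conjI, simp, rule exI[of _ c'])
        (use \<epsilon>q in \<open>auto intro!: rate\<close>)
    moreover have "\<zeta> > 0 \<and> (\<exists>C. \<forall>K\<ge>1.
          (\<forall>M\<ge>1. max_weight_moment_bound ?S \<tau>\<^sub>0 \<tau> g y n\<^sub>0 (\<beta> M K) M K c \<epsilon> q) \<longrightarrow>
          (\<forall>M\<ge>1. (SUP n. ereal (dpf_error ?S \<tau>\<^sub>0 \<tau> g y n\<^sub>0 (\<beta> M K) M K p h n))
                   \<le> ereal (C / (real M powr \<zeta> * sqrt (real K)))))"
      if \<Upsilon>: "\<Upsilon> \<in> {(1 + \<epsilon>) / q <..< 1 / 2 - (1 + \<epsilon>) / q}"
        and \<zeta>: "\<zeta> = min 1 (\<nu> h / (1 + ln (SUP n. a n))) * \<Upsilon>" for \<Upsilon> \<zeta>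
    proof -
      have "0 < (1 + \<epsilon>) / q" using constants by simp
      then have \<Upsilon>0: "0 < \<Upsilon>" using \<Upsilon> by simp
      have "0 \<le> ln A" using A by simp
      then have "0 < \<nu> h / (1 + ln A)" using \<nu>_pos[OF h] by simp
      then have "0 < \<zeta>" using \<Upsilon>0 unfolding \<zeta> A_def[symmetric] by simp
      moreover have "\<zeta> \<le> 1/2 - \<epsilon> / (2 * q)"
      proof -
        have "\<zeta> \<le> 1 * \<Upsilon>" unfolding \<zeta> using \<Upsilon>0 by (intro mult_right_mono) auto
        moreover have "\<epsilon> / (2 * q) \<le> (1 + \<epsilon>) / q" using constants by (intro frac_le) auto
        ultimately show ?thesis using \<Upsilon> by simp
      qed
      ultimately show ?thesis by (auto intro!: exI[of _ c'] rate)
    qed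
    ultimately show "(\<exists>\<zeta>>0. \<exists>C. \<forall>K\<ge>1.
       (\<forall>M\<ge>1. max_weight_moment_bound ?S \<tau>\<^sub>0 \<tau> g y n\<^sub>0 (\<beta> M K) M K c \<epsilon> q) \<longrightarrow>
       (\<forall>M\<ge>1. (SUP n. ereal (dpf_error ?S \<tau>\<^sub>0 \<tau> g y n\<^sub>0 (\<beta> M K) M K p h n))
                \<le> ereal (C / (real M powr \<zeta> * sqrt (real K))))) \<and>
      (\<forall>\<Upsilon> \<in> {(1 + \<epsilon>) / q <..< 1 / 2 - (1 + \<epsilon>) / q}. \<forall>\<zeta>.
       \<zeta> = min 1 (\<nu> h / (1 + ln (SUP n. a n))) * \<Upsilon> \<longrightarrow>
       \<zeta> > 0 \<and>
       (\<exists>C. \<forall>K\<ge>1.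
          (\<forall>M\<ge>1. max_weight_moment_bound ?S \<tau>\<^sub>0 \<tau> g y n\<^sub>0 (\<beta> M K) M K c \<epsilon> q) \<longrightarrow>
          (\<forall>M\<ge>1. (SUP n. ereal (dpf_error ?S \<tau>\<^sub>0 \<tau> g y n\<^sub>0 (\<beta> M K) M K p h n))
                   \<le> ereal (C / (real M powr \<zeta> * sqrt (real K))))))"
      by blast
  qed
qed

end
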